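(* Let $s\in\mathbb{C}$. The solutions $h$ of the Schwarzian equation $\{h,\tau\}=s\,E_4(\tau)$ on $\mathfrak{H}$ are modular functions if and only if $s=2\pi^2(n/m)^2$ with $m,n$ positive integers satisfying $2\le m\le 5$ and $\gcd(m,n)=1$. In that case the invariance group of the solutions is the principal congruence subgroup $\Gamma(m)$ (up to $\pm I_2$, i.e. its image in $\mathrm{PSL}_2(\mathbb{Z})$ is that of $\Gamma(m)$).
   Context: $\mathfrak{H}=\{\tau\in\mathbb{C}:\Im\tau>0\}$. For a non-constant meromorphic function $h$, the Schwarz derivative is $\{h,\tau\}=\frac{h'''}{h'}-\frac32\left(\frac{h''}{h'}\right)^2$. $E_4(\tau)=1+240\sum_{n\ge1}\sigma_3(n)q^n$, $q=e^{2\pi i\tau}$, is the weight 4 Eisenstein series, $\sigma_3(n)$ the sum of cubes of positive divisors of $n$. $\mathrm{SL}_2(\mathbb{Z})$ acts on $\mathfrak{H}$ by linear fractional transformations. The invariance group of a meromorphic function $h$ on $\mathfrak{H}$ is $\{\gamma\in\mathrm{SL}_2(\mathbb{Z}): h(\gamma\tau)=h(\tau)\ \forall\tau\}$. A modular function is a meromorphic function on $\mathfrak{H}$ whose invariance group has finite index in $\mathrm{SL}_2(\mathbb{Z})$ and which is meromorphic at all cusps. $\Gamma(m)=\{\gamma\in\mathrm{SL}_2(\mathbb{Z}):\gamma\equiv I_2 \bmod m\}$. *)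

theory Defs
  imports
    "HOL-Complex_Analysis.Complex_Analysis"
    "HOL-Algebra.Coset"
    "HOL-Number_Theory.Cong"
begin

definition upper_half_plane :: "complex set" where
  "upper_half_plane = {\<tau>. Im \<tau> > 0}"

definition sigma3 :: "nat \<Rightarrow> nat" where
  "sigma3 n = (\<Sum>d | d dvd n. d ^ 3)"

(* The series is summed over n \<ge> 1, hence the shift n \<mapsto> Suc n. *)
definition E4 :: "complex \<Rightarrow> complex" where
  "E4 \<tau> = 1 + 240 * (\<Sum>n. of_nat (sigma3 (Suc n)) * exp (2 * of_real pi * \<i> * \<tau>) ^ Suc n)"

definition schwarz_deriv :: "(complex \<Rightarrow> complex) \<Rightarrow> complex \<Rightarrow> complex" where
  "schwarz_deriv h \<tau> =
     (deriv ^^ 3) h \<tau> / deriv h \<tau> - 3 / 2 * ((deriv ^^ 2) h \<tau> / deriv h \<tau>)\<^sup>2"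

(* A meromorphic function is represented by its normal form (nicely_meromorphic_on): continuous off
   the poles and 0 at the poles.  The differential equation is an identity of meromorphic
   functions, i.e. it holds off a discrete subset of the upper half plane; the poles of h and the
   zeros of h' have to be left out because deriv and division are total. *)
definition schwarz_solution :: "complex \<Rightarrow> (complex \<Rightarrow> complex) \<Rightarrow> bool" where
  "schwarz_solution s h \<longleftrightarrow>
     h nicely_meromorphic_on upper_half_plane \<and>
     \<not> h constant_on upper_half_plane \<and>
     (\<forall>\<^sub>\<approx>\<tau>\<in>upper_half_plane. schwarz_deriv h \<tau> = s * E4 \<tau>)"

definition SL2Z :: "(int ^ 2 ^ 2) monoid" where
  "SL2Z = \<lparr>carrier = {A. det A = 1}, mult = (**), one = mat 1\<rparr>"

definition mobius :: "int ^ 2 ^ 2 \<Rightarrow> complex \<Rightarrow> complex" where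
  "mobius A \<tau> =
     (of_int (A $ 1 $ 1) * \<tau> + of_int (A $ 1 $ 2)) / (of_int (A $ 2 $ 1) * \<tau> + of_int (A $ 2 $ 2))"

(* For functions in normal form, pointwise equality is equality of meromorphic functions: the value
   0 at a pole cannot be mistaken for a zero, since the functions then differ nearby. *)
definition invariance_group :: "(complex \<Rightarrow> complex) \<Rightarrow> (int ^ 2 ^ 2) set" where
  "invariance_group h =
     {A \<in> carrier SL2Z. \<forall>\<tau>\<in>upper_half_plane. h (mobius A \<tau>) = h \<tau>}"

(* The cusps are the points A(\<infinity>) with A in SL2(Z).  Meromorphy at A(\<infinity>) means that, near
   \<infinity>, h(A \<tau>) is a function of the local parameter exp(2 pi i \<tau> / N), for some
   N \<ge> 1, that has at most a pole at 0. *)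
definition meromorphic_at_cusp :: "(complex \<Rightarrow> complex) \<Rightarrow> int ^ 2 ^ 2 \<Rightarrow> bool" where
  "meromorphic_at_cusp h A \<longleftrightarrow>
     (\<exists>N::nat. \<exists>g. \<exists>C>0. N > 0 \<and> g meromorphic_on {0} \<and>
        (\<forall>\<tau>. Im \<tau> > C \<longrightarrow>
           h (mobius A \<tau>) = g (exp (2 * of_real pi * \<i> * \<tau> / of_nat N))))"

definition modular_function :: "(complex \<Rightarrow> complex) \<Rightarrow> bool" where
  "modular_function h \<longleftrightarrow>
     h nicely_meromorphic_on upper_half_plane \<and>
     finite (rcosets\<^bsub>SL2Z\<^esub> (invariance_group h)) \<and>
     (\<forall>A\<in>carrier SL2Z. meromorphic_at_cusp h A)"

definition principal_congruence_subgroup :: "nat \<Rightarrow> (int ^ 2 ^ 2) set" where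
  "principal_congruence_subgroup m =
     {A \<in> carrier SL2Z. \<forall>i j. [A $ i $ j = mat 1 $ i $ j] (mod int m)}"

(* The projection of SL2(Z) onto PSL2(Z), the quotient group SL2Z Mod {mat 1, - mat 1}. *)
definition to_PSL2Z :: "int ^ 2 ^ 2 \<Rightarrow> (int ^ 2 ^ 2) set" where
  "to_PSL2Z A = {mat 1, - mat 1} #>\<^bsub>SL2Z\<^esub> A"

end

theory Submission
  imports Defs
begin

text \<open>
  Quotients of two independent solutions of the linear equation \<open>y'' = - (s / 2) E4 y\<close> solve the
  Schwarzian equation, and every solution arises in this way. Since E4 has weight 4, the
  weight -1 slash operator of SL2(Z) acts on the two-dimensional space of linear solutions, and
  the invariance group of every Schwarzian solution is the normal subgroup K of those matrices
  that act as scalars. Write \<open>s = 2 \<pi>\<^sup>2 r\<^sup>2\<close>. The exponents of the linear equation at the cusp are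
  \<open>\<plusminus> r / 2\<close>, so for \<open>r = n / m\<close> in lowest terms, m > 1, the translation T has order exactly m modulo K,
  and elliptic elements never lie in K because Schwarzian solutions are locally injective.

  For \<open>2 \<le> m \<le> 5\<close> a Euclidean descent with transvections conjugate to powers of \<open>T\<^sup>m\<close> shows
  that K contains \<Gamma>(m). Modulo m every matrix is, up to sign, conjugate to an elliptic matrix or to a power
  of T, hence K is not larger than \<open>\<plusminus>\<Gamma>(m)\<close>.

  Conversely, let K have finite index. Then a power of T is scalar, so r is rational, and an integral r would
  put T, hence all of SL2(Z), into K. For \<open>m \<ge> 6\<close> the finite image of SL2(Z) is unitary and
  contains a rotation by the angle \<open>2 \<pi> / m \<le> \<pi> / 3\<close>. Rotating the axis nearest to that of T about
  the axis of T would give a still nearer one, so that all conjugates of T share their axis and S acts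
  diagonally. Then \<open>|y\<^sup>4 E4|\<close> is invariant under SL2(Z) for the linear solution y with exponent r / 2
  and vanishes at the cusp, which contradicts the maximum principle.
\<close>

section \<open>The Eisenstein series E4 is modular\<close>

text \<open>The linear solutions must exist on the whole half plane before a Schwarzian solution can
  be compared with them. Explicit series at the cusp provide them: y = e^(pi i r tau) phi(q) with
  phi convergent in the unit disc. All other solutions follow by Cramer's rule from constant
  Wronskians, so neither analytic continuation along paths nor monodromy enters.

  If r is not an integer, the series for r and -r form a basis. For a positive integer r the second
  series is resonant, and the S-translate of the first solution replaces it; that the two are
  independent is once more the maximum principle. For r = 0 the basis 1, tau is written down.

  The bound 5 arises twice, for unrelated reasons. The intervals of the descent cover all fractions
  that occur only up to m = 5, and from m = 6 on the rotation by 2 pi / m is small enough to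
  contract distances between axes.

  The exponent in y^4 E4 balances weight -1 against weight 4. The transformation law of E4 is
  derived here from the lattice sum of weight 4, whose absolute convergence permits every
  rearrangement.\<close>

lemma derivs_eq_on_open:
  assumes "open S" "z \<in> S" "\<And>w. w \<in> S \<Longrightarrow> f w = g w"
    and "(f has_field_derivative f') (at z)" "(g has_field_derivative g') (at z)"
  shows "f' = (g' :: complex)"
proof -
  have "(f has_field_derivative g') (at z)"
    by (rule has_field_derivative_transform_within_open[OF assms(5,1,2)]) (use assms(3) in auto)
  thus ?thesis using assms(4) DERIV_unique by blast
qed

section \<open>Reflection for Polygamma functions and the value zeta(4)\<close>

lemma notin_Ints_imp_notin_nonpos_Ints: "z \<notin> \<int> \<Longrightarrow> z \<notin> \<int>\<^sub>\<le>\<^sub>0 \<and> 1 - z \<notin> \<int>\<^sub>\<le>\<^sub>0" for z :: complex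
proof -
  assume z: "z \<notin> \<int>"
  have "1 - z \<notin> \<int>" using z by (metis Ints_1 Ints_diff add_diff_cancel_left' diff_add_cancel diff_diff_eq2)
  thus ?thesis using z nonpos_Ints_Int by blast
qed

lemma sin_pi_nonzero: "z \<notin> \<int> \<Longrightarrow> sin (of_real pi * z) \<noteq> 0" for z :: complex
proof
  assume z: "z \<notin> \<int>" and "sin (of_real pi * z) = 0"
  then obtain n where "of_real pi * z = of_real (real_of_int n * pi)"
    by (auto simp: sin_eq_0)
  hence "z = of_int n" by simp
  thus False using z by simp
qed

text \<open>The logarithmic derivative of the reflection formula. It is taken for
  \<open>rGamma\<close>, which is entire, so that no function with poles has to be
  differentiated.\<close>

lemma Digamma_reflection:
  fixes z :: complex
  assumes z: "z \<notin> \<int>"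
  shows "Digamma (1 - z) - Digamma z = of_real pi * cot (of_real pi * z)"
proof -
  note nz = notin_Ints_imp_notin_nonpos_Ints[OF z]
  let ?l = "\<lambda>z::complex. rGamma z * rGamma (1 - z)"
  have op: "open (- \<int> :: complex set)" by (simp add: closed_Ints open_Compl)
  have 1: "(?l has_field_derivative (rGamma z * rGamma (1 - z)) * (Digamma (1 - z) - Digamma z)) (at z)"
    using nz by (auto intro!: derivative_eq_intros simp: algebra_simps)
  have 2: "((\<lambda>z. sin (of_real pi * z) / of_real pi) has_field_derivative cos (of_real pi * z)) (at z)"
    by (auto intro!: derivative_eq_intros)
  have eq: "?l w = sin (of_real pi * w) / of_real pi" for w :: complex
    using rGamma_reflection_complex[of w] by simp
  have "(rGamma z * rGamma (1 - z)) * (Digamma (1 - z) - Digamma z) = cos (of_real pi * z)"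
    by (rule derivs_eq_on_open[OF op _ _ 1 2]) (use z eq in auto)
  thus ?thesis using sin_pi_nonzero[OF z] by (simp add: eq cot_def field_simps)
qed

text \<open>Differentiates the Digamma reflection three times. The derivatives of the cotangent are
  parameters because two closed forms are used: a trigonometric one for the value at 1/2 and a
  q-series in the upper half plane.\<close>

lemma Polygamma3_reflection_derivs:
  assumes S: "open S" "S \<subseteq> - \<int>"
    and g: "\<And>z. z \<in> S \<Longrightarrow> of_real pi * cot (of_real pi * z) = g0 z"
    and d1: "\<And>z. z \<in> S \<Longrightarrow> (g0 has_field_derivative g1 z) (at z)"
    and d2: "\<And>z. z \<in> S \<Longrightarrow> (g1 has_field_derivative g2 z) (at z)"
    and d3: "\<And>z. z \<in> S \<Longrightarrow> (g2 has_field_derivative g3 z) (at z)"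
    and z: "z \<in> S"
  shows "Polygamma 3 (z::complex) + Polygamma 3 (1 - z) = - g3 z"
proof -
  have nz: "w \<notin> \<int>\<^sub>\<le>\<^sub>0" "1 - w \<notin> \<int>\<^sub>\<le>\<^sub>0" if "w \<in> S" for w
    using notin_Ints_imp_notin_nonpos_Ints[of w] that S by auto
  have 0: "Digamma (1 - w) - Digamma w = g0 w" if "w \<in> S" for w
    using Digamma_reflection[of w] g[of w] that S by auto
  have 1: "- Polygamma 1 (1 - w) - Polygamma 1 w = g1 w" if w: "w \<in> S" for w
  proof (rule derivs_eq_on_open[OF S(1) w 0])
    show "((\<lambda>w. Digamma (1 - w) - Digamma w) has_field_derivative - Polygamma 1 (1 - w) - Polygamma 1 w) (at w)"
      using nz[OF w] by (auto intro!: derivative_eq_intros)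
  qed (use d1 w in auto)
  have 2: "Polygamma 2 (1 - w) - Polygamma 2 w = g2 w" if w: "w \<in> S" for w
  proof (rule derivs_eq_on_open[OF S(1) w 1])
    show "((\<lambda>w. - Polygamma 1 (1 - w) - Polygamma 1 w) has_field_derivative Polygamma 2 (1 - w) - Polygamma 2 w) (at w)"
      using nz[OF w] by (auto intro!: derivative_eq_intros simp: numeral_2_eq_2)
  qed (use d2 w in auto)
  have "- Polygamma 3 (1 - z) - Polygamma 3 z = g3 z"
  proof (rule derivs_eq_on_open[OF S(1) z 2])
    show "((\<lambda>w. Polygamma 2 (1 - w) - Polygamma 2 w) has_field_derivative - Polygamma 3 (1 - z) - Polygamma 3 z) (at z)"
      using nz[OF z] by (auto intro!: derivative_eq_intros simp: numeral_2_eq_2 numeral_3_eq_3)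
  qed (use d3 z in auto)
  from this[symmetric] show ?thesis by simp
qed

text \<open>At 1/2 the two arguments of the reflection coincide, so it determines the value itself.
  The sum of 1 / (n + 1/2)^4 obtained in this way gives zeta(4).\<close>

lemma Polygamma3_half: "Polygamma 3 (1/2 :: complex) = of_real pi ^ 4"
proof -
  let ?p = "of_real pi :: complex"
  have op: "open (- \<int> :: complex set)" by (simp add: closed_Ints open_Compl)
  have half: "(1/2::complex) \<notin> \<int>"
  proof
    assume "(1/2::complex) \<in> \<int>"
    then obtain k where "(1/2::complex) = of_int k" by (elim Ints_cases)
    hence "(1::complex) = of_int (2 * k)" by (simp add: field_simps)
    hence "(of_int 1 :: complex) = of_int (2 * k)" by simp
    hence "1 = 2 * k" by (subst (asm) of_int_eq_iff)
    thus False by presburger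
  qed
  have "Polygamma 3 (1/2 :: complex) + Polygamma 3 (1 - 1/2) =
    - (\<lambda>z. - (?p^4) * (2 / sin (?p*z)^2 + 6 * cos (?p*z)^2 / sin (?p*z)^4)) (1/2)"
  proof (rule Polygamma3_reflection_derivs[OF op order_refl refl])
    fix z :: complex assume "z \<in> - \<int>"
    hence s: "sin (?p * z) \<noteq> 0" using sin_pi_nonzero[of z] by auto
    have c2: "cos (?p*z)^2 = 1 - sin (?p*z)^2" using sin_cos_squared_add[of "?p*z"] by (simp add: algebra_simps)
    show "((\<lambda>z. ?p * cot (?p*z)) has_field_derivative (\<lambda>z. - (?p^2) / sin (?p*z)^2) z) (at z)"
      using s by (auto intro!: derivative_eq_intros DERIV_cot[THEN DERIV_chain2] simp: field_simps power2_eq_square)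
    show "((\<lambda>z. - (?p^2) / sin (?p*z)^2) has_field_derivative (\<lambda>z. 2*?p^3 * cos (?p*z) / sin (?p*z)^3) z) (at z)"
      using s by (auto intro!: derivative_eq_intros simp: field_simps power2_eq_square power3_eq_cube)
    show "((\<lambda>z. 2*?p^3 * cos (?p*z) / sin (?p*z)^3) has_field_derivative
       (\<lambda>z. - (?p^4) * (2 / sin (?p*z)^2 + 6 * cos (?p*z)^2 / sin (?p*z)^4)) z) (at z)"
      using s by (auto intro!: derivative_eq_intros simp: field_simps power2_eq_square power3_eq_cube power4_eq_xxxx)
  qed (use half in auto)
  moreover have "sin (?p * (1/2)) = 1" "cos (?p * (1/2)) = 0"
    using sin_of_real[of "pi/2", where ?'a = complex] cos_of_real[of "pi/2", where ?'a = complex] by simp_all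
  ultimately have "Polygamma 3 (1/2 :: complex) + Polygamma 3 (1/2) = 2 * ?p^4" by simp
  thus ?thesis by simp
qed

lemma zeta4: "(\<lambda>n. inverse (of_nat (Suc n) ^ 4) :: complex) sums (of_real pi ^ 4 / 90)"
proof -
  define f where "f = (\<lambda>n. inverse (of_nat (Suc n) ^ 4) :: complex)"
  have "(\<lambda>n. inverse ((1 + of_nat n) ^ Suc 3) :: complex) sums ((-1)^Suc 3 * Polygamma 3 1 / fact 3)"
    by (rule Polygamma_LIMSEQ) auto
  hence "summable f" by (simp add: f_def sums_iff add_ac numeral_eq_Suc)
  then obtain L where L: "f sums L" by (auto simp: summable_def)
  have "(\<lambda>n. inverse ((1/2 + of_nat n) ^ Suc 3) :: complex) sums ((-1)^Suc 3 * Polygamma 3 (1/2) / fact 3)"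
    by (rule Polygamma_LIMSEQ) auto
  hence "(\<lambda>n. inverse (16::complex) * inverse ((1/2 + of_nat n) ^ 4) :: complex) sums (inverse 16 * (of_real pi ^ 4 / 6))"
    unfolding Polygamma3_half by (intro sums_mult) (simp add: fact_numeral numeral_eq_Suc)
  moreover have "inverse (16::complex) * inverse ((1/2 + of_nat n) ^ 4) = f (2 * n)" for n
  proof -
    have "(of_nat (Suc (2*n)) :: complex) = 2 * (1/2 + of_nat n)" by (simp add: algebra_simps)
    hence "(of_nat (Suc (2*n)) :: complex)^4 = 16 * (1/2 + of_nat n)^4"
      by (simp only: power_mult_distrib) simp
    thus ?thesis unfolding f_def by (simp only: inverse_mult_distrib)
  qed
  \<comment> \<open>The shift in \<open>f\<close> makes the even indices carry the odd denominators.
    The odd indices carry the even denominators and reproduce 1/16 of the whole sum, so L = pi^4/96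
    + L/16.\<close>
  ultimately have ev: "(\<lambda>n. f (2*n)) sums (of_real pi ^ 4 / 96)" by simp
  have od: "f (2*n+1) = inverse 16 * f n" for n
  proof -
    have "(of_nat (Suc (2*n+1)) :: complex) = 2 * of_nat (Suc n)" by (simp add: algebra_simps)
    hence "(of_nat (Suc (2*n+1)) :: complex)^4 = 16 * of_nat (Suc n)^4"
      by (simp only: power_mult_distrib) simp
    thus ?thesis unfolding f_def by (simp only: inverse_mult_distrib)
  qed
  have "(\<lambda>n. sum f {n * 2..<n * 2 + 2}) sums L" by (rule sums_group[OF L]) simp
  moreover have "sum f {n * 2..<n * 2 + 2} = f (2*n) + inverse 16 * f n" for n
  proof -
    have "{n * 2..<n * 2 + 2} = {2 * n, 2 * n + 1}" by auto
    thus ?thesis using od[of n] by simp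
  qed
  ultimately have "(\<lambda>n. f (2*n) + inverse 16 * f n) sums L" by simp
  moreover have "(\<lambda>n. f (2*n) + inverse 16 * f n) sums (of_real pi ^ 4 / 96 + inverse 16 * L)"
    by (intro sums_add ev sums_mult L)
  ultimately have "L = of_real pi ^ 4 / 96 + inverse 16 * L" using sums_unique2 by blast
  hence "L = of_real pi ^ 4 / 90" by (simp add: field_simps)
  thus ?thesis using L unfolding f_def by (simp only:)
qed

section \<open>Power series in q\<close>

abbreviation qexp :: "complex \<Rightarrow> complex" where
  "qexp \<tau> \<equiv> exp (2 * of_real pi * \<i> * \<tau>)"

lemma norm_qexp_less_1: "Im \<tau> > 0 \<Longrightarrow> norm (qexp \<tau>) < 1"
  by (simp add: mult_ac)

lemma has_field_derivative_qexp:
  "(qexp has_field_derivative (2 * of_real pi * \<i>) * qexp \<tau>) (at \<tau>)"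
  by (auto intro!: derivative_eq_intros)

lemma has_field_derivative_qseries:
  assumes "fps_conv_radius f \<ge> 1" "Im \<tau> > 0"
  shows "((\<lambda>\<tau>. eval_fps f (qexp \<tau>)) has_field_derivative
     (2 * of_real pi * \<i>) * eval_fps (fps_XD f) (qexp \<tau>)) (at \<tau>)"
proof -
  have q: "ereal (norm (qexp \<tau>)) < fps_conv_radius f"
    using norm_qexp_less_1[OF assms(2)] assms(1) by (metis ereal_less(3) less_le_trans one_ereal_def)
  have "ereal (norm (qexp \<tau>)) < fps_conv_radius (fps_deriv f)"
    using q fps_conv_radius_deriv[of f] by (simp add: less_le_trans)
  hence e: "eval_fps (fps_XD f) (qexp \<tau>) = qexp \<tau> * eval_fps (fps_deriv f) (qexp \<tau>)"
    unfolding fps_XD_def comp_def by (subst eval_fps_mult) auto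
  have "((\<lambda>\<tau>. eval_fps f (qexp \<tau>)) has_field_derivative
     eval_fps (fps_deriv f) (qexp \<tau>) * ((2 * of_real pi * \<i>) * qexp \<tau>)) (at \<tau>)"
    by (rule DERIV_chain2[OF has_field_derivative_eval_fps[OF q] has_field_derivative_qexp])
  thus ?thesis unfolding e by (simp add: mult_ac)
qed

lemma fps_conv_radius_XD: "fps_conv_radius (fps_XD f) \<ge> fps_conv_radius (f :: complex fps)"
  unfolding fps_XD_def comp_def using fps_conv_radius_mult[of fps_X "fps_deriv f"] fps_conv_radius_deriv[of f]
  by (simp add: order_trans)

text \<open>Boundedness of |a_n| x^n for every x < 1 is the form of convergence that an induction
  along a recursion such as that of \<open>frob_coeff\<close> can establish.\<close>

lemma fps_conv_radius_ge_1_iff: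
  "fps_conv_radius (f :: complex fps) \<ge> 1 \<longleftrightarrow>
     (\<forall>r. 0 < r \<and> r < 1 \<longrightarrow> (\<exists>C. \<forall>n. norm (fps_nth f n) * r ^ n \<le> C))" (is "?l \<longleftrightarrow> ?r")
proof
  assume l: ?l
  show ?r
  proof (intro allI impI)
    fix r :: real assume r: "0 < r \<and> r < 1"
    have "ereal (norm (of_real r :: complex)) < fps_conv_radius f"
      using r l by (intro less_le_trans[OF _ l]) simp
    hence "summable (\<lambda>n. norm (fps_nth f n * of_real r ^ n))" by (rule norm_summable_fps)
    hence "Bseq (\<lambda>n. norm (fps_nth f n * of_real r ^ n))"
      using summable_LIMSEQ_zero convergent_imp_Bseq convergentI by blast
    then obtain C where "\<And>n. norm (norm (fps_nth f n * of_real r ^ n)) \<le> C" by (auto simp: Bseq_def)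
    thus "\<exists>C. \<forall>n. norm (fps_nth f n) * r ^ n \<le> C"
      using r by (intro exI[of _ C]) (simp add: norm_mult norm_power)
  qed
next
  assume r: ?r
  show ?l unfolding fps_conv_radius_def
  proof (rule conv_radius_geI_ex')
    fix r :: real assume rr: "0 < r" "ereal r < 1"
    hence r1: "r < 1" by simp
    define t where "t = (r + 1) / 2"
    have t: "r < t" "0 < t" "t < 1" using rr r1 by (auto simp: t_def)
    obtain C where C: "\<And>n. norm (fps_nth f n) * t ^ n \<le> C" using r t by blast
    show "summable (\<lambda>n. fps_nth f n * of_real r ^ n)"
    proof (rule summable_comparison_test')
      show "summable (\<lambda>n. C * (r / t) ^ n)" by (intro summable_mult summable_geometric) (use t rr in auto)
      show "norm (fps_nth f n * of_real r ^ n) \<le> C * (r / t) ^ n" for n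
        using mult_right_mono[OF C[of n], of "(r/t)^n"] t rr
        by (simp add: norm_mult norm_power power_divide field_simps)
    qed
  qed
qed

lemma fps_conv_radius_Suc_power: "fps_conv_radius (Abs_fps (\<lambda>n. of_nat (Suc n) ^ k) :: complex fps) \<ge> 1"
proof (induction k)
  case 0
  show ?case unfolding fps_conv_radius_ge_1_iff
    by (auto intro!: exI[of _ 1] power_le_one)
next
  case (Suc k)
  let ?f = "Abs_fps (\<lambda>n. of_nat (Suc n) ^ k) :: complex fps"
  have "Abs_fps (\<lambda>n. of_nat (Suc n) ^ Suc k) = fps_deriv (fps_X * ?f)"
    by (rule fps_ext) (simp add: fps_deriv_def)
  moreover have "fps_conv_radius (fps_deriv (fps_X * ?f)) \<ge> fps_conv_radius (fps_X * ?f)"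
    by (rule fps_conv_radius_deriv)
  moreover have "fps_conv_radius (fps_X * ?f) \<ge> 1"
    using fps_conv_radius_mult[of fps_X ?f] Suc by (simp add: order_trans)
  ultimately show ?case by simp
qed

lemma fps_conv_radius_geI:
  assumes "\<And>n. norm (fps_nth f n) \<le> of_nat (Suc n) ^ k"
  shows "fps_conv_radius (f :: complex fps) \<ge> 1"
  unfolding fps_conv_radius_ge_1_iff
proof (intro allI impI)
  fix r :: real assume r: "0 < r \<and> r < 1"
  then obtain C where C: "\<And>n. norm (fps_nth (Abs_fps (\<lambda>n. of_nat (Suc n) ^ k) :: complex fps) n) * r ^ n \<le> C"
    using fps_conv_radius_Suc_power[of k] unfolding fps_conv_radius_ge_1_iff by blast
  have "norm (fps_nth f n) * r ^ n \<le> C" for n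
    using order_trans[OF mult_right_mono[OF assms, of "r^n" n]] C[of n] r by (simp add: norm_power del: of_nat_Suc)
  thus "\<exists>C. \<forall>n. norm (fps_nth f n) * r ^ n \<le> C" by blast
qed

lemma sigma3_le: "sigma3 n \<le> n ^ 4"
proof (cases "n = 0")
  case False
  have "{d. d dvd n} \<subseteq> {1..n}" using False by (auto intro: dvd_imp_le Suc_leI dvd_pos_nat)
  hence "sigma3 n \<le> (\<Sum>d\<in>{1..n}. d ^ 3)" unfolding sigma3_def by (intro sum_mono2) auto
  also have "\<dots> \<le> (\<Sum>d\<in>{1..n}. n ^ 3)" by (intro sum_mono power_mono) auto
  also have "\<dots> = n ^ 4" by (simp add: numeral_eq_Suc)
  finally show ?thesis .
qed (simp add: sigma3_def)

text \<open>Every number divides 0, so the defining sum runs over an infinite set and has the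
  default value 0. This lets series with these coefficients start at n = 0.\<close>

lemma sigma3_0 [simp]: "sigma3 0 = 0"
  by (simp add: sigma3_def)

definition E4_fps :: "complex fps" where
  "E4_fps = Abs_fps (\<lambda>n. if n = 0 then 1 else 240 * of_nat (sigma3 n))"

lemma sigma3_fps_radius: "fps_conv_radius (Abs_fps (\<lambda>n. of_nat (sigma3 n)) :: complex fps) \<ge> 1"
proof (rule fps_conv_radius_geI)
  fix n
  have "real (sigma3 n) \<le> real (n ^ 4)" using sigma3_le[of n] of_nat_mono by blast
  also have "\<dots> \<le> real (Suc n) ^ 4" by (simp add: power_mono)
  finally show "norm (fps_nth (Abs_fps (\<lambda>n. of_nat (sigma3 n)) :: complex fps) n) \<le> real (Suc n) ^ 4" by simp
qed

lemma E4_fps_altdef: "E4_fps = 1 + fps_const 240 * Abs_fps (\<lambda>n. of_nat (sigma3 n))"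
  by (rule fps_ext) (simp add: E4_fps_def sigma3_def)

lemma E4_fps_radius: "fps_conv_radius E4_fps \<ge> 1"
proof -
  have "fps_conv_radius (fps_const 240 * Abs_fps (\<lambda>n. of_nat (sigma3 n)) :: complex fps) \<ge> 1"
    using sigma3_fps_radius by (simp add: fps_conv_radius_cmult_left)
  thus ?thesis unfolding E4_fps_altdef
    using fps_conv_radius_add[of 1 "fps_const 240 * Abs_fps (\<lambda>n. of_nat (sigma3 n)) :: complex fps"]
    by (simp add: order_trans)
qed

lemma in_conv_radius: "fps_conv_radius f \<ge> 1 \<Longrightarrow> norm (z::complex) < 1 \<Longrightarrow> ereal (norm z) < fps_conv_radius f"
  by (metis ereal_less(3) less_le_trans one_ereal_def)

lemma E4_conv_eval_fps:
  assumes "Im \<tau> > 0"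
  shows "E4 \<tau> = eval_fps E4_fps (qexp \<tau>)"
proof -
  let ?s = "Abs_fps (\<lambda>n. of_nat (sigma3 n)) :: complex fps"
  have q: "norm (qexp \<tau>) < 1" by (rule norm_qexp_less_1[OF assms])
  have "(\<lambda>n. fps_nth ?s n * qexp \<tau> ^ n) sums eval_fps ?s (qexp \<tau>)"
    by (rule sums_eval_fps) (rule in_conv_radius[OF sigma3_fps_radius q])
  hence "(\<lambda>n. of_nat (sigma3 (Suc n)) * qexp \<tau> ^ Suc n) sums eval_fps ?s (qexp \<tau>)"
    using sums_Suc_iff[of "\<lambda>n. fps_nth ?s n * qexp \<tau> ^ n"] by simp
  hence "E4 \<tau> = 1 + 240 * eval_fps ?s (qexp \<tau>)" unfolding E4_def by (simp add: sums_iff)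
  also have "\<dots> = eval_fps E4_fps (qexp \<tau>)" unfolding E4_fps_altdef
    using in_conv_radius[OF sigma3_fps_radius q] in_conv_radius[OF E4_fps_radius q]
    by (simp add: eval_fps_add eval_fps_mult fps_conv_radius_cmult_left)
  finally show ?thesis .
qed

section \<open>The Lipschitz formula\<close>

definition cube_fps :: "complex fps" where "cube_fps = Abs_fps (\<lambda>n. of_nat n ^ 3)"

text \<open>In the upper half plane pi cot(pi z) = - pi i - 2 pi i (q + q^2 + ...), and each of
  three derivatives brings down a factor 2 pi i n. This leaves (2 pi i)^4 times the sum of n^3
  q^n.\<close>

lemma Polygamma3_reflection:
  assumes "Im z > 0"
  shows "Polygamma 3 z + Polygamma 3 (1 - z) = 16 * of_real pi ^ 4 * eval_fps cube_fps (qexp z)"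
proof -
  define g :: "complex fps" where "g = Abs_fps (\<lambda>n. if n = 0 then 0 else 1)"
  let ?c = "2 * of_real pi * \<i> :: complex"
  have gr: "fps_conv_radius g \<ge> 1" by (rule fps_conv_radius_geI[of _ 0]) (simp add: g_def)
  have gr1: "fps_conv_radius (fps_XD g) \<ge> 1" using gr fps_conv_radius_XD order_trans by blast
  have gr2: "fps_conv_radius (fps_XD (fps_XD g)) \<ge> 1" using gr1 fps_conv_radius_XD order_trans by blast
  have "Polygamma 3 z + Polygamma 3 (1 - z) = - (\<lambda>z. - ?c * (?c * (?c * (?c * eval_fps (fps_XD (fps_XD (fps_XD g))) (qexp z))))) z"
  proof (rule Polygamma3_reflection_derivs[where S = "{z. Im z > 0}" and 
        ?g0.0 = "\<lambda>z. - of_real pi * \<i> - ?c * eval_fps g (qexp z)" and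
        ?g1.0 = "\<lambda>z. - ?c * (?c * eval_fps (fps_XD g) (qexp z))" and
        ?g2.0 = "\<lambda>z. - ?c * (?c * (?c * eval_fps (fps_XD (fps_XD g)) (qexp z)))"])
    show "open {z. Im z > 0}" by (rule open_halfspace_Im_gt)
    show "{z. Im z > 0} \<subseteq> - \<int>" by (auto elim!: Ints_cases)
    fix z assume "z \<in> {z. Im z > 0}"
    hence z: "Im z > 0" by simp
    have q: "norm (qexp z) < 1" by (rule norm_qexp_less_1[OF z])
    have "(\<lambda>n. qexp z ^ n) sums (1 / (1 - qexp z))" by (rule geometric_sums[OF q])
    hence "(\<lambda>n. qexp z * qexp z ^ n) sums (qexp z * (1 / (1 - qexp z)))" by (rule sums_mult)
    hence "(\<lambda>n. fps_nth g (Suc n) * qexp z ^ Suc n) sums (qexp z / (1 - qexp z))" by (simp add: g_def)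
    hence "(\<lambda>n. fps_nth g n * qexp z ^ n) sums (qexp z / (1 - qexp z))"
      by (subst (asm) sums_Suc_iff) (simp add: g_def)
    hence e: "eval_fps g (qexp z) = qexp z / (1 - qexp z)" by (simp add: eval_fps_def sums_iff)
    define x where "x = exp (\<i> * (of_real pi * z))"
    have x0: "x \<noteq> 0" by (simp add: x_def)
    have qx: "qexp z = x\<^sup>2" by (simp add: x_def flip: exp_double) (simp add: mult_ac)
    have x1: "1 - x\<^sup>2 \<noteq> 0" using q qx by auto
    have cot: "cot (of_real pi * z) = ((x + inverse x) / 2) / ((x - inverse x) / (2 * \<i>))"
      by (simp add: cot_def cos_exp_eq sin_exp_eq x_def exp_minus)
    have "x - inverse x \<noteq> 0" using x0 x1 by (auto simp: field_simps power2_eq_square)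
    hence cot': "cot (of_real pi * z) = - \<i> - 2 * \<i> * (x\<^sup>2 / (1 - x\<^sup>2))"
      unfolding cot using x0 x1 by (simp add: divide_simps) (simp add: algebra_simps power2_eq_square)
    show "of_real pi * cot (of_real pi * z) = - of_real pi * \<i> - ?c * eval_fps g (qexp z)"
      unfolding e[unfolded qx] qx cot' by (simp add: algebra_simps)
    show "((\<lambda>z. - of_real pi * \<i> - ?c * eval_fps g (qexp z)) has_field_derivative - ?c * (?c * eval_fps (fps_XD g) (qexp z))) (at z)"
      by (rule derivative_eq_intros has_field_derivative_qseries[OF gr z] refl)+ simp
    show "((\<lambda>z. - ?c * (?c * eval_fps (fps_XD g) (qexp z))) has_field_derivative - ?c * (?c * (?c * eval_fps (fps_XD (fps_XD g)) (qexp z)))) (at z)"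
      by (rule DERIV_cmult has_field_derivative_qseries[OF gr1 z])+
    show "((\<lambda>z. - ?c * (?c * (?c * eval_fps (fps_XD (fps_XD g)) (qexp z)))) has_field_derivative (\<lambda>z. - ?c * (?c * (?c * (?c * eval_fps (fps_XD (fps_XD (fps_XD g))) (qexp z))))) z) (at z)"
      by (rule DERIV_cmult has_field_derivative_qseries[OF gr2 z])+
  qed (use assms in auto)
  also have "fps_XD (fps_XD (fps_XD g)) = cube_fps"
    by (rule fps_ext) (simp add: g_def cube_fps_def power3_eq_cube fps_XD_nth mult_ac)
  also have "- (- ?c * (?c * (?c * (?c * eval_fps cube_fps (qexp z))))) = 16 * of_real pi ^ 4 * eval_fps cube_fps (qexp z)"
  proof -
    have "?c\<^sup>2 = - 4 * of_real pi ^ 2" by (simp add: power_mult_distrib)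
    hence "(?c\<^sup>2)\<^sup>2 = 16 * of_real pi ^ 4" by (simp add: power_mult_distrib)
    moreover have "- (- ?c * (?c * (?c * (?c * eval_fps cube_fps (qexp z))))) = (?c\<^sup>2)\<^sup>2 * eval_fps cube_fps (qexp z)"
      by (simp only: power2_eq_square mult_minus_left minus_minus mult.assoc)
    ultimately show ?thesis by (simp only:)
  qed
  finally show ?thesis .
qed

text \<open>Polygamma values arrive as ordered series over the naturals; summability of
  \<open>f\<close> makes them the two halves of an unordered sum over the integers.\<close>

lemma has_sum_int_split:
  fixes f :: "int \<Rightarrow> complex"
  assumes "f summable_on UNIV" "(\<lambda>k. f (int k)) sums a" "(\<lambda>k. f (- int (Suc k))) sums b"
  shows "(f has_sum (a + b)) UNIV"
proof -
  have U: "(UNIV :: int set) = range int \<union> range (\<lambda>k. - int (Suc k))"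
  proof -
    have "x \<in> range int \<union> range (\<lambda>k. - int (Suc k))" for x by (cases x rule: int_cases) auto
    thus ?thesis by auto
  qed
  have 1: "(f has_sum a) (range int)"
  proof -
    have "f summable_on (range int)" using assms(1) summable_on_subset_banach by blast
    hence h: "(f has_sum (infsum f (range int))) (range int)" by simp
    hence "((f \<circ> int) has_sum (infsum f (range int))) UNIV" by (subst (asm) has_sum_reindex) auto
    hence "(f \<circ> int) sums (infsum f (range int))" by (rule has_sum_imp_sums)
    hence "infsum f (range int) = a" using assms(2) sums_unique2 by (auto simp: comp_def)
    thus ?thesis using h by simp
  qed
  have 2: "(f has_sum b) (range (\<lambda>k. - int (Suc k)))" 
  proof -
    let ?r = "range (\<lambda>k. - int (Suc k))"
    have "f summable_on ?r" using assms(1) summable_on_subset_banach by blast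
    hence h: "(f has_sum (infsum f ?r)) ?r" by simp
    hence "((f \<circ> (\<lambda>k. - int (Suc k))) has_sum (infsum f ?r)) UNIV"
      by (subst (asm) has_sum_reindex) (auto simp: inj_def)
    hence "(f \<circ> (\<lambda>k. - int (Suc k))) sums (infsum f ?r)" by (rule has_sum_imp_sums)
    hence "infsum f ?r = b" using assms(3) sums_unique2 by (fastforce simp: comp_def)
    thus ?thesis using h by simp
  qed
  show ?thesis unfolding U by (rule has_sum_Un_disjoint[OF 1 2]) auto
qed

text \<open>The terms with n >= 0 sum to \<open>Polygamma 3 z / 6\<close>, those with n < 0 to the
  same expression at 1 - z, since the fourth power ignores the sign. The reflection formula joins
  both halves.\<close>

lemma lipschitz_formula:
  assumes z: "Im z > 0" and sm: "(\<lambda>n::int. inverse ((z + of_int n) ^ 4)) summable_on UNIV"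
  shows "((\<lambda>n::int. inverse ((z + of_int n) ^ 4)) has_sum (8 * of_real pi ^ 4 / 3 * eval_fps cube_fps (qexp z))) UNIV"
proof -
  have "z \<noteq> 0" "1 - z \<noteq> 0" using z by (auto simp: complex_eq_iff)
  have "(\<lambda>k. inverse ((z + of_nat k) ^ Suc 3)) sums ((-1)^Suc 3 * Polygamma 3 z / fact 3)"
    by (rule Polygamma_LIMSEQ) (use \<open>z \<noteq> 0\<close> in auto)
  hence 1: "(\<lambda>k. inverse ((z + of_int (int k)) ^ 4)) sums (Polygamma 3 z / 6)"
    by (simp add: fact_numeral numeral_eq_Suc)
  have "(\<lambda>k. inverse ((1 - z + of_nat k) ^ Suc 3)) sums ((-1)^Suc 3 * Polygamma 3 (1 - z) / fact 3)"
    by (rule Polygamma_LIMSEQ) (use \<open>1 - z \<noteq> 0\<close> in auto)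
  moreover have "(1 - z + of_nat k) ^ Suc 3 = (z + of_int (- int (Suc k))) ^ 4" for k
  proof -
    have "1 - z + of_nat k = - (z + of_int (- int (Suc k)))" by simp
    hence "(1 - z + of_nat k) ^ 4 = (z + of_int (- int (Suc k))) ^ 4" by (simp only: power_minus_even even_numeral)
    thus ?thesis by (simp add: numeral_eq_Suc)
  qed
  ultimately have 2: "(\<lambda>k. inverse ((z + of_int (- int (Suc k))) ^ 4)) sums (Polygamma 3 (1 - z) / 6)"
    by (simp add: fact_numeral)
  have "Polygamma 3 z / 6 + Polygamma 3 (1 - z) / 6 = (Polygamma 3 z + Polygamma 3 (1 - z)) / 6" by (simp add: field_simps)
  also have "\<dots> = 8 * of_real pi ^ 4 / 3 * eval_fps cube_fps (qexp z)"
    unfolding Polygamma3_reflection[OF z] by simp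
  finally show ?thesis using has_sum_int_split[OF sm 1 2] by metis
qed

section \<open>The lattice sum of weight 4 and its q-expansion\<close>

lemma lattice_norm_bound:
  assumes "Im \<tau> > 0"
  obtains K where "K > 0" "\<And>x y::real. \<bar>x\<bar> + \<bar>y\<bar> \<le> K * norm (of_real x * \<tau> + of_real y)"
proof
  define v where "v = Im \<tau>"
  let ?K = "1 / v + 1 + norm \<tau> / v"
  have v: "v > 0" using assms by (simp add: v_def)
  thus "?K > 0" by (simp add: add_pos_nonneg)
  fix x y :: real
  define N where "N = norm (of_real x * \<tau> + of_real y)"
  have "\<bar>x\<bar> * v = \<bar>Im (of_real x * \<tau> + of_real y)\<bar>" using v by (simp add: v_def abs_mult)
  also have "\<dots> \<le> N" unfolding N_def by (rule abs_Im_le_cmod)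
  finally have x: "\<bar>x\<bar> \<le> N / v" using v by (simp add: field_simps)
  have "norm (of_real y :: complex) \<le> N + norm (of_real x * \<tau>)"
    unfolding N_def using norm_triangle_ineq4[of "of_real x * \<tau> + of_real y" "of_real x * \<tau>"] by simp
  hence "\<bar>y\<bar> \<le> N + \<bar>x\<bar> * norm \<tau>" by (simp add: norm_mult)
  also have "\<dots> \<le> N + (N / v) * norm \<tau>" using x by (intro add_left_mono mult_right_mono) auto
  finally show "\<bar>x\<bar> + \<bar>y\<bar> \<le> ?K * norm (of_real x * \<tau> + of_real y)"
    unfolding N_def[symmetric] using x by (simp add: algebra_simps)
qed

lemma summable_inverse_1_plus_square_int: "(\<lambda>m::int. inverse (1 + real_of_int m ^ 2)) summable_on UNIV"
proof -
  have n: "(\<lambda>n::nat. inverse (1 + real n ^ 2)) summable_on UNIV"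
  proof (subst summable_on_UNIV_nonneg_real_iff)
    show "summable (\<lambda>n. inverse (1 + real n ^ 2))"
    proof (rule summable_comparison_test')
      show "summable (\<lambda>n. inverse (real n ^ 2))" by (rule inverse_power_summable) auto
      show "norm (inverse (1 + real n ^ 2)) \<le> inverse (real n ^ 2)" if "n \<ge> 1" for n
        using that by (auto intro!: le_imp_inverse_le)
    qed
  qed auto
  have U: "(UNIV :: int set) = range int \<union> range (\<lambda>k. - int k)"
  proof -
    have "x \<in> range int \<union> range (\<lambda>k. - int k)" for x
      by (metis UnI1 UnI2 int_cases2 rangeI)
    thus ?thesis by auto
  qed
  have "(\<lambda>m::int. inverse (1 + real_of_int m ^ 2)) summable_on range int"
    by (subst summable_on_reindex) (use n in \<open>auto simp: comp_def\<close>)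
  moreover have "(\<lambda>m::int. inverse (1 + real_of_int m ^ 2)) summable_on range (\<lambda>k. - int k)"
    by (subst summable_on_reindex) (use n in \<open>auto simp: comp_def inj_def\<close>)
  ultimately show ?thesis unfolding U by (rule summable_on_union)
qed

text \<open>The majorant is a product of a function of m and one of n, so that the double sum
  factors. With s = |m| + |n| >= 1 both 1 + m^2 and 1 + n^2 are at most 2 s^2, which explains the
  constant 4 K^4.\<close>

lemma eisenstein4_abs_summable:
  assumes "Im \<tau> > 0"
  shows "(\<lambda>p::int \<times> int. norm (case p of (m,n) \<Rightarrow> inverse ((of_int m * \<tau> + of_int n) ^ 4))) summable_on UNIV"
proof -
  obtain K where K: "K > 0" "\<And>x y::real. \<bar>x\<bar> + \<bar>y\<bar> \<le> K * norm (of_real x * \<tau> + of_real y)"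
    using lattice_norm_bound[OF assms] by blast
  let ?g = "\<lambda>m::int. inverse (1 + real_of_int m ^ 2)"
  have "(\<lambda>p. norm (case p of (m,n) \<Rightarrow> ?g m * ?g n)) summable_on (UNIV \<times> UNIV)"
  proof (subst Infinite_Sum.abs_summable_on_Sigma_iff, intro conjI ballI)
    fix m :: int
    show "(\<lambda>n. norm (case (m,n) of (m,n) \<Rightarrow> ?g m * ?g n)) summable_on UNIV"
      using summable_on_cmult_right[OF summable_inverse_1_plus_square_int, of "?g m"] by (simp add: abs_mult)
    have "(\<lambda>m. ?g m * infsum ?g UNIV) summable_on UNIV"
      by (rule summable_on_cmult_left[OF summable_inverse_1_plus_square_int])
    moreover have "\<bar>\<Sum>\<^sub>\<infinity>y\<in>UNIV. \<bar>?g x\<bar> * \<bar>?g y\<bar>\<bar> = ?g x * infsum ?g UNIV" for x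
    proof -
      have "(\<Sum>\<^sub>\<infinity>y\<in>UNIV. \<bar>?g x\<bar> * \<bar>?g y\<bar>) = ?g x * infsum ?g UNIV" by (simp add: infsum_cmult_right')
      moreover have "infsum ?g UNIV \<ge> 0" by (rule infsum_nonneg) simp
      ultimately show ?thesis by (simp add: abs_mult)
    qed
    ultimately show "(\<lambda>x. norm (infsum (\<lambda>y. norm (case (x,y) of (m,n) \<Rightarrow> ?g m * ?g n)) UNIV)) summable_on UNIV"
      by (simp add: abs_mult)
  qed
  hence "(\<lambda>p. norm (4 * K ^ 4 * (case p of (m,n) \<Rightarrow> ?g m * ?g n))) summable_on UNIV"
    using summable_on_cmult_right[of _ _ "4 * K^4"] by (simp add: abs_mult split_def)
  thus ?thesis
  proof (rule Infinite_Sum.abs_summable_on_comparison_test)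
    fix p :: "int \<times> int"
    obtain m n where p: "p = (m, n)" by force
    have "norm (inverse ((of_int m * \<tau> + of_int n) ^ 4)) \<le> 4 * K ^ 4 * (?g m * ?g n)"
    proof (cases "of_int m * \<tau> + of_int n = 0")
      case False
      define N where "N = norm (of_int m * \<tau> + of_int n)"
      have N: "N > 0" using False by (simp add: N_def)
      define s where "s = \<bar>real_of_int m\<bar> + \<bar>real_of_int n\<bar>"
      have "m \<noteq> 0 \<or> n \<noteq> 0" using False by auto
      hence "\<bar>m\<bar> + \<bar>n\<bar> \<ge> 1" by linarith
      hence s1: "s \<ge> 1" unfolding s_def by linarith
      have sN: "s \<le> K * N" using K(2)[of "of_int m" "of_int n"] by (simp add: s_def N_def)
      have s2: "1 \<le> s^2" using s1 by simp
      have "real_of_int m ^ 2 \<le> s ^ 2" "real_of_int n ^ 2 \<le> s ^ 2"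
        unfolding s_def by (auto intro!: power2_le_iff_abs_le[THEN iffD2])
      hence "1 + real_of_int m ^ 2 \<le> 2 * s^2" "1 + real_of_int n ^ 2 \<le> 2 * s^2" using s2 by linarith+
      hence "(1 + real_of_int m ^ 2) * (1 + real_of_int n ^ 2) \<le> (2 * s^2) * (2 * s^2)"
        by (intro mult_mono) auto
      also have "\<dots> = 4 * s ^ 4" by (simp add: power4_eq_xxxx power2_eq_square)
      also have "\<dots> \<le> 4 * (K * N) ^ 4" using sN s1 by (intro mult_left_mono power_mono) auto
      finally have b: "(1 + real_of_int m ^ 2) * (1 + real_of_int n ^ 2) \<le> 4 * K^4 * N ^ 4" by (simp add: power_mult_distrib)
      have pos: "(1 + real_of_int m ^ 2) > 0" "(1 + real_of_int n ^ 2) > 0" by (auto intro: add_pos_nonneg)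
      have "inverse (N ^ 4) \<le> 4 * K ^ 4 * (?g m * ?g n)"
      proof -
        have "inverse t \<le> c * inverse P" if "P \<le> c * t" "P > 0" "t > 0" for P c t :: real
          using that by (simp add: field_simps)
        from this[OF b] pos N show ?thesis by simp
      qed
      thus ?thesis by (simp add: N_def norm_inverse norm_power)
    qed (auto intro!: mult_nonneg_nonneg)
    moreover have "norm (4 * K ^ 4 * (?g m * ?g n)) = 4 * K ^ 4 * (?g m * ?g n)"
      using K(1) by (subst real_norm_def, intro abs_of_nonneg) auto
    ultimately show "norm (case p of (m,n) \<Rightarrow> inverse ((of_int m * \<tau> + of_int n) ^ 4)) \<le> norm (4 * K ^ 4 * (case p of (m,n) \<Rightarrow> ?g m * ?g n))"
      by (simp add: p)
  qed
qed

text \<open>The index (0, 0) is harmless: \<open>inverse 0 = 0\<close> makes its term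
  vanish.\<close>

definition G4 :: "complex \<Rightarrow> complex" where
  "G4 \<tau> = infsum (\<lambda>(m::int,n::int). inverse ((of_int m * \<tau> + of_int n) ^ 4)) UNIV"

text \<open>Since m (-1/tau) + n = (n tau - m) / tau, the substitution only rotates the index
  lattice, and an unordered sum does not notice this.\<close>

lemma G4_minus_inverse:
  assumes "\<tau> \<noteq> 0"
  shows "G4 (- 1 / \<tau>) = \<tau> ^ 4 * G4 \<tau>"
proof -
  have "G4 (- 1 / \<tau>) = infsum (\<lambda>(m::int,n::int). \<tau> ^ 4 * inverse ((of_int m * \<tau> + of_int n) ^ 4)) UNIV"
    unfolding G4_def
  proof (rule infsum_reindex_bij_witness[where i = "\<lambda>(m,n). (-n, m)" and j = "\<lambda>(m,n). (n, -m)"])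
    fix p :: "int \<times> int"
    obtain m n where p: "p = (m, n)" by force
    have "of_int m * (- 1 / \<tau>) + of_int n = (of_int n * \<tau> + of_int (- m)) / \<tau>"
      using assms by (simp add: field_simps)
    thus "(case (case p of (m,n) \<Rightarrow> (n, -m)) of (m,n) \<Rightarrow> \<tau> ^ 4 * inverse ((of_int m * \<tau> + of_int n) ^ 4)) =
       (case p of (m,n) \<Rightarrow> inverse ((of_int m * (- 1 / \<tau>) + of_int n) ^ 4))"
      by (simp add: p divide_inverse power_mult_distrib power_inverse)
  qed auto
  also have "\<dots> = infsum (\<lambda>p. \<tau> ^ 4 * (case p of (m::int,n::int) \<Rightarrow> inverse ((of_int m * \<tau> + of_int n) ^ 4))) UNIV"
    by (intro infsum_cong) auto
  also have "\<dots> = \<tau> ^ 4 * G4 \<tau>" unfolding G4_def by (rule infsum_cmult_right')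
  finally show ?thesis .
qed

text \<open>Sorting the pairs (m, d) by n = m d collects the cubes of the divisors of n. Absolute
  convergence is inherited from the power series with coefficients \<open>sigma3\<close>.\<close>

lemma sigma3_series_rearrange:
  fixes q :: complex
  assumes q: "norm q < 1"
  shows "((\<lambda>(m,d). of_nat d ^ 3 * q ^ (m * d)) has_sum (\<Sum>n. of_nat (sigma3 n) * q ^ n)) ({1..} \<times> {1..})"
proof -
  let ?S = "Sigma {1..} (\<lambda>n::nat. {d. d dvd n})"
  let ?f = "\<lambda>(n::nat,d). of_nat d ^ 3 * q ^ n"
  have fin: "finite {d. d dvd n}" if "n \<in> {1..}" for n :: nat using that by simp
  have sums: "(\<lambda>n. of_nat (sigma3 n) * norm q ^ n :: real) summable_on {1..}"
  proof -
    have "summable (\<lambda>n. norm (fps_nth (Abs_fps (\<lambda>n. of_nat (sigma3 n))) n * q ^ n))"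
      by (rule norm_summable_fps) (rule in_conv_radius[OF sigma3_fps_radius q])
    hence "(\<lambda>n. of_nat (sigma3 n) * norm q ^ n :: real) summable_on UNIV"
      by (subst summable_on_UNIV_nonneg_real_iff) (auto simp: norm_mult norm_power)
    thus ?thesis by (rule summable_on_subset_banach) auto
  qed
  have abs: "(\<lambda>p. norm (?f p)) summable_on ?S"
  proof (subst Infinite_Sum.abs_summable_on_Sigma_iff, intro conjI ballI)
    fix n :: nat assume "n \<in> {1..}"
    thus "(\<lambda>d. norm (?f (n, d))) summable_on {d. d dvd n}" using fin by auto
  next
    have "(\<lambda>n. norm (\<Sum>\<^sub>\<infinity>d\<in>{d. d dvd n}. norm (?f (n, d)))) summable_on {1..} \<longleftrightarrow>
        (\<lambda>n. of_nat (sigma3 n) * norm q ^ n :: real) summable_on {1..}"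
    proof (rule summable_on_cong)
      fix n :: nat assume n: "n \<in> {1..}"
      have "(\<Sum>\<^sub>\<infinity>d\<in>{d. d dvd n}. norm (?f (n, d))) = (\<Sum>d\<in>{d. d dvd n}. of_nat d ^ 3 * norm q ^ n)"
        using fin[OF n] by (simp add: norm_mult norm_power)
      also have "\<dots> = of_nat (sigma3 n) * norm q ^ n" by (simp add: sigma3_def sum_distrib_right)
      finally show "norm (\<Sum>\<^sub>\<infinity>d\<in>{d. d dvd n}. norm (?f (n, d))) = of_nat (sigma3 n) * norm q ^ n" by simp
    qed
    thus "(\<lambda>n. norm (\<Sum>\<^sub>\<infinity>d\<in>{d. d dvd n}. norm (?f (n, d)))) summable_on {1..}" using sums by blast
  qed
  hence "?f summable_on ?S" by (rule abs_summable_summable)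
  hence h: "(?f has_sum infsum ?f ?S) ?S" by simp
  have "((\<lambda>n. of_nat (sigma3 n) * q ^ n) has_sum infsum ?f ?S) {1..}"
  proof (rule has_sum_SigmaD[OF h])
    fix n :: nat assume n: "n \<in> {1..}"
    show "((\<lambda>d. ?f (n, d)) has_sum of_nat (sigma3 n) * q ^ n) {d. d dvd n}"
      by (rule has_sum_finiteI[OF fin[OF n]]) (simp add: sigma3_def sum_distrib_right)
  qed
  hence "((\<lambda>n. of_nat (sigma3 n) * q ^ n) has_sum infsum ?f ?S) UNIV"
    by (subst has_sum_cong_neutral[where T = "{1..}" and g = "\<lambda>n. of_nat (sigma3 n) * q ^ n"])
       (auto simp: not_le)
  hence "infsum ?f ?S = (\<Sum>n. of_nat (sigma3 n) * q ^ n)"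
    by (intro sums_unique has_sum_imp_sums)
  hence "(?f has_sum (\<Sum>n. of_nat (sigma3 n) * q ^ n)) ?S" using h by simp
  thus ?thesis
    by (subst has_sum_reindex_bij_witness[where S = "{1..} \<times> {1..}" and T = ?S and h = ?f and
          j = "\<lambda>(m,d). (m * d, d)" and i = "\<lambda>(n,d). (n div d, d)"])
       (auto simp: dvd_def)
qed

text \<open>The row m = 0 gives 2 zeta(4) = pi^4/45; the rows m and -m agree and are evaluated by
  \<open>lipschitz_formula\<close>. The coefficient 240 is 2 (8 pi^4/3) / (pi^4/45).\<close>

lemma G4_eq_E4:
  assumes tau: "Im \<tau> > 0"
  shows "G4 \<tau> = of_real pi ^ 4 / 45 * E4 \<tau>"
proof -
  let ?f = "\<lambda>(m::int,n::int). inverse ((of_int m * \<tau> + of_int n) ^ 4)"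
  let ?g = "\<lambda>m::int. infsum (\<lambda>n. ?f (m, n)) UNIV"
  let ?L = "\<lambda>m::nat. 8 * of_real pi ^ 4 / 3 * eval_fps cube_fps (qexp (of_nat m * \<tau>))"
  define q where "q = qexp \<tau>"
  have q1: "norm q < 1" unfolding q_def by (rule norm_qexp_less_1[OF tau])
  have abs: "(\<lambda>p. norm (?f p)) summable_on UNIV" by (rule eisenstein4_abs_summable[OF tau])
  hence h: "(?f has_sum G4 \<tau>) (UNIV \<times> UNIV)" unfolding G4_def
    using abs_summable_summable[OF abs] by simp
  have inner: "(\<lambda>n. ?f (m, n)) summable_on UNIV" for m
  proof -
    have "?f summable_on (UNIV \<times> UNIV)" using abs_summable_summable[OF abs] by simp
    from summable_on_SigmaD1[OF this, of m] show ?thesis by simp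
  qed
  have "(?g has_sum G4 \<tau>) UNIV"
    by (rule has_sum_SigmaD[OF h]) (use inner in auto)
  hence smg: "?g summable_on UNIV" and G: "G4 \<tau> = infsum ?g UNIV" by (auto simp: has_sum_iff)
  have pos: "?g (int m) = ?L m" if "m > 0" for m
  proof -
    have "((\<lambda>n::int. inverse ((of_nat m * \<tau> + of_int n) ^ 4)) has_sum ?L m) UNIV"
      by (rule lipschitz_formula) (use tau that inner[of "int m"] in auto)
    thus ?thesis by (simp add: has_sum_iff)
  qed
  have neg: "?g (- int m) = ?g (int m)" for m
    by (rule infsum_reindex_bij_witness[where i = uminus and j = uminus])
       (auto, metis minus_add_distrib even_numeral power_minus_even diff_minus_eq_add minus_diff_eq)
  have zero: "?g 0 = of_real pi ^ 4 / 45"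
  proof -
    have "((\<lambda>n. ?f (0, n)) has_sum (of_real pi ^ 4 / 90 + of_real pi ^ 4 / 90)) UNIV"
    proof (rule has_sum_int_split[OF inner])
      show "(\<lambda>k. ?f (0, - int (Suc k))) sums (of_real pi ^ 4 / 90)" 
      proof -
        have "?f (0, - int (Suc k)) = inverse (of_nat (Suc k) ^ 4)" for k
          by (simp only: prod.case of_int_0 mult_zero_left add_0_left of_int_minus power_minus_even even_numeral of_int_of_nat_eq)
        thus ?thesis using zeta4 by (simp only:)
      qed
      have "(\<lambda>k. ?f (0, int (Suc k))) sums (of_real pi ^ 4 / 90)" 
        using zeta4 by (simp only: prod.case of_int_0 mult_zero_left add_0_left of_int_of_nat_eq)
      thus "(\<lambda>k. ?f (0, int k)) sums (of_real pi ^ 4 / 90)" 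
        using sums_Suc_iff[of "\<lambda>k. ?f (0, int k)"] by simp
    qed
    thus ?thesis by (simp add: has_sum_iff)
  qed
  have eval: "eval_fps cube_fps (qexp (of_nat m * \<tau>)) = infsum (\<lambda>d. of_nat d ^ 3 * q ^ (m * d)) {1..}"
    and cs: "(\<lambda>d. of_nat d ^ 3 * q ^ (m * d)) summable_on {1..}" if "m > 0" for m
  proof -
    have qm: "qexp (of_nat m * \<tau>) = q ^ m" by (simp add: q_def mult_ac flip: exp_of_nat_mult)
    have "norm (q ^ m) < 1" using q1 that by (simp add: norm_power power_less_one_iff)
    moreover have "fps_conv_radius cube_fps \<ge> 1"
      by (rule fps_conv_radius_geI[of _ 3]) (auto simp: cube_fps_def norm_power intro!: power_mono)
    ultimately have r: "ereal (norm (q ^ m)) < fps_conv_radius cube_fps" by (intro in_conv_radius)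
    have a: "summable (\<lambda>n. norm (fps_nth cube_fps n * (q ^ m) ^ n))" by (rule norm_summable_fps[OF r])
    have "(\<lambda>n. fps_nth cube_fps n * (q ^ m) ^ n) sums eval_fps cube_fps (q ^ m)" by (rule sums_eval_fps[OF r])
    hence "((\<lambda>n. fps_nth cube_fps n * (q ^ m) ^ n) has_sum eval_fps cube_fps (q ^ m)) UNIV"
      by (intro norm_summable_imp_has_sum a)
    hence "((\<lambda>n. of_nat n ^ 3 * q ^ (m * n)) has_sum eval_fps cube_fps (q ^ m)) {1..}"
      by (subst has_sum_cong_neutral[where T = UNIV and g = "\<lambda>n. fps_nth cube_fps n * (q ^ m) ^ n"])
         (auto simp: not_le cube_fps_def power_mult)
    thus "eval_fps cube_fps (qexp (of_nat m * \<tau>)) = infsum (\<lambda>d. of_nat d ^ 3 * q ^ (m * d)) {1..}"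
      "(\<lambda>d. of_nat d ^ 3 * q ^ (m * d)) summable_on {1..}"
      by (auto simp: has_sum_iff qm)
  qed
  have "((\<lambda>m. infsum (\<lambda>d. of_nat d ^ 3 * q ^ (m * d)) {1..}) has_sum (\<Sum>n. of_nat (sigma3 n) * q ^ n)) {1..}"
    by (rule has_sum_SigmaD[OF sigma3_series_rearrange[OF q1]]) (use cs in auto)
  hence "((\<lambda>m. 8 * of_real pi ^ 4 / 3 * infsum (\<lambda>d. of_nat d ^ 3 * q ^ (m * d)) {1..}) has_sum
     (8 * of_real pi ^ 4 / 3 * (\<Sum>n. of_nat (sigma3 n) * q ^ n))) {1..}" by (rule has_sum_cmult_right)
  also have "?this \<longleftrightarrow> ((\<lambda>m. ?g (int m)) has_sum
     (8 * of_real pi ^ 4 / 3 * (\<Sum>n. of_nat (sigma3 n) * q ^ n))) {1..}"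
    by (rule has_sum_cong) (use pos eval in auto)
  also have "\<dots> \<longleftrightarrow> ((\<lambda>m. ?g (int (Suc m))) has_sum
     (8 * of_real pi ^ 4 / 3 * (\<Sum>n. of_nat (sigma3 n) * q ^ n))) UNIV"
    by (rule has_sum_reindex_bij_witness[where j = "\<lambda>m. m - 1" and i = Suc]) auto
  finally have pos_sum: "(\<lambda>m. ?g (int (Suc m))) sums (8 * of_real pi ^ 4 / 3 * (\<Sum>n. of_nat (sigma3 n) * q ^ n))"
    (is "_ sums ?R") by (rule has_sum_imp_sums)
  have "(?g has_sum ((?R + of_real pi ^ 4 / 45) + ?R)) UNIV"
  proof (rule has_sum_int_split[OF smg])
    show "(\<lambda>k. ?g (- int (Suc k))) sums ?R" unfolding neg by (rule pos_sum)
    show "(\<lambda>k. ?g (int k)) sums (?R + of_real pi ^ 4 / 45)"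
      using pos_sum sums_Suc_iff[of "\<lambda>k. ?g (int k)" ?R] zero by (simp only: of_nat_0)
  qed
  hence G': "G4 \<tau> = (?R + of_real pi ^ 4 / 45) + ?R" unfolding G by (simp add: has_sum_iff)
  let ?s = "Abs_fps (\<lambda>n. of_nat (sigma3 n)) :: complex fps"
  have "E4 \<tau> = 1 + 240 * (\<Sum>n. of_nat (sigma3 n) * q ^ n)"
  proof -
    have "(\<lambda>n. fps_nth ?s n * q ^ n) sums eval_fps ?s q"
      by (rule sums_eval_fps) (rule in_conv_radius[OF sigma3_fps_radius q1])
    hence 1: "(\<lambda>n. of_nat (sigma3 n) * q ^ n) sums eval_fps ?s q" by simp
    hence "(\<lambda>n. of_nat (sigma3 (Suc n)) * q ^ Suc n) sums eval_fps ?s q"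
      using sums_Suc_iff[of "\<lambda>n. of_nat (sigma3 n) * q ^ n"] by simp
    thus ?thesis using 1 unfolding E4_def q_def by (simp add: sums_iff)
  qed
  thus ?thesis unfolding G' by (simp add: field_simps)
qed

lemma E4_minus_inverse:
  assumes "Im \<tau> > 0"
  shows "E4 (- 1 / \<tau>) = \<tau> ^ 4 * E4 \<tau>"
proof -
  have t0: "\<tau> \<noteq> 0" using assms by auto
  have "Im (- 1 / \<tau>) > 0" using assms by (simp add: Im_divide_Reals complex_div_gt_0 Im_divide add_pos_pos sum_power2_gt_zero_iff)
  from G4_eq_E4[OF this] G4_eq_E4[OF assms] G4_minus_inverse[OF t0]
  have "of_real pi ^ 4 / 45 * E4 (- 1 / \<tau>) = of_real pi ^ 4 / 45 * (\<tau> ^ 4 * E4 \<tau>)"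
    by (simp only: mult_ac)
  moreover have "(of_real pi ^ 4 / 45 :: complex) \<noteq> 0" by simp
  ultimately show ?thesis by (simp only: mult_cancel_left) blast
qed

lemma holomorphic_E4: "E4 holomorphic_on upper_half_plane"
proof -
  have "(\<lambda>\<tau>. eval_fps E4_fps (qexp \<tau>)) holomorphic_on upper_half_plane"
  proof (rule holomorphic_onI)
    fix \<tau> assume "\<tau> \<in> upper_half_plane"
    hence "Im \<tau> > 0" by (simp add: upper_half_plane_def)
    from has_field_derivative_qseries[OF E4_fps_radius this]
    show "(\<lambda>\<tau>. eval_fps E4_fps (qexp \<tau>)) field_differentiable at \<tau> within upper_half_plane"
      using field_differentiable_at_within field_differentiable_def by blast
  qed
  thus ?thesis by (rule holomorphic_transform) (simp add: E4_conv_eval_fps upper_half_plane_def)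
qed

section \<open>Moebius transformations and the slash operator\<close>

abbreviation ma :: "int ^ 2 ^ 2 \<Rightarrow> int" where "ma A \<equiv> A $ 1 $ 1"
abbreviation mb :: "int ^ 2 ^ 2 \<Rightarrow> int" where "mb A \<equiv> A $ 1 $ 2"
abbreviation mc :: "int ^ 2 ^ 2 \<Rightarrow> int" where "mc A \<equiv> A $ 2 $ 1"
abbreviation md :: "int ^ 2 ^ 2 \<Rightarrow> int" where "md A \<equiv> A $ 2 $ 2"

definition mat2 :: "int \<Rightarrow> int \<Rightarrow> int \<Rightarrow> int \<Rightarrow> int ^ 2 ^ 2" where
  "mat2 a b c d = vector [vector [a, b], vector [c, d]]"

lemma mat2_nth [simp]:
  "ma (mat2 a b c d) = a" "mb (mat2 a b c d) = b"
  "mc (mat2 a b c d) = c" "md (mat2 a b c d) = d"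
  by (simp_all add: mat2_def)

lemma mat2_eqI:
  fixes A B :: "int ^ 2 ^ 2"
  assumes "ma A = ma B" "mb A = mb B" "mc A = mc B" "md A = md B"
  shows "A = B"
  using assms by (simp add: vec_eq_iff forall_2)

lemma mat_1_nth [simp]:
  "ma (mat 1 :: int ^ 2 ^ 2) = 1" "mb (mat 1 :: int ^ 2 ^ 2) = 0"
  "mc (mat 1 :: int ^ 2 ^ 2) = 0" "md (mat 1 :: int ^ 2 ^ 2) = 1"
  by (simp_all add: mat_def)

lemma mat2_mult: "mat2 a b c d ** mat2 a' b' c' d' =
    mat2 (a * a' + b * c') (a * b' + b * d') (c * a' + d * c') (c * b' + d * d')"
  by (rule mat2_eqI) (simp_all add: matrix_matrix_mult_def sum_2)

lemma mult_nth [simp]: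
  fixes A B :: "int ^ 2 ^ 2"
  shows "ma (A ** B) = ma A * ma B + mb A * mc B"
    "mb (A ** B) = ma A * mb B + mb A * md B"
    "mc (A ** B) = mc A * ma B + md A * mc B"
    "md (A ** B) = mc A * mb B + md A * md B"
  by (simp_all add: matrix_matrix_mult_def sum_2)

abbreviation SL2 :: "(int ^ 2 ^ 2) set" where "SL2 \<equiv> carrier SL2Z"

lemma SL2_iff: "A \<in> SL2 \<longleftrightarrow> ma A * md A - mb A * mc A = 1"
  by (simp add: SL2Z_def det_2)

lemma SL2_mult [intro, simp]: "A \<in> SL2 \<Longrightarrow> B \<in> SL2 \<Longrightarrow> A ** B \<in> SL2"
  by (simp add: SL2Z_def det_mul)

definition adj2 :: "int ^ 2 ^ 2 \<Rightarrow> int ^ 2 ^ 2" where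
  "adj2 A = mat2 (md A) (- mb A) (- mc A) (ma A)"

lemma adj2_SL2 [intro, simp]: "A \<in> SL2 \<Longrightarrow> adj2 A \<in> SL2"
  by (simp add: SL2_iff adj2_def algebra_simps)

lemma adj2_inverse [simp]:
  assumes "A \<in> SL2" shows "A ** adj2 A = mat 1" "adj2 A ** A = mat 1"
  using assms by (auto intro!: mat2_eqI simp: SL2_iff adj2_def algebra_simps)

definition Tmat :: "int \<Rightarrow> int ^ 2 ^ 2" where "Tmat k = mat2 1 k 0 1"
definition Smat :: "int ^ 2 ^ 2" where "Smat = mat2 0 (-1) 1 0"

lemma Tmat_SL2 [intro, simp]: "Tmat k \<in> SL2" and Smat_SL2 [intro, simp]: "Smat \<in> SL2"
  and mat_1_SL2 [intro, simp]: "mat 1 \<in> SL2" and uminus_mat_1_SL2 [intro, simp]: "- mat 1 \<in> SL2"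
  by (simp_all add: SL2_iff Tmat_def Smat_def)

lemma Tmat_add: "Tmat j ** Tmat k = Tmat (j + k)"
  by (simp add: Tmat_def mat2_mult add.commute)

lemma Tmat_0: "Tmat 0 = mat 1"
  by (rule mat2_eqI) (auto simp: Tmat_def)

lemma matrix_minus_mult [simp]: 
  fixes A B :: "int ^ 2 ^ 2"
  shows "(- A) ** B = - (A ** B)" "A ** (- B) = - (A ** B)"
  by (rule mat2_eqI; simp)+

text \<open>Euclid's algorithm on the lower row: multiplying by T^k S on the right replaces the
  lower left entry c by d mod c. No case for inverses is required, because powers of T of both signs
  are base cases and S^2 = -1 yields the inverse of S.\<close>

lemma SL2_induct [consumes 1, case_names T S mult]:
  assumes A: "A \<in> SL2"
    and T: "\<And>k. P (Tmat k)" and S: "P Smat"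
    and mult: "\<And>A B. A \<in> SL2 \<Longrightarrow> B \<in> SL2 \<Longrightarrow> P A \<Longrightarrow> P B \<Longrightarrow> P (A ** B)"
  shows "P A"
proof -
  have m1: "P (- mat 1)"
  proof -
    have "- mat 1 = Smat ** Smat" by (rule mat2_eqI) (auto simp: Smat_def)
    thus ?thesis using mult[OF _ _ S S] by simp
  qed
  have "\<forall>A. A \<in> SL2 \<longrightarrow> nat \<bar>mc A\<bar> = n \<longrightarrow> P A" for n
  proof (induction n rule: less_induct)
    case (less n)
    show ?case
    proof (intro allI impI)
      fix A assume A: "A \<in> SL2" "nat \<bar>mc A\<bar> = n"
      show "P A"
      proof (cases "mc A = 0")
        case True
        hence "ma A * md A = 1" using A by (simp add: SL2_iff)
        hence "(ma A = 1 \<and> md A = 1) \<or> (ma A = -1 \<and> md A = -1)"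
          by (simp add: zmult_eq_1_iff)
        hence "A = Tmat (mb A) \<or> A = (- mat 1) ** Tmat (- (mb A))"
          using True by (auto intro!: mat2_eqI simp: Tmat_def)
        thus ?thesis
        proof
          assume eq: "A = Tmat (mb A)"
          show ?thesis by (rule ssubst[OF eq, of P]) (rule T)
        next
          assume eq: "A = (- mat 1) ** Tmat (- (mb A))"
          show ?thesis by (rule ssubst[OF eq, of P]) (intro mult m1 T; simp)
        qed
      next
        case False
        define c where "c = mc A"
        define k where "k = - (md A div c)"
        define B where "B = A ** (Tmat k ** Smat)"
        have B: "B \<in> SL2" using A by (simp add: B_def)
        have "mc B = md A mod c"
          by (simp add: B_def Tmat_def Smat_def k_def c_def minus_div_mult_eq_mod[symmetric] algebra_simps)
        hence "\<bar>mc B\<bar> < \<bar>c\<bar>" using False c_def by (simp add: abs_mod_less)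
        hence "nat \<bar>mc B\<bar> < n" using A False c_def by linarith
        hence PB: "P B" using less.IH B by blast
        have "A = B ** ((Smat ** (- mat 1)) ** Tmat (- k))"
          by (rule mat2_eqI) (simp_all add: B_def Smat_def Tmat_def algebra_simps)
        moreover have "P ((Smat ** (- mat 1)) ** Tmat (- k))"
          by (intro mult S m1 T SL2_mult) auto
        ultimately show ?thesis using mult[OF B _ PB] by (metis SL2_mult Smat_SL2 Tmat_SL2 uminus_mat_1_SL2)
      qed
    qed
  qed
  thus ?thesis using A by blast
qed

lemma in_H_iff: "\<tau> \<in> upper_half_plane \<longleftrightarrow> Im \<tau> > 0"
  by (simp add: upper_half_plane_def)

lemma open_H [simp, intro]: "open upper_half_plane"
  unfolding upper_half_plane_def by (rule open_halfspace_Im_gt)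

lemma connected_H [simp, intro]: "connected upper_half_plane"
  unfolding upper_half_plane_def by (intro convex_connected convex_halfspace_Im_gt)

lemma i_in_H [simp]: "\<i> \<in> upper_half_plane"
  by (simp add: in_H_iff)

definition jfac :: "int ^ 2 ^ 2 \<Rightarrow> complex \<Rightarrow> complex" where
  "jfac A \<tau> = of_int (mc A) * \<tau> + of_int (md A)"

lemma jfac_nonzero:
  assumes "A \<in> SL2" "\<tau> \<in> upper_half_plane"
  shows "jfac A \<tau> \<noteq> 0"
proof
  assume 0: "jfac A \<tau> = 0"
  hence "Im (jfac A \<tau>) = 0" "Re (jfac A \<tau>) = 0" by simp_all
  hence "mc A = 0" "md A = 0" using assms(2) by (auto simp: jfac_def in_H_iff)
  thus False using assms(1) by (simp add: SL2_iff)
qed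

lemma mobius_eq: "mobius A \<tau> = (of_int (ma A) * \<tau> + of_int (mb A)) / jfac A \<tau>"
  by (simp add: mobius_def jfac_def)

lemma Im_mobius:
  assumes "A \<in> SL2"
  shows "Im (mobius A \<tau>) = Im \<tau> / (norm (jfac A \<tau>))\<^sup>2"
proof -
  have det: "real_of_int (ma A) * real_of_int (md A) - real_of_int (mb A) * real_of_int (mc A) = 1"
    using arg_cong[OF assms[unfolded SL2_iff], of real_of_int] by simp
  have "Im (mobius A \<tau>) = (Im \<tau> * (real_of_int (ma A) * real_of_int (md A) - real_of_int (mb A) * real_of_int (mc A))) / (norm (jfac A \<tau>))\<^sup>2"
    by (simp add: mobius_eq Im_divide cmod_power2 jfac_def) (simp add: algebra_simps)
  thus ?thesis by (simp add: det)
qed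

lemma mobius_in_H [simp, intro]:
  assumes "A \<in> SL2" "\<tau> \<in> upper_half_plane"
  shows "mobius A \<tau> \<in> upper_half_plane"
  using assms jfac_nonzero[OF assms] by (simp add: in_H_iff Im_mobius)

lemma jfac_mult:
  assumes "B \<in> SL2" "\<tau> \<in> upper_half_plane"
  shows "jfac (A ** B) \<tau> = jfac A (mobius B \<tau>) * jfac B \<tau>"
proof -
  have "mobius B \<tau> * jfac B \<tau> = of_int (ma B) * \<tau> + of_int (mb B)"
    using jfac_nonzero[OF assms] by (simp add: mobius_eq)
  hence "jfac A (mobius B \<tau>) * jfac B \<tau> = of_int (mc A) * (of_int (ma B) * \<tau> + of_int (mb B)) + of_int (md A) * jfac B \<tau>"
    unfolding jfac_def[of A] distrib_right mult.assoc by (simp only:)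
  thus ?thesis by (simp add: jfac_def algebra_simps)
qed

lemma mobius_mult:
  assumes "A \<in> SL2" "B \<in> SL2" "\<tau> \<in> upper_half_plane"
  shows "mobius (A ** B) \<tau> = mobius A (mobius B \<tau>)"
proof -
  have nz: "jfac B \<tau> \<noteq> 0" "jfac A (mobius B \<tau>) \<noteq> 0"
    using assms jfac_nonzero[of B \<tau>] jfac_nonzero[of A "mobius B \<tau>"] by auto
  have "mobius B \<tau> * jfac B \<tau> = of_int (ma B) * \<tau> + of_int (mb B)"
    using nz by (simp add: mobius_eq)
  hence "(of_int (ma A) * mobius B \<tau> + of_int (mb A)) * jfac B \<tau> =
     of_int (ma (A ** B)) * \<tau> + of_int (mb (A ** B))"
    unfolding distrib_right mult.assoc by (simp only:) (simp add: jfac_def algebra_simps)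
  hence "mobius (A ** B) \<tau> = ((of_int (ma A) * mobius B \<tau> + of_int (mb A)) * jfac B \<tau>) / (jfac A (mobius B \<tau>) * jfac B \<tau>)"
    using assms by (simp add: mobius_eq[of "A ** B"] jfac_mult)
  thus ?thesis using nz by (simp add: mobius_eq[of A])
qed

lemma mobius_special [simp]:
  "mobius (mat 1) \<tau> = \<tau>" "mobius (Tmat k) \<tau> = \<tau> + of_int k" "mobius Smat \<tau> = - 1 / \<tau>" "mobius (- A) \<tau> = mobius A \<tau>"
proof -
  show "mobius (- A) \<tau> = mobius A \<tau>"
  proof -
    have "mobius (- A) \<tau> = (- (of_int (ma A) * \<tau> + of_int (mb A))) / (- (of_int (mc A) * \<tau> + of_int (md A)))"
      by (simp add: mobius_def)
    thus ?thesis by (simp only: minus_divide_divide) (simp add: mobius_def)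
  qed
qed (simp_all add: mobius_def Tmat_def Smat_def)

lemma jfac_special [simp]:
  "jfac (mat 1) \<tau> = 1" "jfac (Tmat k) \<tau> = 1" "jfac Smat \<tau> = \<tau>" "jfac (- A) \<tau> = - jfac A \<tau>"
  by (simp_all add: jfac_def Tmat_def Smat_def)

lemma mobius_deriv:
  assumes "A \<in> SL2" "\<tau> \<in> upper_half_plane"
  shows "(mobius A has_field_derivative 1 / (jfac A \<tau>)\<^sup>2) (at \<tau>)"
proof -
  have det: "of_int (ma A) * of_int (md A) - of_int (mb A) * of_int (mc A) = (1 :: complex)"
    using arg_cong[OF assms(1)[unfolded SL2_iff], of "of_int :: int \<Rightarrow> complex"] by simp
  have nz: "of_int (mc A) * \<tau> + of_int (md A) \<noteq> (0 :: complex)"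
    using jfac_nonzero[OF assms] by (simp add: jfac_def)
  have num: "of_int (ma A) * (of_int (mc A) * \<tau> + of_int (md A)) -
       (of_int (ma A) * \<tau> + of_int (mb A)) * of_int (mc A) = (1::complex)"
    using det by (simp add: algebra_simps)
  have "((\<lambda>\<tau>. (of_int (ma A) * \<tau> + of_int (mb A)) / (of_int (mc A) * \<tau> + of_int (md A)))
     has_field_derivative (of_int (ma A) * (of_int (mc A) * \<tau> + of_int (md A)) -
       (of_int (ma A) * \<tau> + of_int (mb A)) * of_int (mc A)) /
       ((of_int (mc A) * \<tau> + of_int (md A)) * (of_int (mc A) * \<tau> + of_int (md A)))) (at \<tau>)"
    using nz by (auto intro!: derivative_eq_intros)
  thus ?thesis unfolding num by (simp add: mobius_def[abs_def] jfac_def power2_eq_square)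
qed

lemma jfac_deriv: "(jfac A has_field_derivative of_int (mc A)) (at \<tau>)"
  unfolding jfac_def[abs_def] by (auto intro!: derivative_eq_intros)

lemma qexp_plus_int: "qexp (\<tau> + of_int k) = qexp \<tau>" 
proof -
  have "qexp (\<tau> + of_int k) = qexp \<tau> * exp (of_int (2 * k) * (of_real pi * \<i>))"
    by (simp add: algebra_simps flip: exp_add)
  also have "exp (of_int (2 * k) * (of_real pi * \<i>)) = 1"
    by (subst exp_eq_1) (auto intro!: exI[of _ k])
  finally show ?thesis by simp
qed

lemma E4_plus_int: "E4 (\<tau> + of_int k) = E4 \<tau>"
  unfolding E4_def qexp_plus_int ..

lemma E4_modular:
  assumes "A \<in> SL2" "\<tau> \<in> upper_half_plane"
  shows "E4 (mobius A \<tau>) = jfac A \<tau> ^ 4 * E4 \<tau>"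
proof -
  have "\<forall>\<tau>\<in>upper_half_plane. E4 (mobius A \<tau>) = jfac A \<tau> ^ 4 * E4 \<tau>"
    using assms(1)
  proof (induction rule: SL2_induct)
    case (T k)
    show ?case by (simp add: E4_plus_int)
  next
    case S
    show ?case using E4_minus_inverse by (simp add: in_H_iff)
  next
    case (mult A B)
    thus ?case by (simp add: mobius_mult jfac_mult power_mult_distrib)
  qed
  thus ?thesis using assms(2) by blast
qed

text \<open>Weight -1 is the weight for which an equation y'' = Q y with Q of weight 4 is preserved
  (Bol's identity for second derivatives).\<close>

definition slash :: "int ^ 2 ^ 2 \<Rightarrow> (complex \<Rightarrow> complex) \<Rightarrow> complex \<Rightarrow> complex" where
  "slash A y \<tau> = jfac A \<tau> * y (mobius A \<tau>)"

lemma slash_mult: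
  assumes "A \<in> SL2" "B \<in> SL2" "\<tau> \<in> upper_half_plane"
  shows "slash (A ** B) y \<tau> = slash B (slash A y) \<tau>"
  using assms by (simp add: slash_def mobius_mult jfac_mult)

lemma slash_cong:
  assumes "A \<in> SL2" "\<tau> \<in> upper_half_plane" "\<And>\<tau>. \<tau> \<in> upper_half_plane \<Longrightarrow> y \<tau> = z \<tau>"
  shows "slash A y \<tau> = slash A z \<tau>"
  using assms by (simp add: slash_def)

lemma slash_lincomb: "slash A (\<lambda>\<tau>. a * y \<tau> + b * z \<tau>) \<tau> = a * slash A y \<tau> + b * slash A z \<tau>"
  by (simp add: slash_def algebra_simps)

lemma slash_special [simp]: "slash (mat 1) y \<tau> = y \<tau>" "slash (- A) y \<tau> = - slash A y \<tau>"
  "slash (Tmat k) y \<tau> = y (\<tau> + of_int k)" "slash Smat y \<tau> = \<tau> * y (- 1 / \<tau>)"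
  by (simp_all add: slash_def)

section \<open>The linear equation and its Schwarzian quotients\<close>

text \<open>Identity theorem in pointwise form. Once the functions agree in a punctured
  neighbourhood of every point, they share their poles, where the normal form makes both 0, and
  elsewhere their limits, which are the values.\<close>

lemma nicely_meromorphic_eqI:
  assumes f: "f nicely_meromorphic_on A" and g: "g nicely_meromorphic_on A"
    and A: "open A" "connected A" and S: "open S" "S \<subseteq> A" "z0 \<in> S"
    and eq: "\<And>z. z \<in> S \<Longrightarrow> f z = g z" and z: "z \<in> A"
  shows "f z = g z"
proof -
  have "(\<lambda>z. f z - g z) meromorphic_on A"
    using f g by (auto simp: nicely_meromorphic_on_def intro!: meromorphic_intros)
  hence alt: "(\<forall>\<^sub>\<approx>z\<in>A. f z - g z = 0) \<or> (\<forall>\<^sub>\<approx>z\<in>A. f z - g z \<noteq> 0)"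
    using meromorphic_imp_constant_or_avoid A by blast
  have "eventually (\<lambda>z. z \<in> S) (at z0)" using S by (simp add: eventually_at_in_open')
  hence ev0: "eventually (\<lambda>z. f z - g z = 0) (at z0)" by eventually_elim (simp add: eq)
  have "\<not> (\<forall>\<^sub>\<approx>z\<in>A. f z - g z \<noteq> 0)"
  proof
    assume "\<forall>\<^sub>\<approx>z\<in>A. f z - g z \<noteq> 0"
    hence "eventually (\<lambda>z. f z - g z \<noteq> 0) (at z0)" using S A by (auto simp: eventually_cosparse_open_eq)
    with ev0 have "eventually (\<lambda>z. False) (at z0)" by eventually_elim auto
    thus False by simp
  qed
  hence "eventually (\<lambda>z. f z - g z = 0) (at z)" using alt A z by (auto simp: eventually_cosparse_open_eq)
  hence ev: "eventually (\<lambda>z. f z = g z) (at z)" by simp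
  have pole: "is_pole f z \<longleftrightarrow> is_pole g z" by (rule is_pole_cong[OF ev refl])
  show ?thesis
  proof (cases "is_pole f z")
    case True
    thus ?thesis using pole is_pole_zero_at_nicely_mero[OF f _ z] is_pole_zero_at_nicely_mero[OF g _ z] by simp
  next
    case False
    hence "f \<midarrow>z\<rightarrow> f z" "g \<midarrow>z\<rightarrow> g z" using f g z pole unfolding nicely_meromorphic_on_def by blast+
    moreover from this(1) have "g \<midarrow>z\<rightarrow> f z" using tendsto_cong[OF ev] by blast
    ultimately show ?thesis using LIM_unique by blast
  qed
qed

text \<open>The domain is a parameter because a Schwarzian solution is linearised first on a small
  disc, where its derivative has a holomorphic square root.\<close>

definition solves :: "(complex \<Rightarrow> complex) \<Rightarrow> complex set \<Rightarrow> (complex \<Rightarrow> complex) \<Rightarrow> bool" where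
  "solves Q S y \<longleftrightarrow> y holomorphic_on S \<and> (\<forall>z\<in>S. deriv (deriv y) z = Q z * y z)"

lemma solves_has_deriv:
  assumes "solves Q S y" "open S" "z \<in> S"
  shows "(y has_field_derivative deriv y z) (at z)" "(deriv y has_field_derivative Q z * y z) (at z)"
  using assms holomorphic_derivI[of y S z] holomorphic_derivI[of "deriv y" S z] holomorphic_deriv[of y S]
  by (auto simp: solves_def)

lemma solvesI:
  assumes S: "open S" and 1: "\<And>z. z \<in> S \<Longrightarrow> (y has_field_derivative y' z) (at z)"
    and 2: "\<And>z. z \<in> S \<Longrightarrow> (y' has_field_derivative Q z * y z) (at z)"
  shows "solves Q S y" "\<And>z. z \<in> S \<Longrightarrow> deriv y z = y' z"
proof -
  show d: "deriv y z = y' z" if "z \<in> S" for z using 1[OF that] by (rule DERIV_imp_deriv)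
  show "solves Q S y" unfolding solves_def
  proof (intro conjI ballI)
    show "y holomorphic_on S" using 1 S by (meson field_differentiable_at_within field_differentiable_def holomorphic_onI)
    fix z assume z: "z \<in> S"
    have "(deriv y has_field_derivative Q z * y z) (at z)"
      by (rule has_field_derivative_transform_within_open[OF 2[OF z] S z]) (simp add: d)
    thus "deriv (deriv y) z = Q z * y z" by (rule DERIV_imp_deriv)
  qed
qed

lemma solves_subset: "solves Q S y \<Longrightarrow> T \<subseteq> S \<Longrightarrow> solves Q T y"
  unfolding solves_def using holomorphic_on_subset by blast

lemma solves_lincomb:
  assumes "solves Q S f" "solves Q S g" "open S"
  shows "solves Q S (\<lambda>z. a * f z + b * g z)"
    "z \<in> S \<Longrightarrow> deriv (\<lambda>z. a * f z + b * g z) z = a * deriv f z + b * deriv g z"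
proof -
  let ?y = "\<lambda>z. a * f z + b * g z" and ?y' = "\<lambda>z. a * deriv f z + b * deriv g z"
  have 1: "(?y has_field_derivative ?y' z) (at z)" if "z \<in> S" for z
    using solves_has_deriv[OF assms(1,3) that] solves_has_deriv[OF assms(2,3) that]
    by (auto intro!: derivative_eq_intros)
  have 2: "(?y' has_field_derivative Q z * ?y z) (at z)" if "z \<in> S" for z
    using solves_has_deriv[OF assms(1,3) that] solves_has_deriv[OF assms(2,3) that]
    by (auto intro!: derivative_eq_intros simp: algebra_simps)
  show "solves Q S ?y" by (rule solvesI(1)[OF assms(3) 1 2])
  show "z \<in> S \<Longrightarrow> deriv ?y z = ?y' z" by (rule solvesI(2)[OF assms(3) 1 2])
qed

definition wronskian :: "(complex \<Rightarrow> complex) \<Rightarrow> (complex \<Rightarrow> complex) \<Rightarrow> complex \<Rightarrow> complex" where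
  "wronskian f g z = f z * deriv g z - deriv f z * g z"

lemma wronskian_constant:
  assumes "solves Q S f" "solves Q S g" "open S" "connected S" "z \<in> S" "w \<in> S"
  shows "wronskian f g z = wronskian f g w"
proof -
  have "(wronskian f g has_field_derivative 0) (at z)" if "z \<in> S" for z
    unfolding wronskian_def[abs_def]
    using solves_has_deriv[OF assms(1,3) that] solves_has_deriv[OF assms(2,3) that]
    by (auto intro!: derivative_eq_intros simp: algebra_simps)
  hence "\<exists>c. \<forall>z\<in>S. wronskian f g z = c"
    using has_field_derivative_0_imp_constant_on[of S "wronskian f g"] assms(3,4)
    by (auto simp: constant_on_def)
  thus ?thesis using assms(5,6) by auto
qed

text \<open>Cramer's rule: W(f,g) y = W(y,g) f + W(f,y) g is an identity, and all three Wronskians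
  are constant. This replaces the uniqueness theorem for initial values.\<close>

lemma solves_span:
  assumes f: "solves Q S f" and g: "solves Q S g" and y: "solves Q S y"
    and S: "open S" "connected S" "z0 \<in> S" and W: "wronskian f g z0 \<noteq> 0"
  obtains a b where "\<And>z. z \<in> S \<Longrightarrow> y z = a * f z + b * g z"
proof
  let ?W = "wronskian f g z0"
  fix z assume z: "z \<in> S"
  have "wronskian f g z = ?W" "wronskian y g z = wronskian y g z0" "wronskian f y z = wronskian f y z0"
    using wronskian_constant f g y S z by blast+
  moreover have "wronskian f g z * y z = wronskian y g z * f z + wronskian f y z * g z"
    by (simp add: wronskian_def algebra_simps)
  ultimately show "y z = (wronskian y g z0 / ?W) * f z + (wronskian f y z0 / ?W) * g z"
    using W by (simp add: field_simps)
qed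

text \<open>On a disc without zeros of g the quotient f / g has derivative 0; analytic continuation
  carries the proportionality to all of S.\<close>

lemma wronskian_zero_imp_dependent:
  assumes f: "solves Q S f" and g: "solves Q S g" and S: "open S" "connected S"
    and W: "z0 \<in> S" "wronskian f g z0 = 0" and z1: "z1 \<in> S" "g z1 \<noteq> 0"
  obtains c where "\<And>z. z \<in> S \<Longrightarrow> f z = c * g z"
proof
  have holf: "f holomorphic_on S" and holg: "g holomorphic_on S" using f g by (auto simp: solves_def)
  have op: "open (S \<inter> g -` (- {0}))"
    using continuous_open_preimage[OF holomorphic_on_imp_continuous_on[OF holg] S(1), of "- {0}"] by auto
  have "z1 \<in> S \<inter> g -` (- {0})" using z1 by simp
  then obtain r where r: "r > 0" "ball z1 r \<subseteq> S \<inter> g -` (- {0})"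
    using open_contains_ball[THEN iffD1, OF op] by blast
  hence r: "r > 0" "\<And>z. z \<in> ball z1 r \<Longrightarrow> z \<in> S \<and> g z \<noteq> 0" by auto
  have "((\<lambda>z. f z / g z) has_field_derivative 0) (at z)" if z: "z \<in> ball z1 r" for z
  proof -
    have zS: "z \<in> S" "g z \<noteq> 0" using r z by auto
    have "wronskian f g z = 0" using wronskian_constant[OF f g S W(1) zS(1)] W(2) by simp
    thus ?thesis using solves_has_deriv[OF f S(1) zS(1)] solves_has_deriv[OF g S(1) zS(1)] zS
      by (auto intro!: derivative_eq_intros simp: wronskian_def algebra_simps)
  qed
  hence "(\<lambda>z. f z / g z) constant_on ball z1 r"
    by (intro has_field_derivative_0_imp_constant_on) auto
  then obtain c where "\<forall>z\<in>ball z1 r. f z / g z = c" by (auto simp: constant_on_def)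
  hence c: "f z / g z = f z1 / g z1" if "z \<in> ball z1 r" for z using that r(1) by simp
  fix z assume z: "z \<in> S"
  show "f z = (f z1 / g z1) * g z"
  proof (rule analytic_continuation_open[where s = "ball z1 r" and s' = S and f = f and g = "\<lambda>z. f z1 / g z1 * g z"])
    show "f w = f z1 / g z1 * g w" if "w \<in> ball z1 r" for w
      using c[OF that] r(2)[OF that] z1 by (simp add: field_simps)
  qed (use r S z holf holg in \<open>auto intro!: holomorphic_intros\<close>)
qed

abbreviation lin_sol :: "complex \<Rightarrow> (complex \<Rightarrow> complex) \<Rightarrow> bool" where
  "lin_sol s y \<equiv> solves (\<lambda>\<tau>. - (s / 2) * E4 \<tau>) upper_half_plane y"

lemma slash_has_deriv:
  assumes A: "A \<in> SL2" and t: "\<tau> \<in> upper_half_plane" and y: "y holomorphic_on upper_half_plane"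
  shows "(slash A y has_field_derivative of_int (mc A) * y (mobius A \<tau>) + deriv y (mobius A \<tau>) / jfac A \<tau>) (at \<tau>)"
proof -
  have nz: "jfac A \<tau> \<noteq> 0" by (rule jfac_nonzero[OF A t])
  have d: "(y has_field_derivative deriv y (mobius A \<tau>)) (at (mobius A \<tau>))"
    using y A t by (intro holomorphic_derivI[of _ upper_half_plane]) auto
  have "((\<lambda>\<tau>. jfac A \<tau> * y (mobius A \<tau>)) has_field_derivative
    jfac A \<tau> * (deriv y (mobius A \<tau>) * (1 / (jfac A \<tau>)\<^sup>2)) + of_int (mc A) * y (mobius A \<tau>)) (at \<tau>)"
    by (rule DERIV_mult'[OF jfac_deriv DERIV_chain2[OF d mobius_deriv[OF A t]]])
  thus ?thesis using nz by (simp add: slash_def[abs_def] power2_eq_square add.commute)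
qed

text \<open>With j = \<open>jfac A\<close>, the terms in y' cancel and the second derivative of j
  y(A tau) is j^-3 y''(A tau). The factor j^4 from E4 then restores j y(A tau).\<close>

lemma lin_sol_slash:
  assumes y: "lin_sol s y" and A: "A \<in> SL2"
  shows "lin_sol s (slash A y)"
    "\<And>\<tau>. \<tau> \<in> upper_half_plane \<Longrightarrow> deriv (slash A y) \<tau> = of_int (mc A) * y (mobius A \<tau>) + deriv y (mobius A \<tau>) / jfac A \<tau>"
proof -
  have *: "(slash A y has_field_derivative of_int (mc A) * y (mobius A \<tau>) + deriv y (mobius A \<tau>) / jfac A \<tau>) (at \<tau>) \<and>
     ((\<lambda>\<tau>. of_int (mc A) * y (mobius A \<tau>) + deriv y (mobius A \<tau>) / jfac A \<tau>) has_field_derivative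
     - (s / 2) * E4 \<tau> * slash A y \<tau>) (at \<tau>)" if t: "\<tau> \<in> upper_half_plane" for \<tau>
  proof
  have nz: "jfac A \<tau> \<noteq> 0" by (rule jfac_nonzero[OF A t])
  have mt: "mobius A \<tau> \<in> upper_half_plane" using A t by blast
  note d = DERIV_chain2[OF solves_has_deriv(1)[OF y open_H mt] mobius_deriv[OF A t]]
  note d' = DERIV_chain2[OF solves_has_deriv(2)[OF y open_H mt] mobius_deriv[OF A t]]
  show "(slash A y has_field_derivative of_int (mc A) * y (mobius A \<tau>) + deriv y (mobius A \<tau>) / jfac A \<tau>) (at \<tau>)"
    using slash_has_deriv[OF A t] y by (auto simp: solves_def)
  have "((\<lambda>\<tau>. of_int (mc A) * y (mobius A \<tau>) + deriv y (mobius A \<tau>) / jfac A \<tau>) has_field_derivative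
     of_int (mc A) * (deriv y (mobius A \<tau>) * (1 / (jfac A \<tau>)\<^sup>2)) +
     ((- (s / 2) * E4 (mobius A \<tau>) * y (mobius A \<tau>) * (1 / (jfac A \<tau>)\<^sup>2)) * jfac A \<tau> -
       deriv y (mobius A \<tau>) * of_int (mc A)) / (jfac A \<tau> * jfac A \<tau>)) (at \<tau>)"
    by (intro DERIV_add DERIV_cmult DERIV_divide d d' jfac_deriv nz)
  also have "of_int (mc A) * (deriv y (mobius A \<tau>) * (1 / (jfac A \<tau>)\<^sup>2)) +
     ((- (s / 2) * E4 (mobius A \<tau>) * y (mobius A \<tau>) * (1 / (jfac A \<tau>)\<^sup>2)) * jfac A \<tau> -
       deriv y (mobius A \<tau>) * of_int (mc A)) / (jfac A \<tau> * jfac A \<tau>) = - (s / 2) * E4 \<tau> * slash A y \<tau>"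
    using nz unfolding E4_modular[OF A t] slash_def
    by (simp add: field_simps power2_eq_square power4_eq_xxxx)
  finally show "((\<lambda>\<tau>. of_int (mc A) * y (mobius A \<tau>) + deriv y (mobius A \<tau>) / jfac A \<tau>) has_field_derivative
     - (s / 2) * E4 \<tau> * slash A y \<tau>) (at \<tau>)" .
  qed
  show "lin_sol s (slash A y)"
    by (rule solvesI(1)[OF open_H conjunct1[OF *] conjunct2[OF *]])
  show "\<And>\<tau>. \<tau> \<in> upper_half_plane \<Longrightarrow> deriv (slash A y) \<tau> = of_int (mc A) * y (mobius A \<tau>) + deriv y (mobius A \<tau>) / jfac A \<tau>"
    by (rule solvesI(2)[OF open_H conjunct1[OF *] conjunct2[OF *]])
qed

text \<open>By the constant Wronskian w the derivative of the quotient is -w / u2^2. Hence the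
  Schwarzian depends on u2 alone and equals -2 u2'' / u2.\<close>

lemma quotient_schwarz_solution:
  assumes u1: "lin_sol s u1" and u2: "lin_sol s u2" and W: "z0 \<in> upper_half_plane" "wronskian u1 u2 z0 \<noteq> 0"
  shows "schwarz_solution s (\<lambda>\<tau>. u1 \<tau> / u2 \<tau>)"
proof -
  define w where "w = wronskian u1 u2 z0"
  have w0: "w \<noteq> 0" using W by (simp add: w_def)
  have wc: "wronskian u1 u2 \<tau> = w" if "\<tau> \<in> upper_half_plane" for \<tau>
    unfolding w_def using wronskian_constant[OF u1 u2 _ _ that W(1)] by simp
  have hol: "u1 holomorphic_on upper_half_plane" "u2 holomorphic_on upper_half_plane"
    using u1 u2 by (auto simp: solves_def)
  have cont: "isCont u1 \<tau>" "isCont u2 \<tau>" if "\<tau> \<in> upper_half_plane" for \<tau>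
    using hol that by (metis open_H holomorphic_on_imp_continuous_on continuous_on_eq_continuous_at)+
  let ?h = "\<lambda>\<tau>. u1 \<tau> / u2 \<tau>"
  define U where "U = {\<tau> \<in> upper_half_plane. u2 \<tau> \<noteq> 0}"
  have U: "open U"
  proof -
    have "U = upper_half_plane \<inter> u2 -` (- {0})" by (auto simp: U_def)
    thus ?thesis using continuous_open_preimage[OF holomorphic_on_imp_continuous_on[OF hol(2)] open_H, of "- {0}"] by auto
  qed
  have nonz: "\<exists>\<tau>\<in>upper_half_plane. u2 \<tau> \<noteq> 0"
  proof (rule ccontr)
    assume "\<not> ?thesis"
    hence z: "u2 \<tau> = 0" if "\<tau> \<in> upper_half_plane" for \<tau> using that by auto
    have "(u2 has_field_derivative 0) (at z0)"
      by (rule has_field_derivative_transform_within_open[OF DERIV_const open_H W(1)]) (simp add: z)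
    hence "deriv u2 z0 = 0" by (rule DERIV_imp_deriv)
    thus False using W z by (simp add: wronskian_def)
  qed
  have evU: "eventually (\<lambda>z. z \<in> U) (at \<tau>)" if t: "\<tau> \<in> upper_half_plane" for \<tau>
  proof -
    obtain \<beta> where b: "\<beta> \<in> upper_half_plane" "u2 \<beta> \<noteq> 0" using nonz by blast
    have "eventually (\<lambda>z. u2 z \<noteq> 0 \<and> z \<in> upper_half_plane) (at \<tau>)"
      by (rule non_zero_neighbour_alt[OF hol(2) _ _ t b]) auto
    thus ?thesis by eventually_elim (simp add: U_def)
  qed
  have dU: "(u1 has_field_derivative deriv u1 \<tau>) (at \<tau>)" "(u2 has_field_derivative deriv u2 \<tau>) (at \<tau>)"
      "(deriv u2 has_field_derivative - (s / 2) * E4 \<tau> * u2 \<tau>) (at \<tau>)" "u2 \<tau> \<noteq> 0"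
    if "\<tau> \<in> U" for \<tau>
    using that solves_has_deriv[OF u1 open_H] solves_has_deriv[OF u2 open_H] by (auto simp: U_def)
  have d1: "deriv ?h \<tau> = - w / (u2 \<tau>)\<^sup>2" if "\<tau> \<in> U" for \<tau>
  proof -
    have "(?h has_field_derivative - w / (u2 \<tau>)\<^sup>2) (at \<tau>)"
      using dU[OF that] wc[of \<tau>] that
      by (auto intro!: derivative_eq_intros simp: U_def wronskian_def power2_eq_square algebra_simps)
    thus ?thesis by (rule DERIV_imp_deriv)
  qed
  have d2: "deriv (deriv ?h) \<tau> = 2 * w * deriv u2 \<tau> / u2 \<tau> ^ 3" if "\<tau> \<in> U" for \<tau>
  proof -
    have "((\<lambda>\<tau>. - w / (u2 \<tau>)\<^sup>2) has_field_derivative 2 * w * deriv u2 \<tau> / u2 \<tau> ^ 3) (at \<tau>)"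
      using dU[OF that]
      by (auto intro!: derivative_eq_intros simp: power2_eq_square power3_eq_cube field_simps)
    hence "(deriv ?h has_field_derivative 2 * w * deriv u2 \<tau> / u2 \<tau> ^ 3) (at \<tau>)"
      by (rule has_field_derivative_transform_within_open[OF _ U that]) (simp add: d1)
    thus ?thesis by (rule DERIV_imp_deriv)
  qed
  have d3: "deriv (deriv (deriv ?h)) \<tau> = 2 * w * (- (s / 2) * E4 \<tau> * u2 \<tau> / u2 \<tau> ^ 3 - 3 * (deriv u2 \<tau>)\<^sup>2 / u2 \<tau> ^ 4)" if "\<tau> \<in> U" for \<tau>
  proof -
    have "((\<lambda>\<tau>. 2 * w * deriv u2 \<tau> / u2 \<tau> ^ 3) has_field_derivative 2 * w * (- (s / 2) * E4 \<tau> * u2 \<tau> / u2 \<tau> ^ 3 - 3 * (deriv u2 \<tau>)\<^sup>2 / u2 \<tau> ^ 4)) (at \<tau>)"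
      using dU[OF that]
      by (auto intro!: derivative_eq_intros simp: power2_eq_square power3_eq_cube power4_eq_xxxx field_simps)
    hence "(deriv (deriv ?h) has_field_derivative 2 * w * (- (s / 2) * E4 \<tau> * u2 \<tau> / u2 \<tau> ^ 3 - 3 * (deriv u2 \<tau>)\<^sup>2 / u2 \<tau> ^ 4)) (at \<tau>)"
      by (rule has_field_derivative_transform_within_open[OF _ U that]) (simp add: d2)
    thus ?thesis by (rule DERIV_imp_deriv)
  qed
  have S: "schwarz_deriv ?h \<tau> = s * E4 \<tau>" if "\<tau> \<in> U" for \<tau>
  proof -
    have "(deriv ^^ 3) ?h \<tau> = deriv (deriv (deriv ?h)) \<tau>" "(deriv ^^ 2) ?h \<tau> = deriv (deriv ?h) \<tau>"
      by (simp_all add: numeral_3_eq_3 numeral_2_eq_2)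
    hence "schwarz_deriv ?h \<tau> = 2 * w * (- (s / 2) * E4 \<tau> * u2 \<tau> / u2 \<tau> ^ 3 - 3 * (deriv u2 \<tau>)\<^sup>2 / u2 \<tau> ^ 4) / (- w / (u2 \<tau>)\<^sup>2)
       - 3 / 2 * ((2 * w * deriv u2 \<tau> / u2 \<tau> ^ 3) / (- w / (u2 \<tau>)\<^sup>2))\<^sup>2"
      unfolding schwarz_deriv_def d1[OF that, symmetric] d2[OF that, symmetric] d3[OF that, symmetric] by (simp only:)
    also have "\<dots> = s * E4 \<tau>"
      using w0 dU(4)[OF that] by (simp add: field_simps power2_eq_square power3_eq_cube power4_eq_xxxx)
    finally show ?thesis .
  qed
  have "\<forall>\<^sub>\<approx>\<tau>\<in>upper_half_plane. schwarz_deriv ?h \<tau> = s * E4 \<tau>"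
    unfolding eventually_cosparse_open_eq[OF open_H]
  proof
    fix \<tau> assume "\<tau> \<in> upper_half_plane"
    from evU[OF this] show "eventually (\<lambda>\<tau>. schwarz_deriv ?h \<tau> = s * E4 \<tau>) (at \<tau>)"
      by eventually_elim (rule S)
  qed
  moreover have "?h nicely_meromorphic_on upper_half_plane"
    unfolding nicely_meromorphic_on_def
  proof (intro conjI ballI)
    show "?h meromorphic_on upper_half_plane"
      using hol by (intro meromorphic_on_divide analytic_on_imp_meromorphic_on) (simp_all add: analytic_on_open)
    fix \<tau> assume t: "\<tau> \<in> upper_half_plane"
    show "is_pole ?h \<tau> \<and> ?h \<tau> = 0 \<or> ?h \<midarrow>\<tau>\<rightarrow> ?h \<tau>"
    proof (cases "u2 \<tau> = 0")
      \<comment> \<open>The Wronskian is nonzero, so u1 does not vanish here as well and this is a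
        genuine pole. Division by zero gives the value 0 that the normal form prescribes.\<close>
      case True
      have "is_pole ?h \<tau>"
      proof (rule is_pole_divide)
        show "isCont u1 \<tau>" using cont t by blast
        show "filterlim u2 (at 0) (at \<tau>)"
          unfolding filterlim_at
        proof
          show "u2 \<midarrow>\<tau>\<rightarrow> 0" using cont(2)[OF t] True by (simp add: isCont_def)

          show "\<forall>\<^sub>F x in at \<tau>. u2 x \<in> UNIV \<and> u2 x \<noteq> 0" using evU[OF t] by eventually_elim (simp add: U_def)
        qed
        show "u1 \<tau> \<noteq> 0" using wc[OF t] w0 True by (auto simp: wronskian_def)
      qed
      thus ?thesis using True by simp
    next
      case False
      thus ?thesis using cont[OF t] by (auto simp: isCont_def intro!: tendsto_intros)
    qed
  qed
  moreover have "\<not> ?h constant_on upper_half_plane"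
  proof
    assume "?h constant_on upper_half_plane"
    then obtain c where c: "\<And>z. z \<in> upper_half_plane \<Longrightarrow> ?h z = c" by (auto simp: constant_on_def)
    obtain \<beta> where b: "\<beta> \<in> U" using nonz by (auto simp: U_def)
    hence bH: "\<beta> \<in> upper_half_plane" by (simp add: U_def)
    have "(?h has_field_derivative 0) (at \<beta>)"
      by (rule has_field_derivative_transform_within_open[OF DERIV_const open_H bH]) (simp add: c)
    hence "deriv ?h \<beta> = 0" by (rule DERIV_imp_deriv)
    thus False using d1[OF b] w0 dU(4)[OF b] by simp
  qed
  ultimately show ?thesis unfolding schwarz_solution_def by blast
qed

text \<open>Inverse of the quotient construction: with g^2 = h' the functions h / g and 1 / g have
  quotient h, and the Schwarzian equation for h becomes the linear equation for both.\<close>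

lemma solves_local_schwarz:
  assumes "g holomorphic_on B" "h holomorphic_on B" and B: "open B"
    and g: "\<And>z. z \<in> B \<Longrightarrow> deriv h z = (g z)\<^sup>2" "\<And>z. z \<in> B \<Longrightarrow> g z \<noteq> 0"
    and S: "\<And>z. z \<in> B \<Longrightarrow> schwarz_deriv h z = - 2 * Q z"
  shows "solves Q B (\<lambda>z. 1 / g z)" "solves Q B (\<lambda>z. h z / g z)"
    "\<And>z. z \<in> B \<Longrightarrow> wronskian (\<lambda>z. h z / g z) (\<lambda>z. 1 / g z) z = -1"
proof -
  have dg: "(g has_field_derivative deriv g z) (at z)" "(deriv g has_field_derivative deriv (deriv g) z) (at z)"
    "(h has_field_derivative (g z)\<^sup>2) (at z)" if "z \<in> B" for z
    using holomorphic_derivI[OF assms(1) B that] holomorphic_derivI[OF holomorphic_deriv[OF assms(1) B] B that]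
      holomorphic_derivI[OF assms(2) B that] g(1)[OF that] by auto
  have h2: "deriv (deriv h) z = 2 * g z * deriv g z" if z: "z \<in> B" for z
  proof -
    have "((\<lambda>z. (g z)\<^sup>2) has_field_derivative 2 * g z * deriv g z) (at z)"
      using dg[OF z] by (auto intro!: derivative_eq_intros)
    hence "(deriv h has_field_derivative 2 * g z * deriv g z) (at z)"
      by (rule has_field_derivative_transform_within_open[OF _ B z]) (simp add: g)
    thus ?thesis by (rule DERIV_imp_deriv)
  qed
  have h3: "deriv (deriv (deriv h)) z = 2 * (deriv g z)\<^sup>2 + 2 * g z * deriv (deriv g) z" if z: "z \<in> B" for z
  proof -
    have "((\<lambda>z. 2 * g z * deriv g z) has_field_derivative 2 * (deriv g z)\<^sup>2 + 2 * g z * deriv (deriv g) z) (at z)"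
      using dg[OF z] by (auto intro!: derivative_eq_intros simp: power2_eq_square)
    hence "(deriv (deriv h) has_field_derivative 2 * (deriv g z)\<^sup>2 + 2 * g z * deriv (deriv g) z) (at z)"
      by (rule has_field_derivative_transform_within_open[OF _ B z]) (simp add: h2)
    thus ?thesis by (rule DERIV_imp_deriv)
  qed
  have Q: "Q z = 2 * (deriv g z)\<^sup>2 / (g z)\<^sup>2 - deriv (deriv g) z / g z" if z: "z \<in> B" for z
  proof -
    have "(deriv ^^ 3) h z = deriv (deriv (deriv h)) z" "(deriv ^^ 2) h z = deriv (deriv h) z"
      by (simp_all add: numeral_3_eq_3 numeral_2_eq_2)
    hence "schwarz_deriv h z = (2 * (deriv g z)\<^sup>2 + 2 * g z * deriv (deriv g) z) / (g z)\<^sup>2 - 3 / 2 * (2 * g z * deriv g z / (g z)\<^sup>2)\<^sup>2"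
      unfolding schwarz_deriv_def h2[OF z, symmetric] h3[OF z, symmetric] g(1)[OF z, symmetric] by (simp only:)
    also have "\<dots> = - 2 * (2 * (deriv g z)\<^sup>2 / (g z)\<^sup>2 - deriv (deriv g) z / g z)"
      using g(2)[OF z] by (simp add: field_simps power2_eq_square)
    finally have "- 2 * Q z = - 2 * (2 * (deriv g z)\<^sup>2 / (g z)\<^sup>2 - deriv (deriv g) z / g z)"
      unfolding S[OF z] .
    moreover have "(-2 :: complex) \<noteq> 0" by simp
    ultimately show ?thesis by (simp only: mult_cancel_left) blast
  qed
  have d1: "((\<lambda>z. 1 / g z) has_field_derivative - deriv g z / (g z)\<^sup>2) (at z)" if z: "z \<in> B" for z
    using dg[OF z] g(2)[OF z] by (auto intro!: derivative_eq_intros simp: power2_eq_square)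
  have d2: "((\<lambda>z. - deriv g z / (g z)\<^sup>2) has_field_derivative Q z * (1 / g z)) (at z)" if z: "z \<in> B" for z
    using dg[OF z] g(2)[OF z] unfolding Q[OF z]
    by (auto intro!: derivative_eq_intros simp: power2_eq_square field_simps)
  have d3: "((\<lambda>z. h z / g z) has_field_derivative g z - h z * deriv g z / (g z)\<^sup>2) (at z)" if z: "z \<in> B" for z
    using dg[OF z] g(2)[OF z] by (auto intro!: derivative_eq_intros simp: power2_eq_square field_simps)
  have d4: "((\<lambda>z. g z - h z * deriv g z / (g z)\<^sup>2) has_field_derivative Q z * (h z / g z)) (at z)" if z: "z \<in> B" for z
    using dg[OF z] g(2)[OF z] unfolding Q[OF z]
    by (auto intro!: derivative_eq_intros simp: power2_eq_square field_simps)
  note s1 = solvesI[OF B d1 d2] and s2 = solvesI[OF B d3 d4]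
  show "solves Q B (\<lambda>z. 1 / g z)" "solves Q B (\<lambda>z. h z / g z)" by (rule s1 s2; assumption)+
  show "wronskian (\<lambda>z. h z / g z) (\<lambda>z. 1 / g z) z = -1" if "z \<in> B" for z
    unfolding wronskian_def DERIV_imp_deriv[OF d1[OF that]] DERIV_imp_deriv[OF d3[OF that]]
    using g(2)[OF that] by (simp add: field_simps power2_eq_square)
qed

lemma quotient_nicely_meromorphic:
  assumes "lin_sol s u1" "lin_sol s u2" "z0 \<in> upper_half_plane" "wronskian u1 u2 z0 \<noteq> 0"
  shows "(\<lambda>\<tau>. u1 \<tau> / u2 \<tau>) nicely_meromorphic_on upper_half_plane"
  using quotient_schwarz_solution[OF assms] by (simp add: schwarz_solution_def)

text \<open>The linearisation lives only on a disc, but there it is a combination of the global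
  solutions y1 and y2, and the same combination defines u1 and u2 everywhere. The identity theorem
  then extends h = u1 / u2.\<close>

lemma schwarz_solution_quotient:
  assumes h: "schwarz_solution s h"
    and y: "lin_sol s y1" "lin_sol s y2" "wronskian y1 y2 \<i> \<noteq> 0"
  obtains u1 u2 where "lin_sol s u1" "lin_sol s u2" "wronskian u1 u2 \<i> \<noteq> 0"
    "\<And>\<tau>. \<tau> \<in> upper_half_plane \<Longrightarrow> h \<tau> = u1 \<tau> / u2 \<tau>"
proof -
  have mero: "h nicely_meromorphic_on upper_half_plane" and nc: "\<not> h constant_on upper_half_plane"
    and ev: "\<forall>\<^sub>\<approx>\<tau>\<in>upper_half_plane. schwarz_deriv h \<tau> = s * E4 \<tau>"
    using h by (auto simp: schwarz_solution_def)
  have ev_an: "\<forall>\<^sub>\<approx>\<tau>\<in>upper_half_plane. h analytic_on {\<tau>}"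
    using mero by (intro meromorphic_on_imp_analytic_cosparse) (simp add: nicely_meromorphic_on_def)
  have "\<exists>z. z \<in> upper_half_plane \<and> h analytic_on {z} \<and> deriv h z \<noteq> 0"
  proof (rule ccontr)
    assume "\<not> ?thesis"
    hence z: "deriv h z = 0" if "z \<in> upper_half_plane" "h analytic_on {z}" for z using that by blast
    have "eventually (\<lambda>z. h analytic_on {z} \<and> z \<in> upper_half_plane) (at \<i>)"
      using ev_an eventually_at_in_open'[OF open_H i_in_H]
      by (auto simp: eventually_cosparse_open_eq eventually_conj_iff)
    from eventually_happens'[OF at_neq_bot this]
    obtain z1 where z1: "h analytic_on {z1}" "z1 \<in> upper_half_plane" by blast
    then obtain r where r: "r > 0" "h holomorphic_on ball z1 r" by (auto simp: analytic_at_ball)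
    obtain r' where r': "r' > 0" "ball z1 r' \<subseteq> upper_half_plane" using open_H z1 openE by blast
    define R where "R = min r r'"
    have R: "R > 0" "h holomorphic_on ball z1 R" "ball z1 R \<subseteq> upper_half_plane"
      using r r' holomorphic_on_subset[OF r(2), of "ball z1 R"] by (auto simp: R_def)
    have "(h has_field_derivative 0) (at z)" if "z \<in> ball z1 R" for z
    proof -
      have "h analytic_on {z}" using R that by (meson analytic_on_analytic_at analytic_on_open open_ball)
      hence "deriv h z = 0" using z R that by blast
      thus ?thesis using holomorphic_derivI[OF R(2) open_ball that] by simp
    qed
    hence "h constant_on ball z1 R"
      by (intro has_field_derivative_0_imp_constant_on) auto
    hence "h constant_on upper_half_plane"
      by (rule constant_on_extend_nicely_meromorphic_on[OF mero]) (use R in auto)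
    thus False using nc by blast
  qed
  then obtain z1 where z1: "z1 \<in> upper_half_plane" "h analytic_on {z1}" "deriv h z1 \<noteq> 0" by blast
  obtain r where r: "r > 0" "h holomorphic_on ball z1 r" using z1 by (auto simp: analytic_at_ball)
  have hol': "deriv h holomorphic_on ball z1 r" using r by (intro holomorphic_deriv) auto
  have "isCont (deriv h) z1"
    using hol' r by (metis centre_in_ball continuous_on_interior holomorphic_on_imp_continuous_on interior_ball)
  hence "eventually (\<lambda>z. deriv h z \<noteq> 0) (at z1)"
    using z1 by (intro tendsto_imp_eventually_ne) (auto simp: isCont_def)
  moreover have "eventually (\<lambda>z. z \<in> ball z1 r \<inter> upper_half_plane) (at z1)"
    using r z1 by (intro eventually_at_in_open') auto
  moreover have "eventually (\<lambda>z. schwarz_deriv h z = s * E4 z) (at z1)"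
    using ev z1 by (auto simp: eventually_cosparse_open_eq)
  ultimately have "eventually (\<lambda>z. z \<in> ball z1 r \<inter> upper_half_plane \<and> deriv h z \<noteq> 0 \<and> schwarz_deriv h z = s * E4 z) (at z1)"
    by eventually_elim auto
  then obtain d where d: "d > 0" "\<And>z. z \<noteq> z1 \<Longrightarrow> dist z z1 < d \<Longrightarrow>
      z \<in> ball z1 r \<inter> upper_half_plane \<and> deriv h z \<noteq> 0 \<and> schwarz_deriv h z = s * E4 z"
    unfolding eventually_at by auto
  \<comment> \<open>The required properties are known only in a punctured disc around z1. The disc
    of radius d/2 about the shifted centre lies inside it, with z1 on its boundary.\<close>
  define z0 where "z0 = z1 + of_real (d / 2)"
  define B where "B = ball z0 (d / 2)"
  have B: "z \<noteq> z1 \<and> dist z z1 < d" if "z \<in> B" for z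
  proof -
    have d0: "dist z0 z1 = d / 2" using d(1) by (simp add: z0_def dist_norm norm_divide)
    have "dist z0 z < d / 2" using that by (simp add: B_def)
    thus ?thesis using d0 dist_triangle[of z z1 z0] by (auto simp: dist_commute)
  qed
  have z0: "z0 \<in> B" "open B" "connected B" "simply_connected B"
    using d(1) by (auto simp: B_def convex_imp_simply_connected)
  have BH: "B \<subseteq> upper_half_plane" "B \<subseteq> ball z1 r" using B d(2) by auto
  have holB: "h holomorphic_on B" "deriv h holomorphic_on B"
    using r(2) hol' BH holomorphic_on_subset by blast+
  obtain g where g: "g holomorphic_on B" "\<And>z. z \<in> B \<Longrightarrow> deriv h z = (g z)\<^sup>2"
  proof -
    have "\<forall>z\<in>B. deriv h z \<noteq> 0" using B d(2) by blast
    moreover have "\<forall>f. f holomorphic_on B \<and> (\<forall>z\<in>B. f z \<noteq> 0) \<longrightarrow> (\<exists>g. g holomorphic_on B \<and> (\<forall>z\<in>B. f z = (g z)\<^sup>2))"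
      using simply_connected_eq_holomorphic_sqrt[OF z0(2)] z0(4) by simp
    ultimately show ?thesis using holB(2) that by blast
  qed
  have gnz: "g z \<noteq> 0" if "z \<in> B" for z using g(2)[OF that] B[OF that] d(2)[of z] by auto
  have Sz: "schwarz_deriv h z = - 2 * (- (s / 2) * E4 z)" if "z \<in> B" for z
    using B[OF that] d(2)[of z] by simp
  note loc = solves_local_schwarz[OF g(1) holB(1) z0(2) g(2) gnz Sz]
  have s1: "solves (\<lambda>\<tau>. - (s / 2) * E4 \<tau>) B (\<lambda>z. 1 / g z)" and s2: "solves (\<lambda>\<tau>. - (s / 2) * E4 \<tau>) B (\<lambda>z. h z / g z)"
    and s3: "wronskian (\<lambda>z. h z / g z) (\<lambda>z. 1 / g z) z0 = -1"
    by (rule loc; use z0 in simp)+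
  have yB: "solves (\<lambda>\<tau>. - (s / 2) * E4 \<tau>) B y1" "solves (\<lambda>\<tau>. - (s / 2) * E4 \<tau>) B y2"
    using y BH solves_subset by blast+
  have W: "wronskian y1 y2 z0 \<noteq> 0"
    using y(3) wronskian_constant[OF y(1,2) open_H connected_H _ i_in_H, of z0] BH z0 by auto
  obtain a b where ab: "\<And>z. z \<in> B \<Longrightarrow> h z / g z = a * y1 z + b * y2 z"
    using solves_span[OF yB s2 z0(2,3,1) W] by blast
  obtain a' b' where ab': "\<And>z. z \<in> B \<Longrightarrow> 1 / g z = a' * y1 z + b' * y2 z"
    using solves_span[OF yB s1 z0(2,3,1) W] by blast
  define u1 where "u1 = (\<lambda>z. a * y1 z + b * y2 z)"
  define u2 where "u2 = (\<lambda>z. a' * y1 z + b' * y2 z)"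
  have u: "lin_sol s u1" "lin_sol s u2" unfolding u1_def u2_def by (rule solves_lincomb[OF y(1,2) open_H])+
  have "deriv u1 z0 = deriv (\<lambda>z. h z / g z) z0" "deriv u2 z0 = deriv (\<lambda>z. 1 / g z) z0"
  proof -
    have ev: "eventually (\<lambda>z. z \<in> B) (nhds z0)" using z0 by (simp add: eventually_nhds_in_open)
    from ev have "eventually (\<lambda>z. u1 z = h z / g z) (nhds z0)" by eventually_elim (simp add: u1_def ab)
    from deriv_cong_ev[OF this refl] show "deriv u1 z0 = deriv (\<lambda>z. h z / g z) z0" .
    from ev have "eventually (\<lambda>z. u2 z = 1 / g z) (nhds z0)" by eventually_elim (simp add: u2_def ab')
    from deriv_cong_ev[OF this refl] show "deriv u2 z0 = deriv (\<lambda>z. 1 / g z) z0" .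
  qed
  moreover have "u1 z0 = h z0 / g z0" "u2 z0 = 1 / g z0" using ab ab' z0 by (auto simp: u1_def u2_def)
  ultimately have "wronskian u1 u2 z0 = -1" using s3 by (simp add: wronskian_def)
  hence W': "wronskian u1 u2 \<i> \<noteq> 0"
    using wronskian_constant[OF u open_H connected_H i_in_H, of z0] BH z0 by auto
  have "h \<tau> = u1 \<tau> / u2 \<tau>" if t: "\<tau> \<in> upper_half_plane" for \<tau>
  proof (rule nicely_meromorphic_eqI[OF mero quotient_nicely_meromorphic[OF u i_in_H W'] open_H connected_H z0(2) BH(1) z0(1) _ t])
    fix z assume z: "z \<in> B"
    show "h z = u1 z / u2 z" unfolding u1_def u2_def ab[OF z, symmetric] ab'[OF z, symmetric]
      using gnz[OF z] by simp
  qed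
  thus ?thesis using that u W' by blast
qed

section \<open>Invariance groups of Schwarzian solutions\<close>

definition scalar_group :: "complex \<Rightarrow> (int ^ 2 ^ 2) set" where
  "scalar_group s = {A \<in> SL2. \<exists>c. \<forall>y. lin_sol s y \<longrightarrow> (\<forall>\<tau>\<in>upper_half_plane. slash A y \<tau> = c * y \<tau>)}"

lemma common_nonzero:
  assumes "solves Q S f" "solves Q S g" "open S" "connected S"
    and "z1 \<in> S" "f z1 \<noteq> 0" "z2 \<in> S" "g z2 \<noteq> 0"
  shows "\<exists>z\<in>S. f z \<noteq> 0 \<and> g z \<noteq> 0"
proof -
  have "eventually (\<lambda>z. f z \<noteq> 0 \<and> z \<in> S) (at z1)"
    by (rule non_zero_neighbour_alt[of f S z1 z1]) (use assms in \<open>auto simp: solves_def\<close>)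
  moreover have "eventually (\<lambda>z. g z \<noteq> 0 \<and> z \<in> S) (at z1)"
    by (rule non_zero_neighbour_alt[of g S z1 z2]) (use assms in \<open>auto simp: solves_def\<close>)
  ultimately have "eventually (\<lambda>z. z \<in> S \<and> f z \<noteq> 0 \<and> g z \<noteq> 0) (at z1)" by eventually_elim auto
  from eventually_happens'[OF at_neq_bot this] show ?thesis by blast
qed

lemma wronskian_nonzero_imp_nonzero:
  assumes "wronskian f g z \<noteq> 0" "solves Q S f" "solves Q S g" "open S" "z \<in> S"
  shows "\<exists>z\<in>S. f z \<noteq> 0" "\<exists>z\<in>S. g z \<noteq> 0"
proof -
  have "deriv f z = 0" if "\<And>z. z \<in> S \<Longrightarrow> f z = 0" for f
  proof (rule DERIV_imp_deriv)
    show "(f has_field_derivative 0) (at z)"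
      by (rule has_field_derivative_transform_within_open[OF DERIV_const[of 0] assms(4,5)]) (simp add: that)
  qed
  hence "f z = 0 \<and> deriv f z = 0" if "\<not> (\<exists>z\<in>S. f z \<noteq> 0)" for f using that assms(5) by blast
  thus "\<exists>z\<in>S. f z \<noteq> 0" "\<exists>z\<in>S. g z \<noteq> 0" using assms(1) unfolding wronskian_def by (metis diff_self mult_zero_left mult_zero_right)+
qed

text \<open>A acts on h = u1 / u2 as a Moebius map with coefficients a, b, c, d. Invariance makes h
  a root of c x^2 + (d - a) x - b; as h' has no zeros, differentiating twice gives c = 0, then d = a
  and b = 0. Conversely a scalar cancels in the quotient; it is nonzero because u1 and u2 have no
  common zero.\<close>

lemma invariance_group_eq_scalar_group:
  assumes u: "lin_sol s u1" "lin_sol s u2" and W: "wronskian u1 u2 \<i> \<noteq> 0"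
    and h: "\<And>\<tau>. \<tau> \<in> upper_half_plane \<Longrightarrow> h \<tau> = u1 \<tau> / u2 \<tau>"
  shows "invariance_group h = scalar_group s"
proof (intro subset_antisym subsetI)
  define w where "w = wronskian u1 u2 \<i>"
  have w0: "w \<noteq> 0" using W by (simp add: w_def)
  have wc: "wronskian u1 u2 \<tau> = w" if "\<tau> \<in> upper_half_plane" for \<tau>
    unfolding w_def using wronskian_constant[OF u _ _ that i_in_H] by simp
  have hA: "h (mobius A \<tau>) = slash A u1 \<tau> / slash A u2 \<tau>" if "A \<in> SL2" "\<tau> \<in> upper_half_plane" for A \<tau>
    using that jfac_nonzero[OF that] by (simp add: h slash_def)
  {
    fix A assume "A \<in> scalar_group s"
    then obtain c where A: "A \<in> SL2" and c: "\<And>y \<tau>. lin_sol s y \<Longrightarrow> \<tau> \<in> upper_half_plane \<Longrightarrow> slash A y \<tau> = c * y \<tau>"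
      by (auto simp: scalar_group_def)
    have "mobius A \<i> \<in> upper_half_plane" by (rule mobius_in_H[OF A i_in_H])
    from wc[OF this] have "u1 (mobius A \<i>) \<noteq> 0 \<or> u2 (mobius A \<i>) \<noteq> 0" using w0 by (auto simp: wronskian_def)
    hence "slash A u1 \<i> \<noteq> 0 \<or> slash A u2 \<i> \<noteq> 0" using jfac_nonzero[OF A i_in_H] by (auto simp: slash_def)
    hence "c \<noteq> 0" using c[OF u(1) i_in_H] c[OF u(2) i_in_H] by auto
    thus "A \<in> invariance_group h"
      using A hA c[OF u(1)] c[OF u(2)] h by (auto simp: invariance_group_def)
  next
    fix A assume "A \<in> invariance_group h"
    hence A: "A \<in> SL2" and inv: "\<And>\<tau>. \<tau> \<in> upper_half_plane \<Longrightarrow> h (mobius A \<tau>) = h \<tau>"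
      by (auto simp: invariance_group_def)
    note su = lin_sol_slash(1)[OF u(1) A] lin_sol_slash(1)[OF u(2) A]
    obtain a b where ab: "\<And>\<tau>. \<tau> \<in> upper_half_plane \<Longrightarrow> slash A u1 \<tau> = a * u1 \<tau> + b * u2 \<tau>"
      using solves_span[OF u su(1) open_H connected_H i_in_H W] by blast
    obtain c d where cd: "\<And>\<tau>. \<tau> \<in> upper_half_plane \<Longrightarrow> slash A u2 \<tau> = c * u1 \<tau> + d * u2 \<tau>"
      using solves_span[OF u su(2) open_H connected_H i_in_H W] by blast
    have mi: "mobius (adj2 A) z \<in> upper_half_plane" if "z \<in> upper_half_plane" for z
      by (rule mobius_in_H[OF adj2_SL2[OF A] that])
    obtain z2 where z2: "z2 \<in> upper_half_plane" "u2 z2 \<noteq> 0"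
      using wronskian_nonzero_imp_nonzero[OF W u open_H i_in_H] by blast
    define z3 where "z3 = mobius (adj2 A) z2"
    have z3: "z3 \<in> upper_half_plane" unfolding z3_def by (rule mi[OF z2(1)])
    have "mobius A z3 = z2" using mobius_mult[of A "adj2 A" z2] A z2(1) by (simp add: z3_def)
    hence "slash A u2 z3 \<noteq> 0" using z2(2) jfac_nonzero[OF A z3] by (simp add: slash_def)
    hence "\<exists>z\<in>upper_half_plane. u2 z \<noteq> 0 \<and> slash A u2 z \<noteq> 0"
      using common_nonzero[OF u(2) su(2) open_H connected_H z2 z3] by blast
    then obtain p where p: "p \<in> upper_half_plane" "u2 p \<noteq> 0" "slash A u2 p \<noteq> 0" by blast
    \<comment> \<open>At zeros of u2 or of its slash the default value of division would hide the
      quadratic equation, so they are left out; the point p shows that something remains.\<close>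
    define V where "V = {z \<in> upper_half_plane. u2 z * slash A u2 z \<noteq> 0}"
    have V: "open V"
    proof -
      have "(\<lambda>z. u2 z * slash A u2 z) holomorphic_on upper_half_plane"
        using u su by (intro holomorphic_on_mult) (auto simp: solves_def)
      from continuous_open_preimage[OF holomorphic_on_imp_continuous_on[OF this] open_H, of "- {0}"]
      have "open (upper_half_plane \<inter> (\<lambda>z. u2 z * slash A u2 z) -` (- {0}))" by auto
      also have "upper_half_plane \<inter> (\<lambda>z. u2 z * slash A u2 z) -` (- {0}) = V" by (auto simp: V_def)
      finally show ?thesis .
    qed
    have pV: "p \<in> V" using p by (simp add: V_def)
    define hh where "hh = (\<lambda>z. u1 z / u2 z)"
    have dh: "(hh has_field_derivative - w / (u2 z)\<^sup>2) (at z)" if "z \<in> V" for z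
      unfolding hh_def using that wc[of z] solves_has_deriv[OF u(1) open_H, of z] solves_has_deriv[OF u(2) open_H, of z]
      by (auto intro!: derivative_eq_intros simp: V_def wronskian_def power2_eq_square algebra_simps)
    have e0: "c * (hh z)\<^sup>2 + (d - a) * hh z - b = 0" if z: "z \<in> V" for z
    proof -
      have zH: "z \<in> upper_half_plane" and nz: "u2 z \<noteq> 0" "c * u1 z + d * u2 z \<noteq> 0"
        using z cd by (auto simp: V_def)
      have "(a * u1 z + b * u2 z) / (c * u1 z + d * u2 z) = u1 z / u2 z"
        using inv[OF zH] hA[OF A zH] ab[OF zH] cd[OF zH] h[OF zH] by simp
      hence "u1 z * (c * u1 z + d * u2 z) - (a * u1 z + b * u2 z) * u2 z = 0"
        using nz by (simp add: frac_eq_eq)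
      moreover have "c * (hh z)\<^sup>2 + (d - a) * hh z - b = (u1 z * (c * u1 z + d * u2 z) - (a * u1 z + b * u2 z) * u2 z) / (u2 z)\<^sup>2"
        using nz by (simp add: hh_def field_simps power2_eq_square)
      ultimately show ?thesis by (simp only: div_0)
    qed
    have e1: "2 * c * hh z + (d - a) = 0" if z: "z \<in> V" for z
    proof -
      have nz: "u2 z \<noteq> 0" using z by (simp add: V_def)
      have "(2 * c * hh z + (d - a)) * (- w / (u2 z)\<^sup>2) = 0"
      proof (rule derivs_eq_on_open[OF V z, of "\<lambda>z. c * (hh z)\<^sup>2 + (d - a) * hh z - b" "\<lambda>_. 0"])
        show "((\<lambda>z. c * (hh z)\<^sup>2 + (d - a) * hh z - b) has_field_derivative (2 * c * hh z + (d - a)) * (- w / (u2 z)\<^sup>2)) (at z)"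
          by (rule derivative_eq_intros dh[OF z] refl)+ (simp add: algebra_simps diff_divide_distrib)
      qed (use e0 in auto)
      thus ?thesis using w0 nz by simp
    qed
    have "2 * c * (- w / (u2 p)\<^sup>2) = 0"
    proof (rule derivs_eq_on_open[OF V pV, of "\<lambda>z. 2 * c * hh z + (d - a)" "\<lambda>_. 0"])
      show "((\<lambda>z. 2 * c * hh z + (d - a)) has_field_derivative 2 * c * (- w / (u2 p)\<^sup>2)) (at p)"
        by (rule derivative_eq_intros dh[OF pV] refl)+ simp
    qed (use e1 in auto)
    hence c0: "c = 0" using w0 p by simp
    hence da: "d = a" using e1[OF pV] by simp
    hence b0: "b = 0" using e0[OF pV] c0 by simp
    have "slash A y \<tau> = a * y \<tau>" if y: "lin_sol s y" and t: "\<tau> \<in> upper_half_plane" for y \<tau>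
    proof -
      obtain k l where kl: "\<And>\<tau>. \<tau> \<in> upper_half_plane \<Longrightarrow> y \<tau> = k * u1 \<tau> + l * u2 \<tau>"
        using solves_span[OF u y open_H connected_H i_in_H W] by blast
      have "slash A y \<tau> = slash A (\<lambda>\<tau>. k * u1 \<tau> + l * u2 \<tau>) \<tau>"
        by (rule slash_cong[OF A t kl])
      thus ?thesis using ab[OF t] cd[OF t] c0 da b0 kl[OF t] by (simp add: slash_lincomb algebra_simps)
    qed
    thus "A \<in> scalar_group s" using A by (auto simp: scalar_group_def)
  }
qed

section \<open>Normal subgroups of SL2(Z) containing a power of T\<close>

text \<open>\<open>- mat 1\<close> is built in because it acts as the scalar -1; arguments about K
  can then be made up to sign.\<close>

definition normal_in_SL2 :: "(int ^ 2 ^ 2) set \<Rightarrow> bool" where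
  "normal_in_SL2 K \<longleftrightarrow> K \<subseteq> SL2 \<and> - mat 1 \<in> K \<and> (\<forall>A\<in>K. \<forall>B\<in>K. A ** B \<in> K) \<and>
     (\<forall>A\<in>K. adj2 A \<in> K) \<and> (\<forall>A\<in>K. \<forall>B\<in>SL2. B ** A ** adj2 B \<in> K)"

lemma normal_in_SL2_scalar_group: "normal_in_SL2 (scalar_group s)"
  unfolding normal_in_SL2_def
proof (intro conjI ballI)
  show "scalar_group s \<subseteq> SL2" by (auto simp: scalar_group_def)
  show "- mat 1 \<in> scalar_group s" by (auto simp: scalar_group_def intro!: exI[of _ "-1"])
  fix A assume "A \<in> scalar_group s"
  then obtain c where A: "A \<in> SL2" and c: "\<And>y \<tau>. lin_sol s y \<Longrightarrow> \<tau> \<in> upper_half_plane \<Longrightarrow> slash A y \<tau> = c * y \<tau>"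
    by (auto simp: scalar_group_def)
  {
    fix B assume "B \<in> scalar_group s"
    then obtain d where B: "B \<in> SL2" and d: "\<And>y \<tau>. lin_sol s y \<Longrightarrow> \<tau> \<in> upper_half_plane \<Longrightarrow> slash B y \<tau> = d * y \<tau>"
      by (auto simp: scalar_group_def)
    have "slash (A ** B) y \<tau> = (d * c) * y \<tau>" if "lin_sol s y" "\<tau> \<in> upper_half_plane" for y \<tau>
      using slash_mult[OF A B that(2)] d[OF lin_sol_slash(1)[OF that(1) A] that(2)] c[OF that] by simp
    thus "A ** B \<in> scalar_group s" using A B by (auto simp: scalar_group_def)
  }
  {
    fix B assume B: "B \<in> SL2"
    have "slash (B ** A ** adj2 B) y \<tau> = c * y \<tau>" if y: "lin_sol s y" and t: "\<tau> \<in> upper_half_plane" for y \<tau>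
    proof -
      have Bt: "mobius (adj2 B) \<tau> \<in> upper_half_plane" by (rule mobius_in_H[OF adj2_SL2[OF B] t])
      have "slash (B ** A ** adj2 B) y \<tau> = jfac (adj2 B) \<tau> * slash (B ** A) y (mobius (adj2 B) \<tau>)"
        using slash_mult[of "B ** A" "adj2 B" \<tau> y] A B t by (simp add: slash_def)
      also have "slash (B ** A) y (mobius (adj2 B) \<tau>) = c * slash B y (mobius (adj2 B) \<tau>)"
        using slash_mult[OF B A Bt] c[OF lin_sol_slash(1)[OF y B] Bt] by simp
      also have "jfac (adj2 B) \<tau> * (c * slash B y (mobius (adj2 B) \<tau>)) = c * slash (B ** adj2 B) y \<tau>"
        using slash_mult[of B "adj2 B" \<tau> y] B t by (simp add: slash_def mult_ac)
      finally show ?thesis using B by simp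
    qed
    thus "B ** A ** adj2 B \<in> scalar_group s" using A B by (auto simp: scalar_group_def)
  }
  have "slash (adj2 A) y \<tau> = (1 / c) * y \<tau>" if y: "lin_sol s y" and t: "\<tau> \<in> upper_half_plane" for y \<tau>
  proof -
    have At: "mobius (adj2 A) \<tau> \<in> upper_half_plane" by (rule mobius_in_H[OF adj2_SL2[OF A] t])
    have "y \<tau> = slash (A ** adj2 A) y \<tau>" using A by simp
    also have "\<dots> = jfac (adj2 A) \<tau> * slash A y (mobius (adj2 A) \<tau>)"
      using slash_mult[of A "adj2 A" \<tau> y] A t by (simp add: slash_def)
    also have "\<dots> = c * slash (adj2 A) y \<tau>" using c[OF y At] by (simp add: slash_def)
    finally have e: "y \<tau> = c * slash (adj2 A) y \<tau>" .
    show ?thesis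
    proof (cases "c = 0")
      \<comment> \<open>No basis is at hand here to exclude c = 0. In that case every solution
        vanishes identically, and the claim holds with the default value of
        \<open>1 / c\<close>.\<close>
      case True
      have "slash A y (mobius (adj2 A) (mobius (adj2 A) \<tau>)) = 0"
        using c[OF y] mobius_in_H[OF adj2_SL2[OF A] At] True by simp
      hence "y (mobius (A ** adj2 A) (mobius (adj2 A) \<tau>)) = 0"
        using mobius_mult[of A "adj2 A" "mobius (adj2 A) \<tau>"] A At mobius_in_H[OF adj2_SL2[OF A] At]
          jfac_nonzero[OF A mobius_in_H[OF adj2_SL2[OF A] At]] by (simp add: slash_def)
      thus ?thesis using A True by (simp add: slash_def)
    qed (use e in \<open>simp add: field_simps\<close>)
  qed
  thus "adj2 A \<in> scalar_group s" unfolding scalar_group_def using A by (auto intro!: exI[of _ "1 / c"])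
qed

text \<open>At a fixed point with factor j, a solution that does not vanish there gives the scalar c
  = j. The solution v that vanishes there has nonzero derivative and gives c = 1 / j. This is local
  injectivity of the quotient in linear terms.\<close>

lemma scalar_group_fixed_point:
  assumes u: "lin_sol s u1" "lin_sol s u2" and W: "wronskian u1 u2 \<i> \<noteq> 0"
    and A: "A \<in> scalar_group s" and t: "\<tau> \<in> upper_half_plane" "mobius A \<tau> = \<tau>"
  shows "(jfac A \<tau>)\<^sup>2 = 1"
proof -
  obtain c where A: "A \<in> SL2" and c: "\<And>y \<tau>. lin_sol s y \<Longrightarrow> \<tau> \<in> upper_half_plane \<Longrightarrow> slash A y \<tau> = c * y \<tau>"
    using A by (auto simp: scalar_group_def)
  have W': "wronskian u1 u2 \<tau> \<noteq> 0"
    using wronskian_constant[OF u open_H connected_H t(1) i_in_H] W by simp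
  hence "u1 \<tau> \<noteq> 0 \<or> u2 \<tau> \<noteq> 0" by (auto simp: wronskian_def)
  hence cj: "c = jfac A \<tau>" using c[OF u(1) t(1)] c[OF u(2) t(1)] t(2) by (auto simp: slash_def)
  define v where "v = (\<lambda>z. u1 \<tau> * u2 z + (- u2 \<tau>) * u1 z)"
  have v: "lin_sol s v" unfolding v_def by (rule solves_lincomb[OF u(2,1) open_H])
  have v0: "v \<tau> = 0" by (simp add: v_def)
  have v1: "deriv v \<tau> \<noteq> 0"
    using solves_lincomb(2)[OF u(2,1) open_H t(1), of "u1 \<tau>" "- u2 \<tau>"] W'
    by (simp add: v_def wronskian_def mult.commute)
  have "(slash A v has_field_derivative c * deriv v \<tau>) (at \<tau>)"
    by (rule has_field_derivative_transform_within_open[OF _ open_H t(1), of "\<lambda>z. c * v z"])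
       (use solves_has_deriv(1)[OF v open_H t(1)] c[OF v] in \<open>auto intro!: DERIV_cmult\<close>)
  hence "deriv (slash A v) \<tau> = c * deriv v \<tau>" by (rule DERIV_imp_deriv)
  hence "deriv v \<tau> / jfac A \<tau> = c * deriv v \<tau>"
    using lin_sol_slash(2)[OF v A t(1)] t(2) v0 by simp
  hence "1 / jfac A \<tau> = c" using v1 jfac_nonzero[OF A t(1)] by (simp add: field_simps)
  thus ?thesis using cj jfac_nonzero[OF A t(1)] by (simp add: field_simps power2_eq_square)
qed

lemma elliptic_notin_scalar_group:
  assumes u: "lin_sol s u1" "lin_sol s u2" and W: "wronskian u1 u2 \<i> \<noteq> 0" and t: "\<bar>t\<bar> \<le> 1"
  shows "mat2 0 (-1) 1 t \<notin> scalar_group s"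
proof
  assume K: "mat2 0 (-1) 1 t \<in> scalar_group s"
  \<comment> \<open>Prepares the root tau of z^2 + t z + 1 in the upper half plane, which is the
    fixed point. Its factor tau + t is not real, hence neither 1 nor -1.\<close>
  define r where "r = sqrt (4 - (real_of_int t)\<^sup>2)"
  have "t\<^sup>2 \<le> 1" using t by (simp add: abs_square_le_1)
  hence t2: "(real_of_int t)\<^sup>2 \<le> 1" by (metis of_int_1 of_int_le_iff of_int_power)
  hence r2: "r\<^sup>2 = 4 - (real_of_int t)\<^sup>2" and r0: "r > 0" unfolding r_def by simp_all
  define \<tau> where "\<tau> = Complex (- real_of_int t / 2) (r / 2)"
  have tH: "\<tau> \<in> upper_half_plane" using r0 by (simp add: in_H_iff \<tau>_def)
  have nz: "\<tau> + of_int t \<noteq> 0" using r0 by (simp add: \<tau>_def complex_eq_iff)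
  have "\<tau> * (\<tau> + of_int t) = -1"
    using r2 by (simp add: \<tau>_def complex_eq_iff power2_eq_square field_simps)
  hence "- 1 / (\<tau> + of_int t) = \<tau>" using nz by (simp only: divide_eq_eq) simp
  hence "mobius (mat2 0 (-1) 1 t) \<tau> = \<tau>" by (simp add: mobius_def)
  from scalar_group_fixed_point[OF u W K tH this]
  have "(\<tau> + of_int t)\<^sup>2 = 1" by (simp add: jfac_def)
  hence "\<tau> + of_int t = 1 \<or> \<tau> + of_int t = -1" by (simp add: power2_eq_1_iff)
  thus False using r0 by (auto simp: \<tau>_def complex_eq_iff)
qed

section \<open>Congruences, transvections and the descent\<close>

definition congr_mod :: "int \<Rightarrow> int ^ 2 ^ 2 \<Rightarrow> int ^ 2 ^ 2 \<Rightarrow> bool" where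
  "congr_mod m A B \<longleftrightarrow> m dvd ma A - ma B \<and> m dvd mb A - mb B \<and> m dvd mc A - mc B \<and> m dvd md A - md B"

lemma principal_congruence_iff:
  "A \<in> principal_congruence_subgroup m \<longleftrightarrow> A \<in> SL2 \<and> congr_mod (int m) A (mat 1)"
  by (auto simp: principal_congruence_subgroup_def congr_mod_def forall_2 cong_iff_dvd_diff)

lemma congr_mod_mult:
  assumes "congr_mod m A A'" "congr_mod m B B'"
  shows "congr_mod m (A ** B) (A' ** B')"
proof -
  have *: "m dvd (x * y + z * w) - (x' * y' + z' * w')"
    if "m dvd x - x'" "m dvd y - y'" "m dvd z - z'" "m dvd w - w'" for x y z w x' y' z' w' :: int
  proof -
    have "(x * y + z * w) - (x' * y' + z' * w') = (x - x') * y + x' * (y - y') + (z - z') * w + z' * (w - w')"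
      by (simp add: algebra_simps)
    thus ?thesis using that by simp
  qed
  show ?thesis using assms unfolding congr_mod_def mult_nth by (auto intro!: *)
qed

lemma congr_mod_refl [simp]: "congr_mod m A A"
  by (simp add: congr_mod_def)

lemma congr_mod_uminus: "congr_mod m A B \<Longrightarrow> congr_mod m (- A) (- B)"
  unfolding congr_mod_def by (auto simp: dvd_diff_commute)

text \<open>The conjugate of T^t that fixes the vector (p, q). By \<open>conj_Tmat\<close> only the
  first column of the conjugating matrix matters, so the descent has merely to choose a fraction p /
  q.\<close>

definition transvection :: "int \<Rightarrow> int \<Rightarrow> int \<Rightarrow> int ^ 2 ^ 2" where
  "transvection t p q = mat2 (1 - t * p * q) (t * p\<^sup>2) (- t * q\<^sup>2) (1 + t * p * q)"

lemma conj_Tmat: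
  assumes "B \<in> SL2"
  shows "B ** Tmat t ** adj2 B = transvection t (ma B) (mc B)"
proof -
  have d: "ma B * md B - mb B * mc B = 1" using assms by (simp add: SL2_iff)
  have "ma B * md B - (mb B + ma B * t) * mc B = 1 - t * ma B * mc B"
    "md B * ma B + mc B * t * ma B - mc B * mb B = 1 + t * ma B * mc B"
    using d by (simp_all add: algebra_simps)
  thus ?thesis
    by (intro mat2_eqI) (simp_all add: transvection_def adj2_def Tmat_def algebra_simps power2_eq_square)
qed

lemma round_div: "\<exists>k. 2 * \<bar>k * c - a\<bar> \<le> \<bar>c\<bar>" if "c \<noteq> 0" for a c :: int
proof -
  have e: "c * (a div c) + a mod c = a" by simp
  show ?thesis
  proof (cases "2 * \<bar>a mod c\<bar> \<le> \<bar>c\<bar>")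
    case True
    have "a div c * c - a = - (a mod c)" using e by (simp add: algebra_simps)
    thus ?thesis using True by (intro exI[of _ "a div c"]) simp
  next
    case False
    have "(a div c + 1) * c - a = c - a mod c" using e by (simp add: algebra_simps)
    moreover have "2 * \<bar>c - a mod c\<bar> \<le> \<bar>c\<bar>"
    proof (cases "c > 0")
      case True
      hence b: "0 \<le> a mod c" "a mod c < c" by auto
      have "2 * \<bar>c - x\<bar> \<le> \<bar>c\<bar>" if "0 \<le> x" "x < c" "\<not> 2 * \<bar>x\<bar> \<le> \<bar>c\<bar>" for x
        using that by arith
      from this[OF b False] show ?thesis .
    next
      case c: False
      hence b: "a mod c \<le> 0" "c < a mod c" using that by (auto simp: neg_mod_sign neg_mod_bound)
      have "2 * \<bar>c - x\<bar> \<le> \<bar>c\<bar>" if "x \<le> 0" "c < x" "\<not> 2 * \<bar>x\<bar> \<le> \<bar>c\<bar>" for x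
        using that by arith
      from this[OF b False] show ?thesis .
    qed
    ultimately show ?thesis by (intro exI[of _ "a div c + 1"]) simp
  qed
qed

text \<open>Here (a, c) is the first column of a matrix in \<Gamma>(m) and \<open>c + e m q (p c - q a)\<close> is its lower
  entry after the transvection along (p, q). It is smaller than c if \<open>0 < |p / q - a / c| < 2 / (m q\<^sup>2)\<close>, and
  for \<open>m \<le> 5\<close> these intervals with \<open>q \<le> 2\<close> leave out only fractions a / c that cannot occur.\<close>

lemma descent_step:
  fixes a c m :: int
  assumes m: "m \<in> {2,3,4,5}" and c: "c \<noteq> 0" "m dvd c" "m dvd a - 1" and cop: "coprime a c"
  shows "\<exists>p q e. (e = 1 \<or> e = -1) \<and> (q = 1 \<or> (q = 2 \<and> odd p)) \<and> \<bar>c + e * m * q * (p * c - q * a)\<bar> < \<bar>c\<bar>"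
proof -
  have cm: "\<bar>c\<bar> \<ge> m" using dvd_imp_le_int[OF c(1,2)] by linarith
  obtain k where k: "2 * \<bar>k * c - a\<bar> \<le> \<bar>c\<bar>" using round_div[OF c(1)] by blast
  define f where "f = k * c - a"
  \<comment> \<open>Excludes fractions a / c that reduce to a small denominator: c is coprime to a
    and therefore divides n, while |c| >= m.\<close>
  have small: "\<bar>c\<bar> \<le> n" if "n * a = c * x" "n > 0" for n x :: int
  proof -
    have "c dvd n * a" using that by simp
    hence "c dvd n" using cop by (metis coprime_commute coprime_dvd_mult_left_iff)
    thus ?thesis using dvd_imp_le_int[of n c] that(2) by auto
  qed
  have f0: "f \<noteq> 0"
  proof
    assume "f = 0"
    hence "1 * a = c * k" by (simp add: f_def algebra_simps)
    from small[OF this] cm m show False by auto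
  qed
  have sgn: "\<exists>e. (e = 1 \<or> e = -1) \<and> \<bar>c + e * y\<bar> < \<bar>c\<bar>" if "y \<noteq> 0" "\<bar>y\<bar> < 2 * \<bar>c\<bar>" for y
  proof (cases "(c > 0) = (y > 0)")
    case True
    hence "\<bar>c + (-1) * y\<bar> < \<bar>c\<bar>" using that c by linarith
    thus ?thesis by blast
  next
    case False
    hence "\<bar>c + 1 * y\<bar> < \<bar>c\<bar>" using that c by linarith
    thus ?thesis by blast
  qed
  show ?thesis
  proof (cases "m * \<bar>f\<bar> < 2 * \<bar>c\<bar>")
    case True
    have "m * f \<noteq> 0" "\<bar>m * f\<bar> < 2 * \<bar>c\<bar>" using True f0 m by (auto simp: abs_mult)
    from sgn[OF this] obtain e where "e = 1 \<or> e = -1" "\<bar>c + e * (m * f)\<bar> < \<bar>c\<bar>" by blast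
    thus ?thesis by (intro exI[of _ k] exI[of _ 1] exI[of _ e]) (auto simp: f_def algebra_simps)
  next
    case False
    have k': "2 * \<bar>f\<bar> \<le> \<bar>c\<bar>" using k by (simp add: f_def)
    have half: "2 * \<bar>f\<bar> \<noteq> \<bar>c\<bar>" if "m \<noteq> 2"
    proof
      assume "2 * \<bar>f\<bar> = \<bar>c\<bar>"
      hence "2 * f = c \<or> 2 * f = - c" by linarith
      hence "2 * a = c * (2 * k - 1) \<or> 2 * a = c * (2 * k + 1)" by (auto simp: f_def algebra_simps)
      hence "\<bar>c\<bar> \<le> 2" using small[of 2] by auto
      thus False using cm that m by auto
    qed
    \<comment> \<open>Since 2|f| <= |c|, the nearest integer k succeeds for m <= 3, and for m = 4
      unless 2|f| = |c|, which \<open>half\<close> rules out.\<close>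
    have m5: "m = 5" using m False k' half f0 c by auto
    \<comment> \<open>The common end point of the intervals around k and around the adjacent
      half-integers. It would force c = 5 or -5 and f = 2 or -2, whereas f = k c - a is -1 mod
      5.\<close>
    have fift: "5 * \<bar>f\<bar> \<noteq> 2 * \<bar>c\<bar>"
    proof
      assume "5 * \<bar>f\<bar> = 2 * \<bar>c\<bar>"
      hence f5: "5 * f = 2 * c \<or> 5 * f = - 2 * c" by linarith
      hence "5 * a = c * (5 * k - 2) \<or> 5 * a = c * (5 * k + 2)" by (auto simp: f_def algebra_simps)
      hence "\<bar>c\<bar> \<le> 5" using small[of 5] by auto
      hence "c = 5 \<or> c = -5" using cm m5 by linarith
      hence "f = 2 \<or> f = -2" using f5 by auto
      moreover obtain x y where "c = 5 * x" "a - 1 = 5 * y" using c m5 by (auto elim!: dvdE)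
      hence "f = 5 * (k * x - y) - 1" by (simp add: f_def algebra_simps)
      ultimately show False by presburger
    qed
    \<comment> \<open>k + e'/2 is the half-integer on the same side of k as a / c = k - f / c. It
      has q = 2 and p = 2 k + e', so the factor 10 in y is m q.\<close>
    define e' where "e' = (if (f > 0) = (c > 0) then -1 else 1 :: int)"
    define y where "y = 10 * (2 * f + e' * c)"
    have "\<bar>2 * f + e' * c\<bar> = \<bar>c\<bar> - 2 * \<bar>f\<bar>" using k' f0 c by (auto simp: e'_def)
    moreover have "5 * \<bar>f\<bar> > 2 * \<bar>c\<bar>" using False m5 fift by auto
    moreover have "\<bar>y\<bar> = 10 * \<bar>2 * f + e' * c\<bar>" by (simp only: y_def abs_mult abs_numeral)
    ultimately have "\<bar>y\<bar> \<noteq> 0" "\<bar>y\<bar> < 2 * \<bar>c\<bar>" using half m5 k' by auto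
    hence "y \<noteq> 0" "\<bar>y\<bar> < 2 * \<bar>c\<bar>" by auto
    from sgn[OF this] obtain e where e: "e = 1 \<or> e = -1" "\<bar>c + e * y\<bar> < \<bar>c\<bar>" by blast
    have y': "y = m * 2 * ((2 * k + e') * c - 2 * a)" by (simp add: y_def m5 f_def algebra_simps)
    have "odd (2 * k + e')" by (simp add: e'_def)
    thus ?thesis using e unfolding y'
      by (intro exI[of _ "2 * k + e'"] exI[of _ 2] exI[of _ e]) (auto simp: algebra_simps)
  qed
qed

lemma normal_in_SL2D:
  assumes "normal_in_SL2 K"
  shows "A \<in> K \<Longrightarrow> A \<in> SL2" "- mat 1 \<in> K" "A \<in> K \<Longrightarrow> B \<in> K \<Longrightarrow> A ** B \<in> K" "A \<in> K \<Longrightarrow> adj2 A \<in> K"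
    "A \<in> K \<Longrightarrow> B \<in> SL2 \<Longrightarrow> B ** A ** adj2 B \<in> K" "A \<in> K \<Longrightarrow> - A \<in> K" "mat 1 \<in> K"
proof -
  show "A \<in> K \<Longrightarrow> A \<in> SL2" "- mat 1 \<in> K" "A \<in> K \<Longrightarrow> adj2 A \<in> K"
    "A \<in> K \<Longrightarrow> B \<in> SL2 \<Longrightarrow> B ** A ** adj2 B \<in> K"
    using assms unfolding normal_in_SL2_def by blast+
  show *: "A \<in> K \<Longrightarrow> B \<in> K \<Longrightarrow> A ** B \<in> K" for A B using assms unfolding normal_in_SL2_def by blast
  have m: "- mat 1 \<in> K" using assms unfolding normal_in_SL2_def by blast
  from *[OF m m] show "mat 1 \<in> K" by simp
  show "A \<in> K \<Longrightarrow> - A \<in> K" using *[OF m, of A] by simp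
qed

lemma Tmat_multiple_in:
  assumes K: "normal_in_SL2 K" and T: "Tmat m \<in> K"
  shows "Tmat (k * m) \<in> K"
proof -
  have n: "Tmat (int n * m) \<in> K" for n
  proof (induction n)
    case 0 show ?case using normal_in_SL2D(7)[OF K] by (simp add: Tmat_0)
  next
    case (Suc n)
    have "Tmat (int (Suc n) * m) = Tmat (int n * m) ** Tmat m" by (simp add: Tmat_add algebra_simps)
    thus ?case using normal_in_SL2D(3)[OF K Suc T] by simp
  qed
  show ?thesis
  proof (cases "k \<ge> 0")
    case True
    thus ?thesis using n[of "nat k"] by simp
  next
    case False
    have "adj2 (Tmat (int (nat (- k)) * m)) = Tmat (k * m)" using False by (simp add: adj2_def Tmat_def)
    thus ?thesis using normal_in_SL2D(4)[OF K n[of "nat (-k)"]] by simp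
  qed
qed

lemma SL2_lower_zero:
  assumes "A \<in> SL2" "mc A = 0"
  shows "(ma A = 1 \<and> A = Tmat (mb A)) \<or> (ma A = -1 \<and> A = - Tmat (- mb A))"
proof -
  have "ma A * md A = 1" using assms by (simp add: SL2_iff)
  hence "(ma A = 1 \<and> md A = 1) \<or> (ma A = -1 \<and> md A = -1)" by (simp add: zmult_eq_1_iff)
  thus ?thesis using assms(2) by (auto intro!: mat2_eqI simp: Tmat_def)
qed

text \<open>The transvection supplied by \<open>descent_step\<close> lies in K as a conjugate of T^m
  or its inverse, and it is 1 mod m, so multiplying by it keeps the congruence while |c| drops. At c
  = 0 only a power of T^m, up to sign, is left.\<close>

lemma principal_congruence_subset:
  assumes K: "normal_in_SL2 K" and m: "m \<in> {2,3,4,5}" and T: "Tmat m \<in> K"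
    and A: "A \<in> SL2" "congr_mod m A (mat 1)"
  shows "A \<in> K"
  using A
proof (induction "nat \<bar>mc A\<bar>" arbitrary: A rule: less_induct)
  case less
  show ?case
  proof (cases "mc A = 0")
    case True
    have "m dvd mb A" using less.prems by (simp add: congr_mod_def)
    then obtain k where k: "mb A = k * m" by (metis dvdE mult.commute)
    have "Tmat (mb A) \<in> K" "Tmat (- mb A) \<in> K"
      using Tmat_multiple_in[OF K T, of k] Tmat_multiple_in[OF K T, of "-k"] k by auto
    hence "Tmat (mb A) \<in> K" "- Tmat (- mb A) \<in> K" using normal_in_SL2D(6)[OF K] by auto
    thus ?thesis using SL2_lower_zero[OF less.prems(1) True] by metis
  next
    case False
    have det: "ma A * md A - mb A * mc A = 1" using less.prems by (simp add: SL2_iff)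
    have "coprime (ma A) (mc A)"
    proof (rule coprimeI)
      fix x assume "x dvd ma A" "x dvd mc A"
      hence "x dvd ma A * md A - mb A * mc A" by simp
      thus "is_unit x" using det by simp
    qed
    then obtain p q e where e: "e = 1 \<or> e = -1" and q: "q = 1 \<or> (q = 2 \<and> odd p)"
      and lt: "\<bar>mc A + e * m * q * (p * mc A - q * ma A)\<bar> < \<bar>mc A\<bar>"
      using descent_step[OF m False, of "ma A"] less.prems by (auto simp: congr_mod_def)
    have "\<exists>B\<in>SL2. ma B = p \<and> mc B = q"
    proof (cases "q = 1")
      case True
      thus ?thesis by (intro bexI[of _ "mat2 p (-1) 1 0"]) (auto simp: SL2_iff)
    next
      case False
      hence "q = 2" "odd p" using q by auto
      then obtain k where "p = 2 * k + 1" by (auto elim!: oddE)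
      thus ?thesis using \<open>q = 2\<close> by (intro bexI[of _ "mat2 p k 2 1"]) (auto simp: SL2_iff)
    qed
    then obtain B where B: "B \<in> SL2" "ma B = p" "mc B = q" by blast
    define N where "N = transvection (e * m) p q"
    have "Tmat (e * m) \<in> K" by (rule Tmat_multiple_in[OF K T])
    from normal_in_SL2D(5)[OF K this B(1)] have NK: "N \<in> K" using conj_Tmat[OF B(1), of "e * m"] B by (simp add: N_def)
    hence N: "N \<in> SL2" by (rule normal_in_SL2D(1)[OF K])
    have "congr_mod m N (mat 1)" by (simp add: N_def transvection_def congr_mod_def)
    from congr_mod_mult[OF this less.prems(2)] have c1: "congr_mod m (N ** A) (mat 1)" by simp
    have "mc (N ** A) = mc A + e * m * q * (p * mc A - q * ma A)"
      by (simp add: N_def transvection_def algebra_simps power2_eq_square)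
    hence "nat \<bar>mc (N ** A)\<bar> < nat \<bar>mc A\<bar>" using lt by simp
    from less.hyps[OF this _ c1] have "N ** A \<in> K" using N less.prems by simp
    hence "adj2 N ** (N ** A) \<in> K" by (rule normal_in_SL2D(3)[OF K normal_in_SL2D(4)[OF K NK]])
    thus ?thesis using N by (simp add: matrix_mul_assoc)
  qed
qed

text \<open>Conjugating the matrix (a, b; c, d) by S or by (1, 0; y, 1) makes its lower left entry congruent
  to \<open>\<plusminus>1\<close> modulo m, or makes it upper triangular with \<open>\<plusminus>1\<close> on the diagonal. The former matrices are
  conjugate, up to sign, to (0, -1; 1, t) with \<open>|t| \<le> 2\<close>.\<close>

definition residue_check :: "int \<Rightarrow> bool" where
  "residue_check m \<longleftrightarrow> (\<forall>a\<in>set [0..m-1]. \<forall>b\<in>set [0..m-1]. \<forall>c\<in>set [0..m-1]. \<forall>d\<in>set [0..m-1].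
     (a * d - b * c) mod m = 1 \<longrightarrow>
       (- b mod m \<in> {1, m - 1} \<or> (b = 0 \<and> d \<in> {1, m - 1})) \<or>
       (\<exists>y\<in>set [0..m-1]. (c + (d - a) * y - b * y * y) mod m \<in> {1, m - 1} \<or>
          (c + (d - a) * y - b * y * y) mod m = 0 \<and> (a + b * y) mod m \<in> {1, m - 1}))"

lemma residue_check: "m \<in> {2,3,4,5} \<Longrightarrow> residue_check m"
proof -
  have "residue_check 2 \<and> residue_check 3 \<and> residue_check 4 \<and> residue_check 5" by code_simp
  thus "m \<in> {2,3,4,5} \<Longrightarrow> residue_check m" by auto
qed

text \<open>The quotient of the two matrices is 1 mod m. Membership in K is therefore decided by
  residues, which makes a finite check possible.\<close>

lemma congruent_in:
  assumes K: "normal_in_SL2 K" and m: "m \<in> {2,3,4,5}" and T: "Tmat m \<in> K"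
    and A: "A \<in> K" and B: "B \<in> SL2" "congr_mod m B A"
  shows "B \<in> K"
proof -
  have AS: "A \<in> SL2" by (rule normal_in_SL2D(1)[OF K A])
  have "congr_mod m (B ** adj2 A) (A ** adj2 A)" by (intro congr_mod_mult B congr_mod_refl)
  hence "B ** adj2 A \<in> K"
    using principal_congruence_subset[OF K m T, of "B ** adj2 A"] AS B by simp
  from normal_in_SL2D(3)[OF K this A] show ?thesis using AS by (simp add: matrix_mul_assoc[symmetric])
qed

lemma representative_mod:
  assumes "m \<in> {2,3,4,5::int}"
  shows "\<exists>t. \<bar>t\<bar> \<le> 2 \<and> m dvd d - t"
proof -
  have r: "0 \<le> d mod m" "d mod m < m" using assms by auto
  show ?thesis
  proof (cases "d mod m \<le> 2")
    case True
    thus ?thesis using r by (intro exI[of _ "d mod m"]) (auto simp: minus_mod_eq_mult_div)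
  next
    case False
    have "d - (d mod m - m) = m * (d div m + 1)" by (simp add: algebra_simps minus_mod_eq_mult_div[symmetric])
    thus ?thesis using False r assms by (intro exI[of _ "d mod m - m"]) auto
  qed
qed

lemma unit_lower_left_imp:
  assumes K: "normal_in_SL2 K" and m: "m \<in> {2,3,4,5}" and T: "Tmat m \<in> K"
    and A: "A \<in> K" "m dvd mc A - 1"
  shows "Tmat 1 \<in> K \<or> (\<exists>t. \<bar>t\<bar> \<le> 1 \<and> mat2 0 (-1) 1 t \<in> K)"
proof -
  \<comment> \<open>As the lower left entry is 1 mod m, this conjugation clears the upper left entry
    mod m; the determinant then makes the upper right entry -1 mod m.\<close>
  define N where "N = Tmat (- ma A) ** A ** adj2 (Tmat (- ma A))"
  have NK: "N \<in> K" unfolding N_def by (rule normal_in_SL2D(5)[OF K A(1)]) simp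
  hence NS: "N \<in> SL2" by (rule normal_in_SL2D(1)[OF K])
  have e: "ma N = - (ma A * (mc A - 1))" "mc N = mc A"
    by (simp_all add: N_def Tmat_def adj2_def algebra_simps)
  have a: "m dvd ma N" and c: "m dvd mc N - 1" using A(2) unfolding e by auto
  have "ma N * md N - mb N * mc N = 1" using NS by (simp add: SL2_iff)
  hence "mb N - (-1) = ma N * md N - mb N * (mc N - 1)" by (simp add: algebra_simps)
  hence b: "m dvd mb N - (-1)" using a c by (simp only: dvd_diff dvd_mult dvd_mult2)
  obtain t where t: "\<bar>t\<bar> \<le> 2" "m dvd md N - t" using representative_mod[OF m] by blast
  define E where "E = mat2 0 (-1) 1 t"
  have ES: "E \<in> SL2" by (simp add: E_def SL2_iff)
  have "m dvd -1 - mb N" "m dvd 1 - mc N" "m dvd t - md N" "m dvd 0 - ma N"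
    using a b c t by (simp_all only: dvd_diff_commute[of m "-1"] dvd_diff_commute[of m 1] dvd_diff_commute[of m t]) simp
  hence "congr_mod m E N" by (simp add: congr_mod_def E_def)
  hence EK: "E \<in> K" by (rule congruent_in[OF K m T NK ES])
  \<comment> \<open>The traces 2 and -2 are parabolic: these matrices are conjugate to T^-1 and to
    -T.\<close>
  consider "\<bar>t\<bar> \<le> 1" | "t = 2" | "t = -2" using t by linarith
  thus ?thesis
  proof cases
    case 2
    define B where "B = mat2 1 0 (-1) 1"
    have B: "B \<in> SL2" by (simp add: B_def SL2_iff)
    have "adj2 B ** E ** adj2 (adj2 B) = Tmat (-1)"
      by (rule mat2_eqI) (simp_all add: 2 B_def E_def adj2_def Tmat_def)
    hence "Tmat (-1) \<in> K" using normal_in_SL2D(5)[OF K EK, of "adj2 B"] B by simp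
    from normal_in_SL2D(4)[OF K this] show ?thesis by (simp add: adj2_def Tmat_def)
  next
    case 3
    define B where "B = mat2 1 0 1 1"
    have B: "B \<in> SL2" by (simp add: B_def SL2_iff)
    have "- (adj2 B ** E ** adj2 (adj2 B)) = Tmat 1"
      by (rule mat2_eqI) (simp_all add: 3 B_def E_def adj2_def Tmat_def)
    thus ?thesis using normal_in_SL2D(6)[OF K normal_in_SL2D(5)[OF K EK, of "adj2 B"]] B by simp
  qed (use EK E_def in auto)
qed

lemma unit_mod_cases: "x mod m \<in> {1, m - 1} \<Longrightarrow> m dvd x - 1 \<or> m dvd - x - 1" if "m \<ge> 2" for x m :: int
proof -
  assume "x mod m \<in> {1, m - 1}"
  then consider "x mod m = 1" | "x mod m = m - 1" by blast
  thus ?thesis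
  proof cases
    case 1
    hence "x - 1 = m * (x div m)" using mult_div_mod_eq[of m x] by linarith
    thus ?thesis by simp
  next
    case 2
    have "m * (- (x div m) - 1) = - (m * (x div m)) - m" by (simp add: algebra_simps)
    hence "- x - 1 = m * (- (x div m) - 1)" using 2 mult_div_mod_eq[of m x] by linarith
    thus ?thesis by simp
  qed
qed

text \<open>The determinant makes the other diagonal entry 1 mod m, so A is congruent to some T^j
  with 0 <= j < m. Then T^j lies in K, and the exact order of T leaves only j = 0.\<close>

lemma upper_triangular_imp:
  assumes K: "normal_in_SL2 K" and m: "m \<in> {2,3,4,5}" and T: "Tmat m \<in> K"
    and Tj: "\<And>j. 0 < j \<Longrightarrow> j < m \<Longrightarrow> Tmat j \<notin> K"
    and A: "A \<in> K" "m dvd mc A" "m dvd ma A - 1"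
  shows "congr_mod m A (mat 1)"
proof -
  have AS: "A \<in> SL2" by (rule normal_in_SL2D(1)[OF K A(1)])
  have "ma A * md A - mb A * mc A = 1" using AS by (simp add: SL2_iff)
  hence "md A - 1 = mb A * mc A - (ma A - 1) * md A" by (simp add: algebra_simps)
  hence d: "m dvd md A - 1" using A by (simp only: dvd_diff dvd_mult dvd_mult2)
  define j where "j = mb A mod m"
  have "m dvd j - mb A" by (simp add: j_def mod_eq_dvd_iff[symmetric])
  hence "congr_mod m (Tmat j) A" using A d by (simp add: congr_mod_def Tmat_def dvd_diff_commute)
  hence "Tmat j \<in> K" by (rule congruent_in[OF K m T A(1) Tmat_SL2])
  moreover have "0 \<le> j" "j < m" using m by (auto simp: j_def)
  ultimately have "j = 0" using Tj[of j] by linarith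
  hence "m dvd mb A" by (simp add: j_def mod_eq_0_iff_dvd)
  thus ?thesis using A d by (simp add: congr_mod_def)
qed

text \<open>K contains neither T nor the elliptic matrices, so no conjugate of A has lower left
  entry 1 or -1 mod m. By \<open>residue_check\<close> some conjugate is triangular mod m with
  diagonal 1 or -1, hence congruent to 1 or -1; these are central, so A itself is.\<close>

lemma subset_principal_congruence:
  assumes K: "normal_in_SL2 K" and m: "m \<in> {2,3,4,5}" and T: "Tmat m \<in> K"
    and Tj: "\<And>j. 0 < j \<Longrightarrow> j < m \<Longrightarrow> Tmat j \<notin> K"
    and ell: "\<And>t. \<bar>t\<bar> \<le> 1 \<Longrightarrow> mat2 0 (-1) 1 t \<notin> K"
    and A: "A \<in> K"
  shows "congr_mod m A (mat 1) \<or> congr_mod m A (- mat 1)"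
proof -
  have m2: "m \<ge> 2" using m by auto
  have AS: "A \<in> SL2" by (rule normal_in_SL2D(1)[OF K A])
  have T1: "Tmat 1 \<notin> K" using Tj[of 1] m2 by simp
  have no_unit: "mc N mod m \<notin> {1, m - 1}" if N: "N \<in> K" for N
  proof
    assume "mc N mod m \<in> {1, m - 1}"
    from unit_mod_cases[OF m2 this] have "m dvd mc N - 1 \<or> m dvd mc (- N) - 1" by simp
    thus False using unit_lower_left_imp[OF K m T N] unit_lower_left_imp[OF K m T normal_in_SL2D(6)[OF K N]] T1 ell
      by blast
  qed
  have upper: "congr_mod m N (mat 1) \<or> congr_mod m N (- mat 1)"
    if N: "N \<in> K" "mc N mod m = 0" "ma N mod m \<in> {1, m - 1}" for N
  proof -
    have c: "m dvd mc N" using N(2) by (simp add: mod_eq_0_iff_dvd)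
    from unit_mod_cases[OF m2 N(3)] have "m dvd ma N - 1 \<or> m dvd ma (- N) - 1" by simp
    thus ?thesis
    proof
      assume "m dvd ma N - 1"
      thus ?thesis using upper_triangular_imp[OF K m T Tj N(1) c] by blast
    next
      assume a: "m dvd ma (- N) - 1"
      have "congr_mod m (- N) (mat 1)"
        by (rule upper_triangular_imp[OF K m T Tj normal_in_SL2D(6)[OF K N(1)] _ a]) (use c in auto)
      from congr_mod_uminus[OF this] show ?thesis by simp
    qed
  qed
  have conj: "congr_mod m A (mat 1) \<or> congr_mod m A (- mat 1)"
    if B: "B \<in> SL2" and N: "congr_mod m (adj2 B ** A ** B) (mat 1) \<or> congr_mod m (adj2 B ** A ** B) (- mat 1)" for B
  proof -
    have e: "B ** (adj2 B ** A ** B) ** adj2 B = A"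
    proof -
      have "B ** (adj2 B ** A ** B) ** adj2 B = (B ** adj2 B) ** A ** (B ** adj2 B)" by (simp only: matrix_mul_assoc)
      thus ?thesis using B by simp
    qed
    have "congr_mod m A (B ** X ** adj2 B)" if "congr_mod m (adj2 B ** A ** B) X" for X
      using congr_mod_mult[OF congr_mod_mult[OF congr_mod_refl[of m B] that] congr_mod_refl[of m "adj2 B"]] e by simp
    from N this[of "mat 1"] this[of "- mat 1"] show ?thesis using B by auto
  qed
  have cK: "adj2 B ** A ** B \<in> K" if B: "B \<in> SL2" for B
  proof -
    have "adj2 (adj2 B) = B" by (rule mat2_eqI) (simp_all add: adj2_def)
    thus ?thesis using normal_in_SL2D(5)[OF K A adj2_SL2[OF B]] by simp
  qed
  define a b c d where "a = ma A mod m" and "b = mb A mod m" and "c = mc A mod m" and "d = md A mod m"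
  note defs = a_def b_def c_def d_def
  have range: "a \<in> set [0..m-1]" "b \<in> set [0..m-1]" "c \<in> set [0..m-1]" "d \<in> set [0..m-1]"
    using m2 by (auto simp: defs)
  have "(a * d - b * c) mod m = (ma A * md A - mb A * mc A) mod m"
    unfolding defs by (intro mod_diff_cong mod_mult_cong) simp_all
  also have "\<dots> = 1" using AS m2 by (simp add: SL2_iff)
  finally have det: "(a * d - b * c) mod m = 1" .
  from residue_check[OF m] range det
  have "(- b mod m \<in> {1, m - 1} \<or> (b = 0 \<and> d \<in> {1, m - 1})) \<or>
       (\<exists>y\<in>set [0..m-1]. (c + (d - a) * y - b * y * y) mod m \<in> {1, m - 1} \<or>
          (c + (d - a) * y - b * y * y) mod m = 0 \<and> (a + b * y) mod m \<in> {1, m - 1})"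
    unfolding residue_check_def by blast
  thus ?thesis
  proof (elim disjE bexE)
    have e: "mc (adj2 Smat ** A ** Smat) = - mb A" "ma (adj2 Smat ** A ** Smat) = md A"
      by (simp_all add: Smat_def adj2_def)
    {
      assume "- b mod m \<in> {1, m - 1}"
      hence "- mb A mod m \<in> {1, m - 1}" by (simp add: b_def mod_simps)
      thus ?thesis using no_unit[OF cK[OF Smat_SL2]] unfolding e by blast
    }
    assume "b = 0 \<and> d \<in> {1, m - 1}"
    hence "mc (adj2 Smat ** A ** Smat) mod m = 0" "ma (adj2 Smat ** A ** Smat) mod m \<in> {1, m - 1}"
      unfolding e by (auto simp: b_def d_def mod_eq_0_iff_dvd)
    from conj[OF Smat_SL2 upper[OF cK[OF Smat_SL2] this]] show ?thesis .
  next
    fix y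
    define B where "B = mat2 1 0 y 1"
    have B: "B \<in> SL2" by (simp add: B_def SL2_iff)
    have e: "mc (adj2 B ** A ** B) = mc A + (md A - ma A) * y - mb A * y * y" "ma (adj2 B ** A ** B) = ma A + mb A * y"
      by (simp_all add: B_def adj2_def algebra_simps)
    have r: "(c + (d - a) * y - b * y * y) mod m = mc (adj2 B ** A ** B) mod m" "(a + b * y) mod m = ma (adj2 B ** A ** B) mod m"
      unfolding e defs by (intro mod_add_cong mod_diff_cong mod_mult_cong refl; simp)+
    {
      assume "(c + (d - a) * y - b * y * y) mod m \<in> {1, m - 1}"
      thus ?thesis using no_unit[OF cK[OF B]] unfolding r by blast
    }
    assume "(c + (d - a) * y - b * y * y) mod m = 0 \<and> (a + b * y) mod m \<in> {1, m - 1}"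
    hence "mc (adj2 B ** A ** B) mod m = 0" "ma (adj2 B ** A ** B) mod m \<in> {1, m - 1}"
      unfolding r by blast+
    from conj[OF B upper[OF cK[OF B] this]] show ?thesis .
  qed
qed

section \<open>The image in PSL2(Z) and finite index\<close>

lemma to_PSL2Z_eq: "to_PSL2Z A = {A, - A}"
  by (auto simp: to_PSL2Z_def r_coset_def SL2Z_def)

lemma to_PSL2Z_image_eq:
  assumes K: "normal_in_SL2 K" and m: "int m \<in> {2,3,4,5}" and T: "Tmat (int m) \<in> K"
    and Tj: "\<And>j. 0 < j \<Longrightarrow> j < int m \<Longrightarrow> Tmat j \<notin> K"
    and ell: "\<And>t. \<bar>t\<bar> \<le> 1 \<Longrightarrow> mat2 0 (-1) 1 t \<notin> K"
  shows "to_PSL2Z ` K = to_PSL2Z ` principal_congruence_subgroup m"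
proof (intro equalityI image_subsetI)
  fix A assume A: "A \<in> K"
  have AS: "A \<in> SL2" by (rule normal_in_SL2D(1)[OF K A])
  from subset_principal_congruence[OF K m T Tj ell A]
  show "to_PSL2Z A \<in> to_PSL2Z ` principal_congruence_subgroup m"
  proof
    assume "congr_mod (int m) A (- mat 1)"
    hence "- A \<in> principal_congruence_subgroup m"
      using congr_mod_uminus[of "int m" A "- mat 1"] AS by (simp add: principal_congruence_iff SL2_iff)
    moreover have "to_PSL2Z A = to_PSL2Z (- A)" by (auto simp: to_PSL2Z_eq)
    ultimately show ?thesis by blast
  qed (use AS in \<open>auto simp: principal_congruence_iff\<close>)
next
  fix A assume "A \<in> principal_congruence_subgroup m"
  thus "to_PSL2Z A \<in> to_PSL2Z ` K"
    using principal_congruence_subset[OF K m T, of A] by (auto simp: principal_congruence_iff)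
qed

lemma r_coset_SL2Z: "K #>\<^bsub>SL2Z\<^esub> A = (\<lambda>k. k ** A) ` K"
  by (auto simp: r_coset_def SL2Z_def)

text \<open>K contains Gamma(m), so a coset depends only on the entries of a representative mod m,
  and there are at most m^4 residue tuples.\<close>

lemma finite_rcosets_of_congruence:
  assumes K: "normal_in_SL2 K" and m: "m \<in> {2,3,4,5}" and T: "Tmat m \<in> K"
  shows "finite (rcosets\<^bsub>SL2Z\<^esub> K)"
proof -
  define res where "res = (\<lambda>A :: int ^ 2 ^ 2. (ma A mod m, mb A mod m, mc A mod m, md A mod m))"
  have sub: "(\<lambda>k. k ** A) ` K \<subseteq> (\<lambda>k. k ** B) ` K" if "A \<in> SL2" "B \<in> SL2" "res A = res B" for A B
  proof (intro image_subsetI)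
    fix k assume k: "k \<in> K"
    have "congr_mod m A B" using that(3) by (simp add: res_def congr_mod_def mod_eq_dvd_iff)
    from congr_mod_mult[OF this congr_mod_refl[of m "adj2 B"]]
    have "A ** adj2 B \<in> K" using principal_congruence_subset[OF K m T, of "A ** adj2 B"] that by simp
    hence "k ** (A ** adj2 B) \<in> K" using normal_in_SL2D(3)[OF K k] by blast
    moreover have "k ** A = (k ** (A ** adj2 B)) ** B"
    proof -
      have "(k ** (A ** adj2 B)) ** B = (k ** A) ** (adj2 B ** B)" by (simp only: matrix_mul_assoc)
      thus ?thesis using that by simp
    qed
    ultimately show "k ** A \<in> (\<lambda>k. k ** B) ` K" by blast
  qed
  have fin: "finite (res ` SL2)"
  proof (rule finite_subset)
    show "res ` SL2 \<subseteq> {0..<m} \<times> {0..<m} \<times> {0..<m} \<times> {0..<m}" using m by (auto simp: res_def)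
  qed auto
  define F where "F = (\<lambda>r. (\<lambda>k. k ** (SOME B. B \<in> SL2 \<and> res B = r)) ` K)"
  have "(\<lambda>k. k ** A) ` K = F (res A)" if A: "A \<in> SL2" for A
  proof -
    define B where "B = (SOME B. B \<in> SL2 \<and> res B = res A)"
    have "B \<in> SL2 \<and> res B = res A" unfolding B_def by (rule someI[of _ A]) (use A in auto)
    hence "(\<lambda>k. k ** A) ` K = (\<lambda>k. k ** B) ` K" using sub[of A B] sub[of B A] A by auto
    thus ?thesis by (simp add: F_def B_def)
  qed
  hence "rcosets\<^bsub>SL2Z\<^esub> K \<subseteq> F ` (res ` SL2)" by (auto simp: RCOSETS_def r_coset_SL2Z)
  thus ?thesis using fin finite_subset by blast
qed

lemma finite_rcosets_imp_Tmat_power: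
  assumes K: "normal_in_SL2 K" and fin: "finite (rcosets\<^bsub>SL2Z\<^esub> K)"
  obtains N :: nat where "N > 0" "Tmat (int N) \<in> K"
proof -
  let ?f = "\<lambda>n::nat. K #>\<^bsub>SL2Z\<^esub> Tmat (int n)"
  have "range ?f \<subseteq> rcosets\<^bsub>SL2Z\<^esub> K" by (auto simp: RCOSETS_def)
  hence "finite (range ?f)" using fin finite_subset by blast
  hence "\<not> inj ?f" using finite_imageD[of ?f UNIV] infinite_UNIV_nat by blast
  then obtain i' j' where ij': "i' \<noteq> j'" "?f i' = ?f j'" by (auto simp: inj_def)
  obtain i j where ij: "i < j" "?f i = ?f j"
  proof (cases "i' < j'")
    case True
    thus ?thesis using ij' that[of i' j'] by blast
  next
    case False
    hence "j' < i'" using ij' by simp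
    thus ?thesis using ij'(2)[symmetric] that[of j' i'] by blast
  qed
  have "Tmat (int j) \<in> ?f j" using normal_in_SL2D(7)[OF K] unfolding r_coset_SL2Z by force
  then obtain k where k: "k \<in> K" "Tmat (int j) = k ** Tmat (int i)" using ij unfolding r_coset_SL2Z by auto
  have "k = (k ** Tmat (int i)) ** Tmat (- int i)" by (simp add: matrix_mul_assoc[symmetric] Tmat_add Tmat_0)
  also have "\<dots> = Tmat (int (j - i))" using ij unfolding k(2)[symmetric] by (simp add: Tmat_add of_nat_diff)
  finally show ?thesis using that[of "j - i"] ij k by simp
qed

text \<open>S = T^-1 (S T^-1 S^-1) T^-1. The conclusion is spelled as the elliptic matrix with t = 0
  of \<open>elliptic_notin_scalar_group\<close>.\<close>

lemma Tmat_1_imp_Smat: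
  assumes K: "normal_in_SL2 K" and T: "Tmat 1 \<in> K"
  shows "mat2 0 (-1) 1 0 \<in> K"
proof -
  have Tm: "Tmat (-1) \<in> K" using Tmat_multiple_in[OF K T, of "-1"] by simp
  have "Smat ** Tmat (-1) ** adj2 Smat \<in> K" by (rule normal_in_SL2D(5)[OF K Tm]) simp
  hence "Tmat (-1) ** (Smat ** Tmat (-1) ** adj2 Smat) ** Tmat (-1) \<in> K"
    using normal_in_SL2D(3)[OF K] Tm by blast
  also have "Tmat (-1) ** (Smat ** Tmat (-1) ** adj2 Smat) ** Tmat (-1) = mat2 0 (-1) 1 0"
    by (rule mat2_eqI) (simp_all add: Tmat_def Smat_def adj2_def)
  finally show ?thesis .
qed

section \<open>Expansions of the linear solutions at the cusp\<close>

text \<open>Frobenius recursion for the exponent r/2: n (n + r) is (n + r/2)^2 - (r/2)^2, and 60 r^2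
  is r^2/4 times the 240 of E4. A vanishing denominator would silently give the coefficient
  0.\<close>

function frob_coeff :: "complex \<Rightarrow> nat \<Rightarrow> complex" where
  "frob_coeff r n = (if n = 0 then 1 else
     60 * r\<^sup>2 * (\<Sum>j<n. of_nat (sigma3 (n - j)) * frob_coeff r j) / (of_nat n * (of_nat n + r)))"
  by auto
termination by (relation "Wellfounded.measure snd") auto

declare frob_coeff.simps [simp del]

definition frob_fps :: "complex \<Rightarrow> complex fps" where "frob_fps r = Abs_fps (frob_coeff r)"

text \<open>No r/2 + n with n > 0 equals the other exponent -r/2.\<close>

definition nonresonant :: "complex \<Rightarrow> bool" where
  "nonresonant r \<longleftrightarrow> (\<forall>n::nat. n > 0 \<longrightarrow> of_nat n + r \<noteq> 0)"

lemma frob_coeff_0 [simp]: "frob_coeff r 0 = 1"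
  by (simp add: frob_coeff.simps)

lemma frob_coeff_rec:
  assumes "nonresonant r"
  shows "of_nat n * (of_nat n + r) * frob_coeff r n = 60 * r\<^sup>2 * (\<Sum>j<n. of_nat (sigma3 (n - j)) * frob_coeff r j)"
proof (cases "n = 0")
  case False
  thus ?thesis using assms by (subst frob_coeff.simps) (simp add: nonresonant_def)
qed simp

lemma frob_fps_radius: "nonresonant r \<Longrightarrow> fps_conv_radius (frob_fps r) \<ge> 1"
  unfolding fps_conv_radius_ge_1_iff
proof (intro allI impI)
  fix x :: real assume r: "nonresonant r" and x: "0 < x \<and> x < 1"
  obtain B0 where B0: "\<And>n. norm (fps_nth (Abs_fps (\<lambda>n. of_nat (sigma3 n)) :: complex fps) n) * x ^ n \<le> B0"
    using sigma3_fps_radius x unfolding fps_conv_radius_ge_1_iff by blast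
  define B where "B = max B0 0"
  have B: "real (sigma3 n) * x ^ n \<le> B" "B \<ge> 0" for n using B0[of n] by (auto simp: B_def)
  \<comment> \<open>Beyond N0 one has |n + r| >= n/2 and 120 |r|^2 B <= n. The recursion sums n
    terms of size at most B D and divides by at least n^2/2, so the bound D for the first
    coefficients propagates.\<close>
  obtain N0 :: nat where N0: "real N0 > max (2 * norm r) (120 * (norm r)\<^sup>2 * B)" using reals_Archimedean2 by blast
  define D where "D = Max ((\<lambda>n. norm (frob_coeff r n) * x ^ n) ` {..N0})"
  have D: "norm (frob_coeff r n) * x ^ n \<le> D" if "n \<le> N0" for n
    unfolding D_def using that by (intro Max_ge) auto
  have D0: "D \<ge> 0" using D[of 0] by simp
  have "norm (frob_coeff r n) * x ^ n \<le> D" for n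
  proof (induction n rule: less_induct)
    case (less n)
    show ?case
    proof (cases "n \<le> N0")
      case True thus ?thesis by (rule D)
    next
      case False
      hence n: "real n > 2 * norm r" "real n > 120 * (norm r)\<^sup>2 * B" "n > 0" using N0 by auto
      have "norm (of_nat n + r) \<ge> real n - norm r" using norm_triangle_ineq4[of "of_nat n + r" r] by simp
      hence nr: "norm (of_nat n + r) \<ge> real n / 2" using n by linarith
      have "norm (\<Sum>j<n. of_nat (sigma3 (n - j)) * frob_coeff r j) * x ^ n
          \<le> (\<Sum>j<n. real (sigma3 (n - j)) * norm (frob_coeff r j)) * x ^ n"
        using x by (intro mult_right_mono order_trans[OF norm_sum]) (auto simp: norm_mult)
      also have "\<dots> = (\<Sum>j<n. (real (sigma3 (n - j)) * x ^ (n - j)) * (norm (frob_coeff r j) * x ^ j))"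
        unfolding sum_distrib_right
      proof (rule sum.cong)
        fix j assume "j \<in> {..<n}"
        hence "x ^ n = x ^ (n - j) * x ^ j" by (simp add: power_add[symmetric])
        thus "real (sigma3 (n - j)) * norm (frob_coeff r j) * x ^ n = (real (sigma3 (n - j)) * x ^ (n - j)) * (norm (frob_coeff r j) * x ^ j)"
          by (simp add: mult_ac)
      qed auto
      also have "\<dots> \<le> (\<Sum>j<n. B * D)"
        using x less.IH B by (intro sum_mono mult_mono) auto
      finally have S: "norm (\<Sum>j<n. of_nat (sigma3 (n - j)) * frob_coeff r j) * x ^ n \<le> real n * (B * D)" by simp
      have "(real n * (real n / 2)) * (norm (frob_coeff r n) * x ^ n) \<le> (real n * norm (of_nat n + r)) * (norm (frob_coeff r n) * x ^ n)"
        using nr x by (intro mult_right_mono mult_left_mono) auto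
      also have "\<dots> = norm (of_nat n * (of_nat n + r) * frob_coeff r n) * x ^ n" by (simp add: norm_mult)
      also have "\<dots> = 60 * (norm r)\<^sup>2 * (norm (\<Sum>j<n. of_nat (sigma3 (n - j)) * frob_coeff r j) * x ^ n)"
        unfolding frob_coeff_rec[OF r] by (simp add: norm_mult norm_power)
      also have "\<dots> \<le> 60 * (norm r)\<^sup>2 * (real n * (B * D))" using S by (intro mult_left_mono) auto
      finally have "(real n / 2) * (real n * (norm (frob_coeff r n) * x ^ n)) \<le> (real n / 2) * (120 * (norm r)\<^sup>2 * B * D)"
        by (simp add: mult_ac)
      hence "real n * (norm (frob_coeff r n) * x ^ n) \<le> 120 * (norm r)\<^sup>2 * B * D"
        using n(3) by (subst (asm) mult_le_cancel_left_pos) auto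
      also have "\<dots> \<le> real n * D" using n D0 by (intro mult_right_mono) auto
      finally show ?thesis using n(3) by (subst (asm) mult_le_cancel_left_pos) auto
    qed
  qed
  thus "\<exists>C. \<forall>n. norm (fps_nth (frob_fps r) n) * x ^ n \<le> C" by (auto simp: frob_fps_def)
qed

text \<open>With theta = q d/dq, which is \<open>fps_XD\<close>, this is (theta + r/2)^2 phi =
  (r^2/4) E4 phi, compared coefficient by coefficient.\<close>

lemma frob_fps_ode:
  assumes "nonresonant r"
  shows "fps_const (r\<^sup>2 / 4) * frob_fps r + fps_const r * fps_XD (frob_fps r) + fps_XD (fps_XD (frob_fps r)) =
     fps_const (r\<^sup>2 / 4) * (E4_fps * frob_fps r)"
proof (rule fps_ext)
  fix n
  have "fps_nth (E4_fps * frob_fps r) n = (\<Sum>i=0..n. frob_coeff r i * fps_nth E4_fps (n - i))"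
    by (subst mult.commute, subst fps_mult_nth) (simp add: frob_fps_def)
  also have "\<dots> = (\<Sum>i<n. frob_coeff r i * fps_nth E4_fps (n - i)) + frob_coeff r n"
    by (simp add: atLeast0AtMost lessThan_Suc_atMost[symmetric] E4_fps_def)
  also have "(\<Sum>i<n. frob_coeff r i * fps_nth E4_fps (n - i)) = 240 * (\<Sum>j<n. of_nat (sigma3 (n - j)) * frob_coeff r j)"
    unfolding sum_distrib_left by (intro sum.cong) (auto simp: E4_fps_def)
  finally have "fps_nth (fps_const (r\<^sup>2 / 4) * (E4_fps * frob_fps r)) n =
      60 * r\<^sup>2 * (\<Sum>j<n. of_nat (sigma3 (n - j)) * frob_coeff r j) + r\<^sup>2 / 4 * frob_coeff r n"
    by (simp only: fps_mult_left_const_nth) (simp add: algebra_simps)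
  also have "\<dots> = of_nat n * (of_nat n + r) * frob_coeff r n + r\<^sup>2 / 4 * frob_coeff r n"
    unfolding frob_coeff_rec[OF assms] ..
  finally show "fps_nth (fps_const (r\<^sup>2 / 4) * frob_fps r + fps_const r * fps_XD (frob_fps r) + fps_XD (fps_XD (frob_fps r))) n =
     fps_nth (fps_const (r\<^sup>2 / 4) * (E4_fps * frob_fps r)) n"
    by (simp add: frob_fps_def fps_XD_nth algebra_simps)
qed

definition frob_sol :: "complex \<Rightarrow> complex \<Rightarrow> complex" where
  "frob_sol r \<tau> = exp (of_real pi * \<i> * r * \<tau>) * eval_fps (frob_fps r) (qexp \<tau>)"

text \<open>d/dtau is 2 pi i theta, and the factor e^(pi i r tau) turns theta into theta + r/2.
  Since (2 pi i)^2 r^2/4 = - pi^2 r^2, the value of s is 2 pi^2 r^2.\<close>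

lemma lin_sol_frob_sol:
  assumes "nonresonant r"
  shows "lin_sol (2 * of_real pi ^ 2 * r\<^sup>2) (frob_sol r)"
proof -
  let ?\<phi> = "frob_fps r" and ?e = "\<lambda>\<tau>. exp (of_real pi * \<i> * r * \<tau>)"
  let ?p = "of_real pi * \<i> * r" and ?c = "2 * of_real pi * \<i> :: complex"
  let ?y' = "\<lambda>\<tau>. ?e \<tau> * (?p * eval_fps ?\<phi> (qexp \<tau>) + ?c * eval_fps (fps_XD ?\<phi>) (qexp \<tau>))"
  have R0: "fps_conv_radius ?\<phi> \<ge> 1" by (rule frob_fps_radius[OF assms])
  have R1: "fps_conv_radius (fps_XD ?\<phi>) \<ge> 1" using R0 fps_conv_radius_XD order_trans by blast
  have R2: "fps_conv_radius (fps_XD (fps_XD ?\<phi>)) \<ge> 1" using R1 fps_conv_radius_XD order_trans by blast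
  have de: "(?e has_field_derivative ?p * ?e \<tau>) (at \<tau>)" for \<tau> by (auto intro!: derivative_eq_intros)
  show ?thesis
  proof (rule solvesI(1)[OF open_H, of _ ?y'])
    fix \<tau> assume "\<tau> \<in> upper_half_plane"
    hence t: "Im \<tau> > 0" by (simp add: in_H_iff)
    note d0 = has_field_derivative_qseries[OF R0 t] and d1 = has_field_derivative_qseries[OF R1 t]
    have "((\<lambda>\<tau>. ?e \<tau> * eval_fps ?\<phi> (qexp \<tau>)) has_field_derivative
       ?e \<tau> * (?c * eval_fps (fps_XD ?\<phi>) (qexp \<tau>)) + (?p * ?e \<tau>) * eval_fps ?\<phi> (qexp \<tau>)) (at \<tau>)"
      by (rule DERIV_mult'[OF de d0])
    thus "(frob_sol r has_field_derivative ?y' \<tau>) (at \<tau>)" by (simp add: frob_sol_def[abs_def] algebra_simps)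
    define q where "q = qexp \<tau>"
    have q: "norm q < 1" unfolding q_def by (rule norm_qexp_less_1[OF t])
    have "(?y' has_field_derivative ?e \<tau> * (?p * (?c * eval_fps (fps_XD ?\<phi>) q) + ?c * (?c * eval_fps (fps_XD (fps_XD ?\<phi>)) q))
       + (?p * ?e \<tau>) * (?p * eval_fps ?\<phi> q + ?c * eval_fps (fps_XD ?\<phi>) q)) (at \<tau>)"
      unfolding q_def by (intro DERIV_mult' de DERIV_add DERIV_cmult d0 d1)
    also have "?e \<tau> * (?p * (?c * eval_fps (fps_XD ?\<phi>) q) + ?c * (?c * eval_fps (fps_XD (fps_XD ?\<phi>)) q))
       + (?p * ?e \<tau>) * (?p * eval_fps ?\<phi> q + ?c * eval_fps (fps_XD ?\<phi>) q) =
       ?c\<^sup>2 * ?e \<tau> * (r\<^sup>2 / 4 * eval_fps ?\<phi> q + r * eval_fps (fps_XD ?\<phi>) q + eval_fps (fps_XD (fps_XD ?\<phi>)) q)"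
      by (simp add: algebra_simps power2_eq_square)
    also have "r\<^sup>2 / 4 * eval_fps ?\<phi> q + r * eval_fps (fps_XD ?\<phi>) q + eval_fps (fps_XD (fps_XD ?\<phi>)) q =
       r\<^sup>2 / 4 * (eval_fps E4_fps q * eval_fps ?\<phi> q)"
    proof -
      let ?f = "fps_const (r\<^sup>2 / 4) * ?\<phi>" and ?g = "fps_const r * fps_XD ?\<phi>" and ?h = "fps_XD (fps_XD ?\<phi>)"
      have cm: "fps_conv_radius (fps_const a * f) \<ge> 1" if "fps_conv_radius f \<ge> 1" for a and f :: "complex fps"
        using fps_conv_radius_mult[of "fps_const a" f] that by (simp add: order_trans)
      have Rfg: "fps_conv_radius (?f + ?g) \<ge> 1"
        using fps_conv_radius_add[of ?f ?g] cm[OF R0] cm[OF R1] by (meson min.boundedI order_trans)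
      have RE: "fps_conv_radius (E4_fps * ?\<phi>) \<ge> 1"
        using fps_conv_radius_mult[of E4_fps ?\<phi>] E4_fps_radius R0 by (meson min.boundedI order_trans)
      have "r\<^sup>2 / 4 * eval_fps ?\<phi> q + r * eval_fps (fps_XD ?\<phi>) q + eval_fps (fps_XD (fps_XD ?\<phi>)) q = eval_fps (?f + ?g + ?h) q"
        using in_conv_radius[OF R0 q] in_conv_radius[OF R1 q] in_conv_radius[OF R2 q] in_conv_radius[OF Rfg q]
          in_conv_radius[OF cm[OF R0] q] in_conv_radius[OF cm[OF R1] q]
        by (simp add: eval_fps_add eval_fps_mult)
      also have "\<dots> = eval_fps (fps_const (r\<^sup>2 / 4) * (E4_fps * ?\<phi>)) q" unfolding frob_fps_ode[OF assms] ..
      also have "\<dots> = r\<^sup>2 / 4 * (eval_fps E4_fps q * eval_fps ?\<phi> q)"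
        using in_conv_radius[OF RE q] in_conv_radius[OF R0 q] in_conv_radius[OF E4_fps_radius q] 
        by (simp add: eval_fps_mult)
      finally show ?thesis .
    qed
    also have "?c\<^sup>2 * ?e \<tau> * (r\<^sup>2 / 4 * (eval_fps E4_fps q * eval_fps ?\<phi> q)) =
        - (2 * of_real pi ^ 2 * r\<^sup>2 / 2) * E4 \<tau> * frob_sol r \<tau>"
      unfolding frob_sol_def E4_conv_eval_fps[OF t] q_def by (simp add: power_mult_distrib)
    finally show "(?y' has_field_derivative - (2 * of_real pi ^ 2 * r\<^sup>2 / 2) * E4 \<tau> * frob_sol r \<tau>) (at \<tau>)" .
  qed
qed

lemma frob_sol_plus_int: "frob_sol r (\<tau> + of_int k) = exp (of_real pi * \<i> * r * of_int k) * frob_sol r \<tau>"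
  unfolding frob_sol_def qexp_plus_int by (simp add: algebra_simps exp_add)

lemma norm_qexp: "norm (qexp \<tau>) = exp (- (2 * pi * Im \<tau>))"
  by simp

lemma qseries_near_cusp:
  assumes f: "fps_conv_radius f \<ge> 1" and e: "e > 0"
  obtains C where "C > 0" "\<And>\<tau>. Im \<tau> > C \<Longrightarrow> norm (eval_fps f (qexp \<tau>) - fps_nth f 0) < e"
proof -
  have "isCont (eval_fps f) 0"
    by (rule continuous_eval_fps) (use in_conv_radius[OF f, of 0] in auto)
  then obtain d where d: "d > 0" "\<And>q. norm q < d \<Longrightarrow> norm (eval_fps f q - eval_fps f 0) < e"
    using e unfolding continuous_at_eps_delta dist_norm by auto
  show ?thesis
  proof (rule that[of "max 1 (- ln d / (2 * pi))"])
    fix \<tau> assume "Im \<tau> > max 1 (- ln d / (2 * pi))"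
    hence "Im \<tau> * (2 * pi) > - ln d" by (simp add: field_simps)
    hence "exp (- (2 * pi * Im \<tau>)) < exp (ln d)" by (subst exp_less_cancel_iff) (simp add: mult_ac)
    hence "norm (qexp \<tau>) < d" using d(1) unfolding norm_qexp by simp
    from d(2)[OF this] show "norm (eval_fps f (qexp \<tau>) - fps_nth f 0) < e" by (simp add: eval_fps_at_0)
  qed auto
qed

lemma frob_near_cusp:
  assumes "nonresonant r"
  obtains C where "C > 0" "\<And>\<tau>. Im \<tau> > C \<Longrightarrow> norm (eval_fps (frob_fps r) (qexp \<tau>) - 1) < 1 / 2"
proof -
  obtain C where "C > 0" "\<And>\<tau>. Im \<tau> > C \<Longrightarrow> norm (eval_fps (frob_fps r) (qexp \<tau>) - fps_nth (frob_fps r) 0) < 1 / 2"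
    using qseries_near_cusp[OF frob_fps_radius[OF assms], of "1/2"] by auto
  moreover have "fps_nth (frob_fps r) 0 = 1" by (simp add: frob_fps_def)
  ultimately show ?thesis using that[of C] by simp
qed

lemma frob_sol_nonzero:
  assumes "nonresonant r"
  obtains \<tau> where "\<tau> \<in> upper_half_plane" "frob_sol r \<tau> \<noteq> 0"
proof -
  obtain C where C: "C > 0" "\<And>\<tau>. Im \<tau> > C \<Longrightarrow> norm (eval_fps (frob_fps r) (qexp \<tau>) - 1) < 1 / 2"
    using frob_near_cusp[OF assms] by blast
  define \<tau> where "\<tau> = Complex 0 (C + 1)"
  have "eval_fps (frob_fps r) (qexp \<tau>) \<noteq> 0" using C(2)[of \<tau>] by (auto simp: \<tau>_def)
  thus ?thesis using that[of \<tau>] C(1) by (auto simp: frob_sol_def in_H_iff \<tau>_def)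
qed

text \<open>The shift by 1 multiplies the two solutions by e^(pi i r) and e^(-pi i r). If they were
  proportional, these factors would agree.\<close>

lemma frob_wronskian:
  assumes r: "nonresonant r" "nonresonant (- r)" and ne: "exp (2 * of_real pi * \<i> * r) \<noteq> 1" and t: "\<tau> \<in> upper_half_plane"
  shows "wronskian (frob_sol r) (frob_sol (- r)) \<tau> \<noteq> 0"
proof
  assume W: "wronskian (frob_sol r) (frob_sol (- r)) \<tau> = 0"
  have s: "lin_sol (2 * of_real pi ^ 2 * r\<^sup>2) (frob_sol r)" "lin_sol (2 * of_real pi ^ 2 * r\<^sup>2) (frob_sol (- r))"
    using lin_sol_frob_sol[OF r(1)] lin_sol_frob_sol[OF r(2)] by simp_all
  obtain t1 where t1: "t1 \<in> upper_half_plane" "frob_sol (- r) t1 \<noteq> 0" using frob_sol_nonzero[OF r(2)] by blast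
  obtain t2 where t2: "t2 \<in> upper_half_plane" "frob_sol r t2 \<noteq> 0" using frob_sol_nonzero[OF r(1)] by blast
  obtain c where c: "\<And>z. z \<in> upper_half_plane \<Longrightarrow> frob_sol r z = c * frob_sol (- r) z"
    using wronskian_zero_imp_dependent[OF s open_H connected_H t W t1] by blast
  define l where "l = exp (of_real pi * \<i> * r)"
  have l0: "l \<noteq> 0" by (simp add: l_def)
  have li: "exp (of_real pi * \<i> * (- r)) = inverse l" by (simp add: l_def exp_minus)
  have "t2 + 1 \<in> upper_half_plane" using t2 by (simp add: in_H_iff)
  hence "frob_sol r (t2 + 1) = c * frob_sol (- r) (t2 + 1)" by (rule c)
  hence "l * frob_sol r t2 = inverse l * (c * frob_sol (- r) t2)"
    using frob_sol_plus_int[of r t2 1] frob_sol_plus_int[of "- r" t2 1] li by (simp add: l_def mult_ac)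
  hence "l * l = 1" using t2 l0 by (simp add: c[OF t2(1), symmetric] field_simps)
  moreover have "l * l = exp (2 * of_real pi * \<i> * r)" by (simp add: l_def mult_ac flip: exp_add)
  ultimately show False using ne by simp
qed

section \<open>The maximum principle\<close>

text \<open>A point with |Re| <= 1/2 and Im < 1/2 has |z|^2 < 1/2, so -1/z at least doubles the
  imaginary part. For a maximum this strip serves as well as the smaller fundamental domain.\<close>

lemma reduce_to_strip:
  fixes f :: "complex \<Rightarrow> real"
  assumes T: "\<And>\<tau> k. \<tau> \<in> upper_half_plane \<Longrightarrow> f (\<tau> + of_int k) = f \<tau>"
    and S: "\<And>\<tau>. \<tau> \<in> upper_half_plane \<Longrightarrow> f (- 1 / \<tau>) = f \<tau>"
    and t: "\<tau> \<in> upper_half_plane"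
  shows "\<exists>\<tau>'. \<bar>Re \<tau>'\<bar> \<le> 1 / 2 \<and> Im \<tau>' \<ge> 1 / 2 \<and> f \<tau>' = f \<tau>"
proof -
  have main: "\<tau> \<in> upper_half_plane \<Longrightarrow> 2 ^ n * Im \<tau> \<ge> 1 / 2 \<Longrightarrow> \<exists>\<tau>'. \<bar>Re \<tau>'\<bar> \<le> 1 / 2 \<and> Im \<tau>' \<ge> 1 / 2 \<and> f \<tau>' = f \<tau>"
    for n \<tau>
  proof (induction n arbitrary: \<tau>)
    case 0
    define k where "k = - round (Re \<tau>)"
    have "\<bar>Re \<tau> - of_int (round (Re \<tau>))\<bar> \<le> 1 / 2"
      using of_int_round_abs_le[of "Re \<tau>"] by (simp add: abs_minus_commute)
    thus ?case using 0 T[OF 0(1), of k] by (intro exI[of _ "\<tau> + of_int k"]) (auto simp: k_def)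
  next
    case (Suc n)
    define k where "k = - round (Re \<tau>)"
    define z where "z = \<tau> + of_int k"
    have z: "\<bar>Re z\<bar> \<le> 1 / 2" "Im z = Im \<tau>" "f z = f \<tau>"
      using of_int_round_abs_le[of "Re \<tau>"] T[OF Suc.prems(1), of k] by (auto simp: z_def k_def abs_minus_commute)
    have zH: "Im z > 0" using Suc.prems z by (simp add: in_H_iff)
    show ?case
    proof (cases "Im z \<ge> 1 / 2")
      case True thus ?thesis using z by blast
    next
      case False
      have "(Re z)\<^sup>2 \<le> (1 / 2)\<^sup>2" using z(1) by (simp add: abs_le_square_iff[symmetric])
      moreover have "(Im z)\<^sup>2 < (1 / 2)\<^sup>2" using False zH by (intro power_strict_mono) auto
      moreover have "(1 / 2 :: real)\<^sup>2 = 1 / 4" by (simp add: power2_eq_square)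
      ultimately have n: "(cmod z)\<^sup>2 < 1 / 2" unfolding cmod_power2 by linarith
      have z0: "(cmod z)\<^sup>2 > 0" using zH by auto
      have im: "Im (- 1 / z) = Im z / (cmod z)\<^sup>2" using Im_mobius[OF Smat_SL2, of z] by simp
      have "Im z * (2 * (cmod z)\<^sup>2) \<le> Im z * 1" using n zH by (intro mult_left_mono) auto
      hence "Im (- 1 / z) \<ge> 2 * Im z" unfolding im using z0 by (simp add: pos_le_divide_eq)
      hence "2 ^ n * Im (- 1 / z) \<ge> 2 ^ n * (2 * Im \<tau>)" unfolding z(2) by (intro mult_left_mono) auto
      hence "2 ^ n * Im (- 1 / z) \<ge> 1 / 2" using Suc.prems(2) by (simp only: power_Suc2 mult.assoc)
      moreover have "- 1 / z \<in> upper_half_plane" using im z0 zH by (simp add: in_H_iff)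
      ultimately obtain \<tau>' where "\<bar>Re \<tau>'\<bar> \<le> 1 / 2" "Im \<tau>' \<ge> 1 / 2" "f \<tau>' = f (- 1 / z)"
        using Suc.IH by blast
      thus ?thesis using S[of z] z(3) zH by (auto simp: in_H_iff)
    qed
  qed
  have "Im \<tau> > 0" using t by (simp add: in_H_iff)
  then obtain n :: nat where "1 / (2 * Im \<tau>) < 2 ^ n" using real_arch_pow[of 2 "1 / (2 * Im \<tau>)"] by auto
  hence "2 ^ n * Im \<tau> \<ge> 1 / 2" using \<open>Im \<tau> > 0\<close> by (simp add: field_simps)
  thus ?thesis using main t by blast
qed

lemma no_slash_eigenfunction:
  assumes hol: "y holomorphic_on upper_half_plane" and nz: "\<tau>1 \<in> upper_half_plane" "y \<tau>1 \<noteq> 0"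
    and S: "\<And>\<tau>. \<tau> \<in> upper_half_plane \<Longrightarrow> slash Smat y \<tau> = c * y \<tau>" and c: "norm c = 1"
    and T: "\<And>\<tau> k. \<tau> \<in> upper_half_plane \<Longrightarrow> norm (y (\<tau> + of_int k)) = norm (y \<tau>)"
    and decay: "\<And>e. e > 0 \<Longrightarrow> \<exists>C. \<forall>\<tau>. Im \<tau> > C \<longrightarrow> norm (y \<tau>) < e"
  shows False
proof -
  define F where "F = (\<lambda>\<tau>. y \<tau> ^ 4 * E4 \<tau>)"
  let ?f = "\<lambda>\<tau>. norm (F \<tau>)"
  have holF: "F holomorphic_on upper_half_plane"
    unfolding F_def using hol holomorphic_E4 by (intro holomorphic_intros)
  have fT: "?f (\<tau> + of_int k) = ?f \<tau>" if "\<tau> \<in> upper_half_plane" for \<tau> k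
    using T[OF that, of k] by (simp add: F_def E4_plus_int norm_mult norm_power)
  have fS: "?f (- 1 / \<tau>) = ?f \<tau>" if t: "\<tau> \<in> upper_half_plane" for \<tau>
  proof -
    have t0: "\<tau> \<noteq> 0" using t by (auto simp: in_H_iff)
    have "\<tau> * y (- 1 / \<tau>) = c * y \<tau>" using S[OF t] by simp
    hence "norm \<tau> * norm (y (- 1 / \<tau>)) = norm (y \<tau>)" using c by (metis norm_mult mult_1)
    hence "(norm \<tau> * norm (y (- 1 / \<tau>))) ^ 4 = norm (y \<tau>) ^ 4" by simp
    moreover have "E4 (- 1 / \<tau>) = \<tau> ^ 4 * E4 \<tau>" using E4_minus_inverse t by (simp add: in_H_iff)
    ultimately show ?thesis by (simp add: F_def norm_mult norm_power power_mult_distrib mult_ac)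
  qed
  obtain C0 where C0: "C0 > 0" "\<And>\<tau>. Im \<tau> > C0 \<Longrightarrow> norm (eval_fps E4_fps (qexp \<tau>) - fps_nth E4_fps 0) < 1"
    using qseries_near_cusp[OF E4_fps_radius, of 1] by auto
  have E4near: "norm (E4 \<tau> - 1) < 1" if "Im \<tau> > C0" for \<tau>
    using C0(2)[OF that] E4_conv_eval_fps[of \<tau>] that C0(1) by (simp add: E4_fps_def)
  have E4_2: "norm (E4 \<tau>) < 2" if "Im \<tau> > C0" for \<tau>
    using E4near[OF that] norm_triangle_sub[of "E4 \<tau>" 1] by simp
  \<comment> \<open>Provides a positive value M of the invariant function: this high up E4 is
    nonzero, and by the identity theorem y cannot vanish on a whole half plane.\<close>
  have "\<exists>\<tau>. Im \<tau> > C0 \<and> y \<tau> \<noteq> 0"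
  proof (rule ccontr)
    assume z: "\<not> ?thesis"
    have "y \<tau>1 = 0"
    proof (rule analytic_continuation_open[of "{\<tau>. Im \<tau> > C0}" upper_half_plane y "\<lambda>_. 0"])
      show "{\<tau>. Im \<tau> > C0} \<noteq> {}" by (auto intro!: exI[of _ "Complex 0 (C0 + 1)"])
    qed (use z C0(1) hol nz in \<open>auto simp: in_H_iff open_halfspace_Im_gt\<close>)
    thus False using nz by simp
  qed
  then obtain \<tau>0 where t0: "Im \<tau>0 > C0" "y \<tau>0 \<noteq> 0" by blast
  hence t0H: "\<tau>0 \<in> upper_half_plane" using C0 by (simp add: in_H_iff)
  define M where "M = ?f \<tau>0"
  have "E4 \<tau>0 \<noteq> 0" using E4near[OF t0(1)] by auto
  hence M: "M > 0" using t0 by (simp add: M_def F_def)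
  \<comment> \<open>The bound 1 reduces |y|^4 to |y|, and M/2 makes up for |E4| < 2.\<close>
  obtain C1 where C1: "\<And>\<tau>. Im \<tau> > C1 \<Longrightarrow> norm (y \<tau>) < min 1 (M / 2)" using decay[of "min 1 (M / 2)"] M by auto
  define C where "C = max C0 C1"
  have small: "?f \<tau> < M" if "Im \<tau> > C" for \<tau>
  proof -
    have y: "norm (y \<tau>) < 1" "norm (y \<tau>) < M / 2" using C1[of \<tau>] that by (auto simp: C_def)
    have "norm (y \<tau>) ^ 4 = norm (y \<tau>) ^ 3 * norm (y \<tau>)" by (simp add: power4_eq_xxxx power3_eq_cube)
    also have "\<dots> \<le> 1 * norm (y \<tau>)" using y by (intro mult_right_mono power_le_one) auto
    finally have "norm (y \<tau>) ^ 4 < M / 2" using y by linarith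
    hence "norm (y \<tau>) ^ 4 * norm (E4 \<tau>) \<le> M / 2 * norm (E4 \<tau>)" by (intro mult_right_mono) auto
    also have "\<dots> < M / 2 * 2" using E4_2[of \<tau>] that M by (intro mult_strict_left_mono) (auto simp: C_def)
    finally show ?thesis by (simp add: F_def norm_mult norm_power)
  qed
  define D where "D = cbox (Complex (- 1 / 2) (1 / 2)) (Complex (1 / 2) C)"
  have D: "z \<in> D \<longleftrightarrow> \<bar>Re z\<bar> \<le> 1 / 2 \<and> 1 / 2 \<le> Im z \<and> Im z \<le> C" for z
    by (auto simp: D_def in_cbox_complex_iff)
  have DH: "D \<subseteq> upper_half_plane" by (auto simp: D in_H_iff)
  obtain t0' where t0': "\<bar>Re t0'\<bar> \<le> 1 / 2" "Im t0' \<ge> 1 / 2" "?f t0' = M"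
    using reduce_to_strip[of ?f, OF fT fS t0H] by (auto simp: M_def)
  moreover have "Im t0' \<le> C" using small[of t0'] t0'(3) by (metis less_irrefl not_less)
  ultimately have t0D: "t0' \<in> D" by (simp add: D)
  have "continuous_on D ?f"
    using holomorphic_on_imp_continuous_on[OF holF] DH by (intro continuous_on_norm) (rule continuous_on_subset)
  then obtain p where p: "p \<in> D" "\<And>z. z \<in> D \<Longrightarrow> ?f z \<le> ?f p"
    using continuous_attains_sup[of D ?f] t0D by (auto simp: D_def)
  have pM: "?f p \<ge> M" using p(2)[OF t0D] t0' by simp
  have max: "?f z \<le> ?f p" if z: "z \<in> upper_half_plane" for z
  proof -
    obtain z' where z': "\<bar>Re z'\<bar> \<le> 1 / 2" "Im z' \<ge> 1 / 2" "?f z' = ?f z"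
      using reduce_to_strip[of ?f, OF fT fS z] by auto
    show ?thesis
    proof (cases "Im z' > C")
      case True thus ?thesis using small[OF True] pM z' by linarith
    next
      case False
      hence "z' \<in> D" using z' by (simp add: D)
      thus ?thesis using p(2)[of z'] z' by simp
    qed
  qed
  have "F constant_on upper_half_plane"
    by (rule maximum_modulus_principle[OF holF open_H connected_H open_H order_refl]) (use p DH max in auto)
  then obtain k where k: "\<And>z. z \<in> upper_half_plane \<Longrightarrow> F z = k" by (auto simp: constant_on_def)
  have "Complex 0 (\<bar>C\<bar> + 1) \<in> upper_half_plane" by (simp add: in_H_iff)
  hence "?f (Complex 0 (\<bar>C\<bar> + 1)) = M" using k t0H by (simp add: M_def)
  moreover have "?f (Complex 0 (\<bar>C\<bar> + 1)) < M" by (rule small) simp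
  ultimately show False by simp
qed

text \<open>For r > 0 the leading factor decays like e^(-pi r Im tau), and since r is real the
  powers of T multiply the solution by unimodular numbers.\<close>

lemma frob_sol_not_slash_eigenfunction:
  fixes r :: real
  assumes r: "r > 0" and S: "\<And>\<tau>. \<tau> \<in> upper_half_plane \<Longrightarrow> slash Smat (frob_sol (of_real r)) \<tau> = c * frob_sol (of_real r) \<tau>"
    and c: "norm c = 1"
  shows False
proof -
  let ?y = "frob_sol (of_real r)"
  have nr: "nonresonant (of_real r)"
    unfolding nonresonant_def
  proof (intro allI impI)
    fix n :: nat
    have "real n + r \<noteq> 0" using r by simp
    thus "of_nat n + (of_real r :: complex) \<noteq> 0" by (metis of_real_0 of_real_add of_real_eq_iff of_real_of_nat_eq)
  qed
  obtain \<tau>1 where t1: "\<tau>1 \<in> upper_half_plane" "?y \<tau>1 \<noteq> 0" using frob_sol_nonzero[OF nr] by blast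
  obtain C where C: "C > 0" "\<And>\<tau>. Im \<tau> > C \<Longrightarrow> norm (eval_fps (frob_fps (of_real r)) (qexp \<tau>) - 1) < 1 / 2"
    using frob_near_cusp[OF nr] by blast
  have ne: "norm (exp (of_real pi * \<i> * of_real r * \<tau>)) = exp (- (pi * r * Im \<tau>))" for \<tau>
    by simp
  have nle: "norm (?y \<tau>) \<le> 2 * exp (- (pi * r * Im \<tau>))" if "Im \<tau> > C" for \<tau>
  proof -
    have "norm (eval_fps (frob_fps (of_real r)) (qexp \<tau>)) \<le> 2"
      using C(2)[OF that] norm_triangle_sub[of "eval_fps (frob_fps (of_real r)) (qexp \<tau>)" 1] by simp
    thus ?thesis unfolding frob_sol_def norm_mult ne by simp
  qed
  show False
  proof (rule no_slash_eigenfunction[OF _ t1 S c])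
    show "?y holomorphic_on upper_half_plane" using lin_sol_frob_sol[OF nr] by (simp add: solves_def)
    show "norm (?y (\<tau> + of_int k)) = norm (?y \<tau>)" for \<tau> k
      unfolding frob_sol_plus_int norm_mult by simp
    show "\<exists>C. \<forall>\<tau>. Im \<tau> > C \<longrightarrow> norm (?y \<tau>) < e" if e: "e > 0" for e
    proof (intro exI[of _ "max C (- ln (e / 2) / (pi * r))"] allI impI)
      fix \<tau> assume t: "Im \<tau> > max C (- ln (e / 2) / (pi * r))"
      hence "pi * r * Im \<tau> > - ln (e / 2)" using r by (simp add: field_simps)
      hence "exp (- (pi * r * Im \<tau>)) < exp (ln (e / 2))" by (subst exp_less_cancel_iff) linarith
      hence "exp (- (pi * r * Im \<tau>)) < e / 2" using e by simp
      thus "norm (?y \<tau>) < e" using nle[of \<tau>] t by simp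
    qed
  qed
qed

section \<open>The finite matrix group for m at least 6\<close>

text \<open>The tuple (a, b, c, d) is the matrix with rows (a, b) and (c, d) that expresses the slash operator in
  the basis u, v. It is multiplicative in A, not anti-multiplicative, because slash is a right action.\<close>

definition slash_matrix :: "(complex \<Rightarrow> complex) \<Rightarrow> (complex \<Rightarrow> complex) \<Rightarrow> int ^ 2 ^ 2 \<Rightarrow>
    complex \<times> complex \<times> complex \<times> complex \<Rightarrow> bool" where
  "slash_matrix u v A = (\<lambda>(a, b, c, d). \<forall>\<tau>\<in>upper_half_plane.
      slash A u \<tau> = a * u \<tau> + b * v \<tau> \<and> slash A v \<tau> = c * u \<tau> + d * v \<tau>)"

text \<open>Abstract because integral r uses a solution and its S-translate where other r use the
  series for r and -r.\<close>

locale solution_basis =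
  fixes s u v
  assumes u: "lin_sol s u" and v: "lin_sol s v" and W: "wronskian u v \<i> \<noteq> 0"
begin

lemma W_const: "\<tau> \<in> upper_half_plane \<Longrightarrow> wronskian u v \<tau> = wronskian u v \<i>"
  by (rule wronskian_constant[OF u v open_H connected_H _ i_in_H])

lemma slash_matrix_exists:
  assumes "A \<in> SL2"
  shows "\<exists>a b c d. slash_matrix u v A (a, b, c, d)"
proof -
  obtain a b where "\<And>\<tau>. \<tau> \<in> upper_half_plane \<Longrightarrow> slash A u \<tau> = a * u \<tau> + b * v \<tau>"
    using solves_span[OF u v lin_sol_slash(1)[OF u assms] open_H connected_H i_in_H W] by blast
  moreover obtain c d where "\<And>\<tau>. \<tau> \<in> upper_half_plane \<Longrightarrow> slash A v \<tau> = c * u \<tau> + d * v \<tau>"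
    using solves_span[OF u v lin_sol_slash(1)[OF v assms] open_H connected_H i_in_H W] by blast
  ultimately show ?thesis by (auto simp: slash_matrix_def)
qed

lemma independent:
  assumes "\<And>\<tau>. \<tau> \<in> upper_half_plane \<Longrightarrow> a * u \<tau> + b * v \<tau> = a' * u \<tau> + b' * v \<tau>"
  shows "a = a'" "b = b'"
proof -
  define y where "y = (\<lambda>\<tau>. (a - a') * u \<tau> + (b - b') * v \<tau>)"
  have z: "y \<tau> = 0" if "\<tau> \<in> upper_half_plane" for \<tau> using assms[OF that] by (simp add: y_def algebra_simps)
  have "(y has_field_derivative 0) (at \<i>)"
    by (rule has_field_derivative_transform_within_open[OF DERIV_const open_H i_in_H]) (simp add: z)
  hence "deriv y \<i> = 0" by (rule DERIV_imp_deriv)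
  hence d: "(a - a') * deriv u \<i> + (b - b') * deriv v \<i> = 0"
    using solves_lincomb(2)[OF u v open_H i_in_H] by (simp add: y_def)
  have e: "(a - a') * u \<i> + (b - b') * v \<i> = 0" using z[OF i_in_H] by (simp add: y_def)
  have "(a - a') * wronskian u v \<i> = ((a - a') * u \<i> + (b - b') * v \<i>) * deriv v \<i> - ((a - a') * deriv u \<i> + (b - b') * deriv v \<i>) * v \<i>"
    by (simp add: wronskian_def algebra_simps)
  thus "a = a'" using d e W by simp
  have "(b - b') * wronskian u v \<i> = ((a - a') * deriv u \<i> + (b - b') * deriv v \<i>) * u \<i> - ((a - a') * u \<i> + (b - b') * v \<i>) * deriv u \<i>"
    by (simp add: wronskian_def algebra_simps)
  thus "b = b'" using d e W by simp
qed

lemma slash_matrix_unique: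
  assumes "slash_matrix u v A (a, b, c, d)" "slash_matrix u v A (a', b', c', d')"
  shows "(a, b, c, d) = (a', b', c', d')"
  using independent[of a b a' b'] independent[of c d c' d'] assms by (auto simp: slash_matrix_def)

lemma slash_matrix_mult:
  assumes A: "A \<in> SL2" "slash_matrix u v A (a, b, c, d)" and B: "B \<in> SL2" "slash_matrix u v B (a', b', c', d')"
  shows "slash_matrix u v (A ** B) (a * a' + b * c', a * b' + b * d', c * a' + d * c', c * b' + d * d')"
proof -
  have "slash (A ** B) y \<tau> = k * slash B u \<tau> + l * slash B v \<tau>"
    if "\<And>\<tau>. \<tau> \<in> upper_half_plane \<Longrightarrow> slash A y \<tau> = k * u \<tau> + l * v \<tau>" "\<tau> \<in> upper_half_plane" for y k l \<tau>
    using slash_mult[OF A(1) B(1) that(2)] slash_cong[OF B(1) that(2) that(1)] by (simp add: slash_lincomb)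
  thus ?thesis using A B by (auto simp: slash_matrix_def algebra_simps)
qed

text \<open>The Wronskian of two slashed solutions at tau is the original Wronskian at A tau,
  without any factor; as a nonzero constant it forces determinant 1.\<close>

lemma slash_matrix_det:
  assumes A: "A \<in> SL2" "slash_matrix u v A (a, b, c, d)"
  shows "a * d - b * c = 1"
proof -
  have AH: "mobius A \<i> \<in> upper_half_plane" by (rule mobius_in_H[OF A(1) i_in_H])
  have nz: "jfac A \<i> \<noteq> 0" by (rule jfac_nonzero[OF A(1) i_in_H])
  have der: "deriv (slash A y) \<i> = k * deriv u \<i> + l * deriv v \<i>"
    if "\<And>\<tau>. \<tau> \<in> upper_half_plane \<Longrightarrow> slash A y \<tau> = k * u \<tau> + l * v \<tau>" for y k l
  proof -
    have "eventually (\<lambda>z. z \<in> upper_half_plane) (nhds \<i>)" by (simp add: eventually_nhds_in_open)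
    hence "eventually (\<lambda>z. slash A y z = k * u z + l * v z) (nhds \<i>)" by eventually_elim (rule that)
    from deriv_cong_ev[OF this refl] show ?thesis using solves_lincomb(2)[OF u v open_H i_in_H] by simp
  qed
  have u': "slash A u \<i> = a * u \<i> + b * v \<i>" "deriv (slash A u) \<i> = a * deriv u \<i> + b * deriv v \<i>"
    and v': "slash A v \<i> = c * u \<i> + d * v \<i>" "deriv (slash A v) \<i> = c * deriv u \<i> + d * deriv v \<i>"
    using A(2) i_in_H by (auto simp: slash_matrix_def intro!: der)
  have "wronskian (slash A u) (slash A v) \<i> = (a * d - b * c) * wronskian u v \<i>"
    unfolding wronskian_def u' v' by (simp add: algebra_simps)
  moreover have "wronskian (slash A u) (slash A v) \<i> = wronskian u v (mobius A \<i>)"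
    unfolding wronskian_def lin_sol_slash(2)[OF u A(1) i_in_H] lin_sol_slash(2)[OF v A(1) i_in_H] slash_def
    using nz by (simp add: field_simps)
  ultimately have "(a * d - b * c) * wronskian u v \<i> = 1 * wronskian u v \<i>" using W_const[OF AH] by simp
  thus ?thesis using W by (simp only: mult_cancel_right) blast
qed

lemma slash_matrix_one: "slash_matrix u v (mat 1) (1, 0, 0, 1)"
  by (simp add: slash_matrix_def)

lemma slash_matrix_minus_one: "slash_matrix u v (- mat 1) (-1, 0, 0, -1)"
  by (simp add: slash_matrix_def)

lemma slash_matrix_adj2:
  assumes A: "A \<in> SL2" "slash_matrix u v A (a, b, c, d)"
  shows "slash_matrix u v (adj2 A) (d, - b, - c, a)"
proof -
  obtain a' b' c' d' where M: "slash_matrix u v (adj2 A) (a', b', c', d')" using slash_matrix_exists[OF adj2_SL2[OF A(1)]] by blast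
  have det: "a * d - b * c = 1" by (rule slash_matrix_det[OF A])
  have "slash_matrix u v (mat 1) (a * a' + b * c', a * b' + b * d', c * a' + d * c', c * b' + d * d')"
    using slash_matrix_mult[OF A adj2_SL2[OF A(1)] M] A by simp
  from slash_matrix_unique[OF this slash_matrix_one]
  have e: "a * a' + b * c' = 1" "a * b' + b * d' = 0" "c * a' + d * c' = 0" "c * b' + d * d' = 1" by auto
  have "a' = d * (a * a' + b * c') - b * (c * a' + d * c')" "b' = d * (a * b' + b * d') - b * (c * b' + d * d')"
    "c' = a * (c * a' + d * c') - c * (a * a' + b * c')" "d' = a * (c * b' + d * d') - c * (a * b' + b * d')"
    using arg_cong[OF det, of "\<lambda>x. a' * x"] arg_cong[OF det, of "\<lambda>x. b' * x"]
      arg_cong[OF det, of "\<lambda>x. c' * x"] arg_cong[OF det, of "\<lambda>x. d' * x"] by (simp_all add: algebra_simps)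
  hence "a' = d" "b' = - b" "c' = - c" "d' = a" unfolding e by simp_all
  thus ?thesis using M by simp
qed

definition "matrices = {M. \<exists>A\<in>SL2. slash_matrix u v A M}"

text \<open>An element of K acts as a scalar e with e^2 = 1 by the determinant, so a whole coset of
  K yields at most two matrices.\<close>

lemma finite_matrices:
  assumes fin: "finite (rcosets\<^bsub>SL2Z\<^esub> (scalar_group s))"
  shows "finite matrices"
proof -
  let ?K = "scalar_group s"
  define X where "X = (\<lambda>C. {M. \<exists>A\<in>C. slash_matrix u v A M})"
  have "matrices \<subseteq> (\<Union>C\<in>rcosets\<^bsub>SL2Z\<^esub> ?K. X C)"
  proof
    fix M assume "M \<in> matrices"
    then obtain A where A: "A \<in> SL2" "slash_matrix u v A M" by (auto simp: matrices_def)
    have "A \<in> ?K #>\<^bsub>SL2Z\<^esub> A" using normal_in_SL2D(7)[OF normal_in_SL2_scalar_group] unfolding r_coset_SL2Z by force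
    thus "M \<in> (\<Union>C\<in>rcosets\<^bsub>SL2Z\<^esub> ?K. X C)" using A by (auto simp: X_def RCOSETS_def)
  qed
  moreover have "finite (X C)" if C: "C \<in> rcosets\<^bsub>SL2Z\<^esub> ?K" for C
  proof -
    obtain B where B: "B \<in> SL2" "C = (\<lambda>k. k ** B) ` ?K" using C by (auto simp: RCOSETS_def r_coset_SL2Z)
    obtain a b c d where N: "slash_matrix u v B (a, b, c, d)" using slash_matrix_exists[OF B(1)] by blast
    have "X C \<subseteq> {(a, b, c, d), (- a, - b, - c, - d)}"
    proof
      fix M assume "M \<in> X C"
      then obtain k where k: "k \<in> ?K" "slash_matrix u v (k ** B) M" using B by (auto simp: X_def)
      then obtain e where kS: "k \<in> SL2" and e: "slash_matrix u v k (e, 0, 0, e)"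
        using u v by (auto simp: scalar_group_def slash_matrix_def)
      have "e * e = 1" using slash_matrix_det[OF kS e] by simp
      hence "e = 1 \<or> e = -1" by (simp add: square_eq_1_iff)
      moreover have "M = (e * a, e * b, e * c, e * d)"
        using slash_matrix_mult[OF kS e B(1) N] k(2) slash_matrix_unique by (cases M) simp
      ultimately show "M \<in> {(a, b, c, d), (- a, - b, - c, - d)}" by auto
    qed
    thus ?thesis using finite_subset by blast
  qed
  ultimately show ?thesis using fin finite_subset by blast
qed

end

text \<open>This is where m >= 6 enters: the angle is at most pi/3, whose cosine is 1/2. With a
  factor mu <= 1 the logistic map x -> mu x (1 - x) lowers every x in (0, 1).\<close>

lemma logistic_factor:
  fixes m :: nat
  assumes "m \<ge> 6"
  shows "0 < 2 * (1 - cos (2 * pi / real m))" "2 * (1 - cos (2 * pi / real m)) \<le> 1"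
proof -
  have m: "real m \<ge> 6" using assms by simp
  have l: "2 * pi / real m \<le> pi / 3" "2 * pi / real m > 0" using m pi_gt_zero by (auto simp: field_simps)
  have "cos (2 * pi / real m) \<ge> cos (pi / 3)"
    by (rule cos_monotone_0_pi_le) (use l pi_gt_zero in auto)
  thus "2 * (1 - cos (2 * pi / real m)) \<le> 1" by (simp add: cos_60)
  have "cos (2 * pi / real m) < cos 0"
    by (rule cos_monotone_0_pi) (use l pi_gt_zero in auto)
  thus "0 < 2 * (1 - cos (2 * pi / real m))" by simp
qed

text \<open>A finite group of matrices leaves a Hermitian form invariant. The form is diagonal because
  \<open>T\<close> acts diagonally, so that \<open>d\<close> is the conjugate of \<open>a\<close> for every matrix of the group.
  Conjugating \<open>T\<close> to the power \<open>j\<close> by a matrix with \<open>x = 1 - |a|\<^sup>2\<close> gives a matrix with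
  \<open>x' = \<mu> x (1 - x)\<close>, where \<open>\<mu> = 2 (1 - cos (2 pi / m)) \<le> 1\<close>.\<close>

context solution_basis
begin

lemma matrices_hermitian:
  assumes fin: "finite matrices" and l: "norm l = 1" "l * l \<noteq> 1"
    and T: "slash_matrix u v (Tmat 1) (l, 0, 0, inverse l)"
  shows "\<exists>p q. p > 0 \<and> q > 0 \<and> (\<forall>(a,b,c,d)\<in>matrices. d = cnj a \<and>
     of_real p * cnj a * a + of_real q * cnj c * c = (of_real p :: complex) \<and>
     of_real p * cnj a * b + of_real q * cnj c * d = 0)"
proof -
  \<comment> \<open>P, R, R', Q are the entries of G, the sum of M^H M over the group, with M^H the
    conjugate transpose.\<close>
  define P :: complex where "P = (\<Sum>(a,b,c,d)\<in>matrices. cnj a * a + cnj c * c)"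
  define Q :: complex where "Q = (\<Sum>(a,b,c,d)\<in>matrices. cnj b * b + cnj d * d)"
  define R :: complex where "R = (\<Sum>(a,b,c,d)\<in>matrices. cnj a * b + cnj c * d)"
  define R' :: complex where "R' = (\<Sum>(a,b,c,d)\<in>matrices. cnj b * a + cnj d * c)"
  have R'R: "R' = cnj R" unfolding R'_def R_def by (simp add: case_prod_unfold mult.commute)
  have one: "(1, 0, 0, 1) \<in> matrices" using slash_matrix_one by (auto simp: matrices_def intro!: bexI[of _ "mat 1"])
  \<comment> \<open>Right multiplication by B permutes the finite group, so B^H G B = G; two of the
    four entries are recorded.\<close>
  have inv: "P = P * (cnj a' * a') + R * (cnj a' * c') + R' * (cnj c' * a') + Q * (cnj c' * c') \<and>
     R = P * (cnj a' * b') + R * (cnj a' * d') + R' * (cnj c' * b') + Q * (cnj c' * d')"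
    if N: "slash_matrix u v B (a', b', c', d')" "B \<in> SL2" for B a' b' c' d'
  proof -
    let ?g = "\<lambda>(a, b, c, d). (a * a' + b * c', a * b' + b * d', c * a' + d * c', c * b' + d * d')"
    have det: "a' * d' - b' * c' = 1" by (rule slash_matrix_det[OF N(2,1)])
    have "?g ` matrices \<subseteq> matrices"
      using slash_matrix_mult[OF _ _ N(2,1)] N(2) by (fastforce simp: matrices_def)
    moreover have "inj_on ?g matrices"
    proof (rule inj_on_inverseI[where g = "\<lambda>(a, b, c, d). (a * d' - b * c', - a * b' + b * a', c * d' - d * c', - c * b' + d * a')"])
      fix M :: "complex \<times> complex \<times> complex \<times> complex"
      obtain a b c d where M: "M = (a, b, c, d)" by (cases M)
      have e: "x * (a' * d' - b' * c') = x" for x using det by simp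
      show "(\<lambda>(a, b, c, d). (a * d' - b * c', - a * b' + b * a', c * d' - d * c', - c * b' + d * a')) (?g M) = M"
        using e[of a] e[of b] e[of c] e[of d] by (simp add: M algebra_simps)
    qed
    ultimately have bij: "bij_betw ?g matrices matrices"
      using fin by (simp add: bij_betw_def endo_inj_surj)
    have re: "sum f matrices = sum (\<lambda>M. f (?g M)) matrices" for f :: "_ \<Rightarrow> complex"
      using sum.reindex_bij_betw[OF bij, of f] by simp
    have "P = (\<Sum>(a,b,c,d)\<in>matrices. cnj (a * a' + b * c') * (a * a' + b * c') + cnj (c * a' + d * c') * (c * a' + d * c'))"
      unfolding P_def by (subst re) (simp add: case_prod_unfold)
    also have "\<dots> = (\<Sum>(a,b,c,d)\<in>matrices. (cnj a * a + cnj c * c) * (cnj a' * a') + (cnj a * b + cnj c * d) * (cnj a' * c')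
       + (cnj b * a + cnj d * c) * (cnj c' * a') + (cnj b * b + cnj d * d) * (cnj c' * c'))"
      by (rule sum.cong) (auto simp: algebra_simps)
    also have "\<dots> = P * (cnj a' * a') + R * (cnj a' * c') + R' * (cnj c' * a') + Q * (cnj c' * c')"
      unfolding P_def Q_def R_def R'_def by (simp add: case_prod_unfold sum.distrib sum_distrib_right distrib_right)
    finally have 1: "P = P * (cnj a' * a') + R * (cnj a' * c') + R' * (cnj c' * a') + Q * (cnj c' * c')" .
    have "R = (\<Sum>(a,b,c,d)\<in>matrices. cnj (a * a' + b * c') * (a * b' + b * d') + cnj (c * a' + d * c') * (c * b' + d * d'))"
      unfolding R_def by (subst re) (simp add: case_prod_unfold)
    also have "\<dots> = (\<Sum>(a,b,c,d)\<in>matrices. (cnj a * a + cnj c * c) * (cnj a' * b') + (cnj a * b + cnj c * d) * (cnj a' * d')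
       + (cnj b * a + cnj d * c) * (cnj c' * b') + (cnj b * b + cnj d * d) * (cnj c' * d'))"
      by (rule sum.cong) (auto simp: algebra_simps)
    also have "\<dots> = P * (cnj a' * b') + R * (cnj a' * d') + R' * (cnj c' * b') + Q * (cnj c' * d')"
      unfolding P_def Q_def R_def R'_def by (simp add: case_prod_unfold sum.distrib sum_distrib_right distrib_right)
    finally show ?thesis using 1 by blast
  qed
  have li: "cnj l = inverse l"
  proof -
    have "l * cnj l = 1" using complex_norm_square[of l] l(1) by simp
    thus ?thesis by (metis inverse_unique)
  qed
  have l0: "l \<noteq> 0" using l by auto
  \<comment> \<open>Invariance under T multiplies the off-diagonal entry by l^-2, which is not 1, so
    it vanishes.\<close>
  have "R = R * (cnj l * inverse l)" using inv[OF T] by simp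
  hence "R * (l * l) = R" using l0 unfolding li by (simp add: field_simps)
  hence R0: "R = 0" using l(2) by simp
  define p where "p = (\<Sum>(a,b,c,d)\<in>matrices. (norm a)\<^sup>2 + (norm c)\<^sup>2)"
  define q where "q = (\<Sum>(a,b,c,d)\<in>matrices. (norm b)\<^sup>2 + (norm d)\<^sup>2)"
  have nn: "cnj z * z = of_real ((norm z)\<^sup>2)" for z :: complex
    by (metis complex_norm_square mult.commute of_real_power)
  have pP: "of_real p = P" unfolding p_def P_def by (simp add: case_prod_unfold nn)
  have qQ: "of_real q = Q" unfolding q_def Q_def by (simp add: case_prod_unfold nn)
  have "p \<ge> (\<lambda>(a::complex,b::complex,c::complex,d::complex). (norm a)\<^sup>2 + (norm c)\<^sup>2) (1, 0, 0, 1)"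
    unfolding p_def by (rule member_le_sum[OF one _ fin]) auto
  hence p0: "p > 0" by simp
  have "q \<ge> (\<lambda>(a::complex,b::complex,c::complex,d::complex). (norm b)\<^sup>2 + (norm d)\<^sup>2) (1, 0, 0, 1)"
    unfolding q_def by (rule member_le_sum[OF one _ fin]) auto
  hence q0: "q > 0" by simp
  have "d = cnj a \<and> P * cnj a * a + Q * cnj c * c = P \<and> P * cnj a * b + Q * cnj c * d = 0"
    if M: "(a, b, c, d) \<in> matrices" for a b c d
  proof -
    obtain B where B: "B \<in> SL2" "slash_matrix u v B (a, b, c, d)" using M by (auto simp: matrices_def)
    have e: "P * cnj a * a + Q * cnj c * c = P" "P * cnj a * b + Q * cnj c * d = 0"
      using inv[OF B(2,1)] R0 R'R by (simp_all add: mult_ac)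
    have det: "a * d - b * c = 1" by (rule slash_matrix_det[OF B])
    \<comment> \<open>The upper left entry of B^H G = G B^-1, with B^-1 written as the
      adjugate.\<close>
    have "P * d = (P * cnj a * a + Q * cnj c * c) * d - (P * cnj a * b + Q * cnj c * d) * c" unfolding e by simp
    also have "\<dots> = P * cnj a * (a * d - b * c)" by (simp add: algebra_simps)
    finally have "P * d = P * cnj a" unfolding det by simp
    moreover have "P \<noteq> 0" using pP p0 by auto
    ultimately show ?thesis using e by simp
  qed
  thus ?thesis using p0 q0 unfolding pP[symmetric] qQ[symmetric] by blast
qed

lemma finite_index_imp_slash_eigenfunction:
  fixes m :: nat and k :: int
  assumes fin: "finite matrices" and l: "norm l = 1" and m: "m \<ge> 6"
    and lk: "l powi (2 * k) = cis (2 * pi / real m)"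
    and T: "\<And>j. slash_matrix u v (Tmat j) (l powi j, 0, 0, inverse (l powi j))"
  shows "\<exists>c. norm c = 1 \<and> (\<forall>\<tau>\<in>upper_half_plane. slash Smat u \<tau> = c * u \<tau>)"
proof -
  define \<mu> where "\<mu> = 2 * (1 - cos (2 * pi / real m))"
  have mu: "0 < \<mu>" "\<mu> \<le> 1" unfolding \<mu>_def by (rule logistic_factor[OF m])+
  have l2: "l * l \<noteq> 1"
  proof
    assume "l * l = 1"
    hence "l powi (2 * k) = 1" by (simp add: power_int_mult power2_eq_square[symmetric])
    hence "cos (2 * pi / real m) = 1" using lk by (metis cis.sel(1) one_complex.sel(1))
    thus False using mu by (simp add: \<mu>_def)
  qed
  have T1: "slash_matrix u v (Tmat 1) (l, 0, 0, inverse l)" using T[of 1] by simp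
  obtain p q where pq: "p > 0" "q > 0" and M: "\<And>a b c d. (a,b,c,d) \<in> matrices \<Longrightarrow> d = cnj a \<and>
     of_real p * cnj a * a + of_real q * cnj c * c = (of_real p :: complex) \<and>
     of_real p * cnj a * b + of_real q * cnj c * d = 0"
    using matrices_hermitian[OF fin l l2 T1] by fast
  have nn: "cnj z * z = of_real ((norm z)\<^sup>2)" for z :: complex
    by (metis complex_norm_square mult.commute of_real_power)
  have norms: "p * (norm a)\<^sup>2 + q * (norm c)\<^sup>2 = p" if "(a,b,c,d) \<in> matrices" for a b c d
  proof -
    have "of_real (p * (norm a)\<^sup>2 + q * (norm c)\<^sup>2) = (of_real p :: complex)"
      using M[OF that] by (simp add: mult.assoc nn del: of_real_power) 
    thus ?thesis by (simp only: of_real_eq_iff)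
  qed
  have le1: "(norm a)\<^sup>2 \<le> 1" if "(a,b,c,d) \<in> matrices" for a b c d
  proof -
    have "p * (norm a)\<^sup>2 \<le> p * 1" using norms[OF that] pq(2) by (smt (verit) mult_nonneg_nonneg zero_le_power2)
    thus ?thesis using pq(1) by (subst (asm) mult_le_cancel_left_pos) auto
  qed
  \<comment> \<open>In terms of rotations, x is sin^2 of half the angle between the axis of T and
    its image: 0 if the axis is kept, 1 if it is reversed.\<close>
  define x :: "complex \<times> complex \<times> complex \<times> complex \<Rightarrow> real" where "x = (\<lambda>(a,b,c,d). 1 - (norm a)\<^sup>2)"
  have step: "\<exists>M'\<in>matrices. x M' = \<mu> * x M * (1 - x M)" if M0: "M \<in> matrices" for M
  proof -
    obtain a b c d where Me: "M = (a, b, c, d)" by (cases M)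
    obtain B where B: "B \<in> SL2" "slash_matrix u v B (a, b, c, d)" using M0 by (auto simp: matrices_def Me)
    define w where "w = l powi k"
    have da: "d = cnj a" using M M0 Me by blast
    have bc: "b * c = - of_real (x M)" "a * d = of_real (1 - x M)"
    proof -
      show ad: "a * d = of_real (1 - x M)" using nn[of a] by (simp add: da x_def Me mult.commute)
      have "b * c = a * d - 1" using slash_matrix_det[OF B] by (simp add: algebra_simps)
      thus "b * c = - of_real (x M)" unfolding ad by simp
    qed
    have "slash_matrix u v (B ** Tmat k) (a * w, b * inverse w, c * w, d * inverse w)"
      using slash_matrix_mult[OF B Tmat_SL2 T[of k]] by (simp add: w_def)
    from slash_matrix_mult[OF _ this adj2_SL2[OF B(1)] slash_matrix_adj2[OF B]]
    have N: "slash_matrix u v (B ** Tmat k ** adj2 B)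
       (a * w * d + b * inverse w * (- c), a * w * (- b) + b * inverse w * a, c * w * d + d * inverse w * (- c), c * w * (- b) + d * inverse w * a)"
      (is "slash_matrix _ _ _ ?N") using B by simp
    have NX: "?N \<in> matrices" using N B by (auto simp: matrices_def)
    have w1: "norm w = 1" using l by (simp add: w_def norm_power_int)
    have wi: "inverse w = cnj w"
    proof -
      have "w * cnj w = 1" using w1 nn[of w] by (simp add: mult.commute)
      thus ?thesis by (metis inverse_unique)
    qed
    have Re2: "(Re w)\<^sup>2 - (Im w)\<^sup>2 = cos (2 * pi / real m)"
    proof -
      have "w * w = cis (2 * pi / real m)" using lk by (simp add: w_def power_int_mult power2_eq_square mult.commute)
      hence "Re (w * w) = cos (2 * pi / real m)" by simp
      thus ?thesis by (simp add: power2_eq_square)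
    qed
    have w12: "(Re w)\<^sup>2 + (Im w)\<^sup>2 = 1" using w1 by (simp add: cmod_def)
    have "a * w * d + b * inverse w * (- c) = w * (a * d) - inverse w * (b * c)" by (simp add: algebra_simps)
    also have "\<dots> = w * of_real (1 - x M) + cnj w * of_real (x M)" unfolding bc wi by simp
    finally have a': "a * w * d + b * inverse w * (- c) = w * of_real (1 - x M) + cnj w * of_real (x M)" .
    have "(norm (w * of_real (1 - x M) + cnj w * of_real (x M)))\<^sup>2 = (Re w)\<^sup>2 + ((1 - 2 * x M) * Im w)\<^sup>2"
      by (simp add: cmod_power2) (simp add: algebra_simps)
    also have "\<dots> = (Re w)\<^sup>2 + (Im w)\<^sup>2 - 4 * x M * (1 - x M) * (Im w)\<^sup>2"
      by (simp add: power_mult_distrib power2_eq_square algebra_simps)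
    finally have n1: "(norm (w * of_real (1 - x M) + cnj w * of_real (x M)))\<^sup>2 = 1 - 4 * x M * (1 - x M) * (Im w)\<^sup>2"
      unfolding w12 .
    have im: "(Im w)\<^sup>2 = (1 - cos (2 * pi / real m)) / 2" unfolding Re2[symmetric] using w12 by (simp add: field_simps)
    have "x ?N = 1 - (norm (a * w * d + b * inverse w * (- c)))\<^sup>2" by (simp only: x_def prod.case)
    also have "\<dots> = 4 * x M * (1 - x M) * (Im w)\<^sup>2" unfolding a' n1 by simp
    also have "\<dots> = \<mu> * x M * (1 - x M)" unfolding im \<mu>_def by (simp add: field_simps)
    finally have "x ?N = \<mu> * x M * (1 - x M)" .
    thus ?thesis using NX by blast
  qed
  \<comment> \<open>The least x in (0, 1) would be lowered by the logistic step and still be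
    positive.\<close>
  have x01: "x M = 0 \<or> x M = 1" if M0: "M \<in> matrices" for M
  proof (rule ccontr)
    assume neg: "\<not> ?thesis"
    have rng: "0 \<le> x M \<and> x M \<le> 1" if "M \<in> matrices" for M
      using le1 that by (cases M) (auto simp: x_def)
    define Y where "Y = {M \<in> matrices. 0 < x M \<and> x M < 1}"
    have Y: "finite Y" "M \<in> Y" using fin neg rng[OF M0] M0 by (auto simp: Y_def)
    obtain M1 where M1: "M1 \<in> Y" "\<And>M'. M' \<in> Y \<Longrightarrow> x M1 \<le> x M'"
      using ex_min_if_finite[of "x ` Y"] Y by (metis (no_types, lifting) Y(1) Y(2) arg_min_if_finite(1) arg_min_least empty_iff)
    have "M1 \<in> matrices" using M1(1) by (simp add: Y_def)
    from step[OF this] obtain M2 where M2: "M2 \<in> matrices" "x M2 = \<mu> * x M1 * (1 - x M1)" by blast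
    have x1: "0 < x M1" "x M1 < 1" using M1 by (auto simp: Y_def)
    have "\<mu> * x M1 \<le> x M1" using mu x1 by simp
    hence "\<mu> * x M1 * (1 - x M1) \<le> x M1 * (1 - x M1)" using x1 by (intro mult_right_mono) auto
    also have "\<dots> < x M1 * 1" using x1 by (intro mult_strict_left_mono) auto
    finally have "x M2 < x M1" using M2 by simp
    moreover have "0 < x M2" unfolding M2(2) using mu x1 by simp
    ultimately show False using M1(2)[of M2] M2(1) x1 by (auto simp: Y_def)
  qed
  obtain a b c d where Sm: "slash_matrix u v Smat (a, b, c, d)" using slash_matrix_exists[OF Smat_SL2] by blast
  have SX: "(a, b, c, d) \<in> matrices" using Sm by (auto simp: matrices_def)
  \<comment> \<open>Otherwise S, and with it S T, would be antidiagonal. The cube of an antidiagonal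
    matrix is antidiagonal, but (S T)^3 = -1.\<close>
  have "x (a, b, c, d) \<noteq> 1"
  proof
    assume "x (a, b, c, d) = 1"
    hence a0: "a = 0" by (simp add: x_def)
    hence d0: "d = 0" using M[OF SX] by simp
    have bc: "- (b * c) = 1" using slash_matrix_det[OF Smat_SL2 Sm] a0 by simp
    define U where "U = Smat ** Tmat 1"
    have U: "U \<in> SL2" by (simp add: U_def)
    have UM: "slash_matrix u v U (0, b * inverse l, c * l, 0)"
      using slash_matrix_mult[OF Smat_SL2 Sm Tmat_SL2 T1] a0 d0 by (simp add: U_def)
    from slash_matrix_mult[OF U UM U UM] have "slash_matrix u v (U ** U) ((b * inverse l) * (c * l), 0, 0, (c * l) * (b * inverse l))" by simp
    from slash_matrix_mult[OF SL2_mult[OF U U] this U UM]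
    have "slash_matrix u v (U ** U ** U) (0, (b * inverse l) * (c * l) * (b * inverse l), (c * l) * (b * inverse l) * (c * l), 0)" by simp
    moreover have "U ** U ** U = - mat 1" by (rule mat2_eqI) (simp_all add: U_def Smat_def Tmat_def)
    ultimately show False using slash_matrix_unique[OF slash_matrix_minus_one] by fastforce
  qed
  hence "x (a, b, c, d) = 0" using x01[OF SX] by blast
  hence na: "(norm a)\<^sup>2 = 1" by (simp add: x_def)
  hence "q * (norm c)\<^sup>2 = 0" using norms[OF SX] by simp
  hence c0: "c = 0" using pq by simp
  have a0: "a \<noteq> 0" using na by auto
  have "b = 0" using M[OF SX] c0 pq a0 by simp
  hence "\<forall>\<tau>\<in>upper_half_plane. slash Smat u \<tau> = a * u \<tau>" using Sm by (simp add: slash_matrix_def)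
  moreover have "norm a = 1" using na norm_ge_zero[of a] by (auto simp: power2_eq_1_iff)
  ultimately show ?thesis by blast
qed

end

section \<open>The theorem\<close>

lemma modular_solution_Tmat:
  assumes u: "lin_sol s u" and v: "lin_sol s v" and W: "wronskian u v \<i> \<noteq> 0"
    and mod: "\<And>h. schwarz_solution s h \<Longrightarrow> modular_function h"
  shows "finite (rcosets\<^bsub>SL2Z\<^esub> (scalar_group s))"
    "\<exists>N::nat. N > 0 \<and> Tmat (int N) \<in> scalar_group s"
proof -
  have "modular_function (\<lambda>\<tau>. u \<tau> / v \<tau>)"
    by (intro mod quotient_schwarz_solution[OF u v i_in_H W])
  moreover have "invariance_group (\<lambda>\<tau>. u \<tau> / v \<tau>) = scalar_group s"
    by (rule invariance_group_eq_scalar_group[OF u v W refl])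
  ultimately show fin: "finite (rcosets\<^bsub>SL2Z\<^esub> (scalar_group s))" by (simp add: modular_function_def)
  show "\<exists>N::nat. N > 0 \<and> Tmat (int N) \<in> scalar_group s"
    using finite_rcosets_imp_Tmat_power[OF normal_in_SL2_scalar_group fin] by blast
qed

lemma Tmat_1_notin_scalar_group:
  assumes "lin_sol s u" "lin_sol s v" "wronskian u v \<i> \<noteq> 0"
  shows "Tmat 1 \<notin> scalar_group s"
  using Tmat_1_imp_Smat[OF normal_in_SL2_scalar_group] elliptic_notin_scalar_group[OF assms, of 0] by auto

text \<open>In the basis 1, tau the scalar of T^N would have to be 1, yet T^N moves tau.\<close>

lemma not_all_modular_0:
  assumes mod: "\<And>h. schwarz_solution 0 h \<Longrightarrow> modular_function h"
  shows False
proof -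
  have u: "lin_sol 0 (\<lambda>\<tau>. \<tau>)" and v: "lin_sol 0 (\<lambda>\<tau>. 1)"
    by (rule solvesI(1)[OF open_H, where y' = "\<lambda>_. 1"]; auto intro!: derivative_eq_intros)
       (rule solvesI(1)[OF open_H, where y' = "\<lambda>_. 0"]; auto intro!: derivative_eq_intros)
  have W: "wronskian (\<lambda>\<tau>. \<tau>) (\<lambda>\<tau>. 1) \<i> \<noteq> 0" by (simp add: wronskian_def)
  obtain N :: nat where N: "N > 0" "Tmat (int N) \<in> scalar_group 0"
    using modular_solution_Tmat(2)[OF u v W mod] by blast
  then obtain c where c: "\<And>y \<tau>. lin_sol 0 y \<Longrightarrow> \<tau> \<in> upper_half_plane \<Longrightarrow> slash (Tmat (int N)) y \<tau> = c * y \<tau>"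
    by (auto simp: scalar_group_def)
  have "c = 1" using c[OF v i_in_H] by simp
  thus False using c[OF u i_in_H] N(1) by simp
qed

lemma nonresonant_of_nat: "nonresonant (of_nat k)"
  unfolding nonresonant_def by (metis of_nat_0 of_nat_add of_nat_eq_iff add_is_0 less_irrefl)

text \<open>T acts on the basis u, v by a triangular matrix with equal diagonal entries l = 1 or -1.
  The off-diagonal entry c of T grows to N c, up to sign, in T^N; a scalar T^N therefore forces c =
  0, and T itself would be scalar.\<close>

lemma not_all_modular_integer:
  assumes k: "k > (0::nat)" and mod: "\<And>h. schwarz_solution (2 * of_real pi ^ 2 * (of_nat k)\<^sup>2) h \<Longrightarrow> modular_function h"
  shows False
proof -
  let ?s = "2 * of_real pi ^ 2 * (of_nat k)\<^sup>2 :: complex"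
  define u where "u = frob_sol (of_nat k)"
  define v where "v = slash Smat u"
  have u: "lin_sol ?s u" unfolding u_def by (rule lin_sol_frob_sol[OF nonresonant_of_nat])
  have v: "lin_sol ?s v" unfolding v_def by (rule lin_sol_slash(1)[OF u Smat_SL2])
  obtain t1 where t1: "t1 \<in> upper_half_plane" "u t1 \<noteq> 0"
    using frob_sol_nonzero[OF nonresonant_of_nat] unfolding u_def by blast
  have SS: "slash Smat v \<tau> = - u \<tau>" if t: "\<tau> \<in> upper_half_plane" for \<tau>
  proof -
    have "Smat ** Smat = - mat 1" by (rule mat2_eqI) (simp_all add: Smat_def)
    thus ?thesis using slash_mult[OF Smat_SL2 Smat_SL2 t, of u] by (simp add: v_def)
  qed
  \<comment> \<open>If v = c u, applying S once more gives c^2 = -1. Then |c| = 1 and u is an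
    eigenfunction of S, which \<open>frob_sol_not_slash_eigenfunction\<close> forbids.\<close>
  have W: "wronskian u v \<i> \<noteq> 0"
  proof
    assume "wronskian u v \<i> = 0"
    hence "wronskian v u \<i> = 0" by (simp add: wronskian_def mult.commute)
    then obtain c where c: "\<And>\<tau>. \<tau> \<in> upper_half_plane \<Longrightarrow> v \<tau> = c * u \<tau>"
      using wronskian_zero_imp_dependent[OF v u open_H connected_H i_in_H _ t1] by blast
    have "slash Smat v t1 = slash Smat (\<lambda>\<tau>. c * u \<tau> + 0 * u \<tau>) t1"
      by (rule slash_cong[OF Smat_SL2 t1(1)]) (simp add: c)
    hence "- u t1 = c * v t1" using SS[OF t1(1)] by (simp only: slash_lincomb v_def) simp
    hence "c * c = -1" using c[OF t1(1)] t1(2)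
      by (metis mult.assoc mult_cancel_right mult_minus1)
    hence "norm (c * c) = 1" by simp
    hence "norm c = 1" by (simp add: norm_mult square_eq_1_iff) (metis abs_norm_cancel abs_1 abs_minus_cancel)
    moreover have "slash Smat (frob_sol (of_real (real k))) \<tau> = c * frob_sol (of_real (real k)) \<tau>" if "\<tau> \<in> upper_half_plane" for \<tau>
      using c[OF that] by (simp add: u_def v_def)
    ultimately show False using frob_sol_not_slash_eigenfunction[of "real k" c] k by simp
  qed
  interpret solution_basis ?s u v by unfold_locales (rule u v W)+
  define l where "l = exp (of_real pi * \<i> * of_nat k)"
  have l0: "l \<noteq> 0" by (simp add: l_def)
  have uT: "u (\<tau> + of_int j) = l powi j * u \<tau>" for \<tau> j
  proof -
    have "exp (of_real pi * \<i> * of_nat k * of_int j) = l powi j" 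
      unfolding l_def by (simp add: exp_power_int mult.commute)
    thus ?thesis unfolding u_def frob_sol_plus_int by simp
  qed
  obtain a0 b0 c d where M: "slash_matrix u v (Tmat 1) (a0, b0, c, d)" using slash_matrix_exists[OF Tmat_SL2] by blast
  have e1: "a0 * u \<tau> + b0 * v \<tau> = l * u \<tau> + 0 * v \<tau>" if "\<tau> \<in> upper_half_plane" for \<tau>
    using M uT[of \<tau> 1] that by (simp add: slash_matrix_def)
  have "a0 = l" "b0 = 0" using independent[OF e1] by blast+
  hence d: "d = inverse l" using slash_matrix_det[OF Tmat_SL2 M] l0 by (simp add: field_simps)
  have ll: "l * l = 1"
  proof -
    have "l * l = exp (of_int (2 * int k) * (of_real pi * \<i>))" by (simp add: l_def algebra_simps flip: exp_add)
    also have "\<dots> = 1" by (subst exp_eq_1) (auto intro!: exI[of _ "int k"])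
    finally show ?thesis .
  qed
  have dl: "d = l" using inverse_unique[OF ll] d by simp
  have vT: "v (\<tau> + 1) = c * u \<tau> + l * v \<tau>" if "\<tau> \<in> upper_half_plane" for \<tau>
    using M that dl by (auto simp: slash_matrix_def)
  have vTn: "v (\<tau> + of_nat n) = l ^ n * v \<tau> + of_nat n * l ^ (n + 1) * c * u \<tau>" if t: "\<tau> \<in> upper_half_plane" for \<tau> n
  proof (induction n)
    case (Suc n)
    have tn: "\<tau> + of_nat n \<in> upper_half_plane" using t by (simp add: in_H_iff)
    have un: "u (\<tau> + of_nat n) = l ^ n * u \<tau>" using uT[of \<tau> "int n"] by simp
    have lll: "l ^ n = l ^ n * l * l" using ll by (simp add: mult.assoc)
    have "v (\<tau> + of_nat (Suc n)) = c * u (\<tau> + of_nat n) + l * v (\<tau> + of_nat n)"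
      using vT[OF tn] by (simp add: add_ac)
    also have "\<dots> = c * (l ^ n * l * l) * u \<tau> + l * (l ^ n * v \<tau> + of_nat n * l ^ (n + 1) * c * u \<tau>)"
      unfolding Suc un lll[symmetric] by (simp only: mult.assoc)
    finally show ?case by (simp add: algebra_simps)
  qed simp
  obtain N :: nat where N: "N > 0" "Tmat (int N) \<in> scalar_group ?s"
    using modular_solution_Tmat(2)[OF u v W mod] by blast
  then obtain e where e: "\<And>y \<tau>. lin_sol ?s y \<Longrightarrow> \<tau> \<in> upper_half_plane \<Longrightarrow> slash (Tmat (int N)) y \<tau> = e * y \<tau>"
    by (auto simp: scalar_group_def)
  have "of_nat N * l ^ (N + 1) * c = 0"
  proof (rule independent(1)[of _ "l ^ N" _ e])
    fix \<tau> assume t: "\<tau> \<in> upper_half_plane"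
    show "of_nat N * l ^ (N + 1) * c * u \<tau> + l ^ N * v \<tau> = 0 * u \<tau> + e * v \<tau>"
      using e[OF v t] vTn[OF t, of N] by (simp add: add.commute)
  qed
  hence c0: "c = 0" using N(1) l0 by simp
  have T1: "slash (Tmat 1) y \<tau> = l * y \<tau>" if y: "lin_sol ?s y" and t: "\<tau> \<in> upper_half_plane" for y \<tau>
  proof -
    obtain a b where ab: "\<And>\<tau>. \<tau> \<in> upper_half_plane \<Longrightarrow> y \<tau> = a * u \<tau> + b * v \<tau>"
      using solves_span[OF u v y open_H connected_H i_in_H W] by blast
    have t1: "\<tau> + 1 \<in> upper_half_plane" using t by (simp add: in_H_iff)
    show ?thesis using ab[OF t] ab[OF t1] vT[OF t] uT[of \<tau> 1] c0 by (simp add: algebra_simps)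
  qed
  hence "Tmat 1 \<in> scalar_group ?s" by (auto simp: scalar_group_def)
  thus False using Tmat_1_notin_scalar_group[OF u v W] by blast
qed

lemma frob_basis:
  assumes "exp (2 * of_real pi * \<i> * r) \<noteq> 1"
  shows "nonresonant r" "nonresonant (- r)" "solution_basis (2 * of_real pi ^ 2 * r\<^sup>2) (frob_sol r) (frob_sol (- r))"
proof -
  have nz: "of_int k \<noteq> r" for k
  proof
    assume "of_int k = r"
    hence "exp (2 * of_real pi * \<i> * r) = exp (of_int (2 * k) * (of_real pi * \<i>))" by (auto simp: algebra_simps)
    also have "\<dots> = 1" by (subst exp_eq_1) (auto intro!: exI[of _ k])
    finally show False using assms by simp
  qed
  show r: "nonresonant r" "nonresonant (- r)"
    unfolding nonresonant_def using nz[of "- int n" for n] nz[of "int n" for n]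
    by (auto simp: add_eq_0_iff)
  show "solution_basis (2 * of_real pi ^ 2 * r\<^sup>2) (frob_sol r) (frob_sol (- r))"
    using lin_sol_frob_sol[OF r(1)] lin_sol_frob_sol[OF r(2)] frob_wronskian[OF r assms i_in_H]
    by unfold_locales simp_all
qed

text \<open>T^j is diagonal in the Frobenius basis, with entries e^(pi i r j) and its inverse; it is
  scalar exactly when their quotient is 1.\<close>

lemma Tmat_in_scalar_group_iff:
  assumes r: "exp (2 * of_real pi * \<i> * r) \<noteq> 1"
  shows "Tmat j \<in> scalar_group (2 * of_real pi ^ 2 * r\<^sup>2) \<longleftrightarrow> exp (2 * of_real pi * \<i> * r * of_int j) = 1"
proof -
  interpret solution_basis "2 * of_real pi ^ 2 * r\<^sup>2" "frob_sol r" "frob_sol (- r)" by (rule frob_basis(3)[OF r])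
  define l where "l = exp (of_real pi * \<i> * r * of_int j)"
  have l0: "l \<noteq> 0" by (simp add: l_def)
  have ll: "l * l = exp (2 * of_real pi * \<i> * r * of_int j)" by (simp add: l_def algebra_simps flip: exp_add)
  have sh: "frob_sol r (\<tau> + of_int j) = l * frob_sol r \<tau>" "frob_sol (- r) (\<tau> + of_int j) = inverse l * frob_sol (- r) \<tau>" for \<tau>
    unfolding frob_sol_plus_int l_def by (simp_all add: exp_minus)
  show ?thesis
  proof
    assume "Tmat j \<in> scalar_group (2 * of_real pi ^ 2 * r\<^sup>2)"
    then obtain c where c: "\<And>y \<tau>. lin_sol (2 * of_real pi ^ 2 * r\<^sup>2) y \<Longrightarrow> \<tau> \<in> upper_half_plane \<Longrightarrow> slash (Tmat j) y \<tau> = c * y \<tau>"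
      by (auto simp: scalar_group_def)
    have "l = c" by (rule independent(1)[of l 0 c 0]) (use c[OF u] sh in simp)
    moreover have "inverse l = c" by (rule independent(2)[of 0 "inverse l" 0 c]) (use c[OF v] sh in simp)
    ultimately have "l * l = 1" using l0 by (metis left_inverse)
    thus "exp (2 * of_real pi * \<i> * r * of_int j) = 1" using ll by simp
  next
    assume "exp (2 * of_real pi * \<i> * r * of_int j) = 1"
    hence il: "inverse l = l" using ll l0 by (simp add: field_simps)
    have "slash (Tmat j) y \<tau> = l * y \<tau>" if y: "lin_sol (2 * of_real pi ^ 2 * r\<^sup>2) y" and t: "\<tau> \<in> upper_half_plane" for y \<tau>
    proof -
      obtain a b where ab: "\<And>\<tau>. \<tau> \<in> upper_half_plane \<Longrightarrow> y \<tau> = a * frob_sol r \<tau> + b * frob_sol (- r) \<tau>"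
        using solves_span[OF u v y open_H connected_H i_in_H W] by blast
      have t1: "\<tau> + of_int j \<in> upper_half_plane" using t by (simp add: in_H_iff)
      show ?thesis using ab[OF t] ab[OF t1] sh[of \<tau>] il by (simp add: algebra_simps)
    qed
    thus "Tmat j \<in> scalar_group (2 * of_real pi ^ 2 * r\<^sup>2)" by (auto simp: scalar_group_def)
  qed
qed

lemma exp_2pi_i_rational_eq_1_iff:
  fixes m n :: nat
  assumes m: "m > 0" and cop: "coprime m n"
  shows "exp (2 * of_real pi * \<i> * of_real (real n / real m) * of_int j) = 1 \<longleftrightarrow> int m dvd j"
proof -
  have "exp (2 * of_real pi * \<i> * of_real (real n / real m) * of_int j) = 1 \<longleftrightarrow>
      (\<exists>k::int. 2 * pi * (real n / real m) * of_int j = of_int (2 * k) * pi)"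
    by (subst exp_eq_1) simp
  also have "\<dots> \<longleftrightarrow> (\<exists>k::int. int n * j = k * int m)"
  proof (rule iff_exI)
    fix k :: int
    have "2 * pi * (real n / real m) * of_int j = of_int (2 * k) * pi \<longleftrightarrow> real_of_int (int n * j) = real_of_int (k * int m)"
      using m by (simp add: field_simps)
    thus "2 * pi * (real n / real m) * of_int j = of_int (2 * k) * pi \<longleftrightarrow> int n * j = k * int m"
      by (simp only: of_int_eq_iff)
  qed
  also have "\<dots> \<longleftrightarrow> int m dvd int n * j" by (auto simp: dvd_def mult.commute)
  also have "\<dots> \<longleftrightarrow> int m dvd j" using cop by (simp add: coprime_dvd_mult_right_iff)
  finally show ?thesis .
qed

lemma order_at_most_5:
  fixes m n :: nat
  assumes mn: "m > 0" "n > 0" "coprime m n"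
    and fin: "finite (rcosets\<^bsub>SL2Z\<^esub> (scalar_group (2 * of_real pi ^ 2 * (of_real (real n / real m))\<^sup>2)))"
  shows "m \<le> 5"
proof (rule ccontr)
  assume "\<not> ?thesis"
  hence m6: "m \<ge> 6" by simp
  define r :: real where "r = real n / real m"
  have r0: "r > 0" using mn by (simp add: r_def)
  have ne: "exp (2 * of_real pi * \<i> * of_real r) \<noteq> 1"
    using exp_2pi_i_rational_eq_1_iff[OF mn(1,3), of 1] m6 by (simp add: r_def)
  interpret solution_basis "2 * of_real pi ^ 2 * (of_real r)\<^sup>2" "frob_sol (of_real r)" "frob_sol (- of_real r)"
    by (rule frob_basis(3)[OF ne])
  have finM: "finite matrices" using fin by (intro finite_matrices) (simp add: r_def)
  define l where "l = exp (of_real pi * \<i> * of_real r)"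
  have l1: "norm l = 1" by (simp add: l_def)
  have lj: "exp (of_real pi * \<i> * of_real r * of_int j) = l powi j" for j
    unfolding l_def by (simp add: exp_power_int mult.commute)
  have T: "slash_matrix (frob_sol (of_real r)) (frob_sol (- of_real r)) (Tmat j) (l powi j, 0, 0, inverse (l powi j))" for j
    unfolding slash_matrix_def by (auto simp: frob_sol_plus_int lj[symmetric] exp_minus)
  \<comment> \<open>With n k = 1 mod m the power T^k rotates by the smallest angle 2 pi / m, whereas
    T rotates by 2 pi n / m.\<close>
  have "coprime (int n) (int m)" using mn by (simp add: coprime_commute)
  then obtain k where k: "[int n * k = 1] (mod int m)" using cong_solve_coprime_int by blast
  then obtain t where t: "int n * k = 1 + int m * t" by (metis cong_iff_lin add.commute cong_sym mult.commute)
  have "l powi (2 * k) = exp (of_real pi * \<i> * of_real r * of_int (2 * k))" unfolding lj ..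
  also have "of_real pi * \<i> * of_real r * of_int (2 * k) = \<i> * of_real (2 * pi * (r * of_int k))" by simp
  also have "r * of_int k = real_of_int (int n * k) / real m" by (simp add: r_def)
  also have "\<dots> = 1 / real m + of_int t" unfolding t using mn(1) by (simp add: field_simps)
  also have "exp (\<i> * of_real (2 * pi * (1 / real m + of_int t))) = cis (2 * pi / real m + 2 * pi * of_int t)"
    by (simp add: cis_conv_exp algebra_simps)
  also have "\<dots> = cis (2 * pi / real m)" by (simp add: cis_mult[symmetric] cis_multiple_2pi)
  finally have lk: "l powi (2 * k) = cis (2 * pi / real m)" .
  obtain c where c: "norm c = 1" "\<forall>\<tau>\<in>upper_half_plane. slash Smat (frob_sol (of_real r)) \<tau> = c * frob_sol (of_real r) \<tau>"
    using finite_index_imp_slash_eigenfunction[OF finM l1 m6 lk T] by blast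
  show False by (rule frob_sol_not_slash_eigenfunction[OF r0 _ c(1)]) (use c(2) in blast)
qed

lemma analytic_on_eval_fps_power:
  assumes "fps_conv_radius f \<ge> 1" "m > 0"
  shows "(\<lambda>x. eval_fps f (x ^ m)) analytic_on {0}"
proof -
  have "(\<lambda>x. eval_fps f (x ^ m)) holomorphic_on ball 0 1"
  proof (rule holomorphic_on_compose_gen[unfolded comp_def, of "\<lambda>x. x ^ m" _ "eval_fps f" "ball 0 1"])
    show "eval_fps f holomorphic_on ball 0 1"
      by (rule holomorphic_on_eval_fps) (use in_conv_radius[OF assms(1)] in \<open>auto simp: in_eball_iff\<close>)
    show "(\<lambda>x. x ^ m) ` ball 0 1 \<subseteq> ball (0::complex) 1"
      using assms(2) by (auto simp: norm_power power_less_one_iff)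
  qed (auto intro!: holomorphic_intros)
  thus ?thesis by (rule holomorphic_on_imp_analytic_at) auto
qed

text \<open>Multiplying numerator and denominator by e^(pi i r tau) removes the fractional
  exponents: its square is x^n for the local parameter x = e^(2 pi i tau / m), and q = x^m. Both
  then become analytic functions of x at 0.\<close>

lemma quotient_meromorphic_at_cusp:
  fixes m n :: nat
  defines "r \<equiv> of_real (real n / real m)" and "s \<equiv> 2 * of_real pi ^ 2 * (of_real (real n / real m))\<^sup>2"
  assumes m: "m > 0" and ne: "exp (2 * of_real pi * \<i> * r) \<noteq> 1"
    and u: "lin_sol s u1" "lin_sol s u2"
    and h: "\<And>\<tau>. \<tau> \<in> upper_half_plane \<Longrightarrow> h \<tau> = u1 \<tau> / u2 \<tau>" and A: "A \<in> SL2"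
  shows "meromorphic_at_cusp h A"
proof -
  interpret solution_basis s "frob_sol r" "frob_sol (- r)"
    unfolding s_def r_def by (rule frob_basis(3)[OF ne[unfolded r_def]])
  have R: "fps_conv_radius (frob_fps r) \<ge> 1" "fps_conv_radius (frob_fps (- r)) \<ge> 1"
    by (rule frob_fps_radius[OF frob_basis(1)[OF ne]], rule frob_fps_radius[OF frob_basis(2)[OF ne]])
  have ex: "\<exists>a b. \<forall>\<tau>\<in>upper_half_plane. slash A y \<tau> = a * frob_sol r \<tau> + b * frob_sol (- r) \<tau>" if y: "lin_sol s y" for y
  proof -
    obtain a b where "\<And>\<tau>. \<tau> \<in> upper_half_plane \<Longrightarrow> slash A y \<tau> = a * frob_sol r \<tau> + b * frob_sol (- r) \<tau>"
      using solves_span[OF u v lin_sol_slash(1)[OF y A] open_H connected_H i_in_H W] by blast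
    thus ?thesis by (intro exI[of _ a] exI[of _ b]) simp
  qed
  obtain a b where ab: "\<forall>\<tau>\<in>upper_half_plane. slash A u1 \<tau> = a * frob_sol r \<tau> + b * frob_sol (- r) \<tau>"
    using ex[OF \<open>lin_sol s u1\<close>] by (elim exE)
  obtain c d where cd: "\<forall>\<tau>\<in>upper_half_plane. slash A u2 \<tau> = c * frob_sol r \<tau> + d * frob_sol (- r) \<tau>"
    using ex[OF \<open>lin_sol s u2\<close>] by (elim exE)
  let ?F = "\<lambda>x. eval_fps (frob_fps r) (x ^ m)" and ?G = "\<lambda>x. eval_fps (frob_fps (- r)) (x ^ m)"
  define g where "g = (\<lambda>x. (a * x ^ n * ?F x + b * ?G x) / (c * x ^ n * ?F x + d * ?G x))"
  have an: "?F analytic_on {0}" "?G analytic_on {0}" using R m by (auto intro!: analytic_on_eval_fps_power)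
  have "g meromorphic_on {0}" unfolding g_def
    by (intro meromorphic_on_divide analytic_on_imp_meromorphic_on analytic_intros an)
  moreover have "h (mobius A \<tau>) = g (exp (2 * of_real pi * \<i> * \<tau> / of_nat m))" if "Im \<tau> > 1" for \<tau>
  proof -
    have t: "\<tau> \<in> upper_half_plane" using that by (simp add: in_H_iff)
    define x where "x = exp (2 * of_real pi * \<i> * \<tau> / of_nat m)"
    define e where "e = exp (of_real pi * \<i> * r * \<tau>)"
    have e0: "e \<noteq> 0" by (simp add: e_def)
    have xm: "x ^ m = qexp \<tau>" using m by (simp add: x_def flip: exp_of_nat_mult)
    have xn: "x ^ n = e * e" using m by (simp add: x_def e_def r_def field_simps flip: exp_of_nat_mult exp_add)
    have y1: "frob_sol r \<tau> = e * ?F x" and y2: "frob_sol (- r) \<tau> = inverse e * ?G x"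
      by (simp_all add: frob_sol_def xm e_def exp_minus)
    have "h (mobius A \<tau>) = slash A u1 \<tau> / slash A u2 \<tau>"
      using A t jfac_nonzero[OF A t] by (simp add: h slash_def)
    also have "\<dots> = (e * slash A u1 \<tau>) / (e * slash A u2 \<tau>)" using e0 by simp
    also have "e * slash A u1 \<tau> = a * x ^ n * ?F x + b * ?G x"
      using e0 by (simp add: bspec[OF ab t] y1 y2 xn field_simps)
    also have "e * slash A u2 \<tau> = c * x ^ n * ?F x + d * ?G x"
      using e0 by (simp add: bspec[OF cd t] y1 y2 xn field_simps)
    finally show ?thesis by (simp add: g_def x_def)
  qed
  ultimately show ?thesis unfolding meromorphic_at_cusp_def
    using m by (intro exI[of _ m] exI[of _ g] exI[of _ "1::real"]) auto
qed

lemma rational_case: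
  fixes m n :: nat
  assumes mn: "m \<ge> 2" "m \<le> 5" "coprime m n"
    and h: "schwarz_solution (2 * of_real pi ^ 2 * (of_real (real n / real m))\<^sup>2) h"
  shows "modular_function h" "to_PSL2Z ` invariance_group h = to_PSL2Z ` principal_congruence_subgroup m"
proof -
  define s :: complex where "s = 2 * of_real pi ^ 2 * (of_real (real n / real m))\<^sup>2"
  have m0: "m > 0" using mn by simp
  note iff = exp_2pi_i_rational_eq_1_iff[OF m0 mn(3)]
  have ne: "exp (2 * of_real pi * \<i> * of_real (real n / real m)) \<noteq> 1"
    using iff[of 1] mn(1) by simp
  interpret solution_basis s "frob_sol (of_real (real n / real m))" "frob_sol (- of_real (real n / real m))"
    unfolding s_def by (rule frob_basis(3)[OF ne])
  have T: "Tmat j \<in> scalar_group s \<longleftrightarrow> int m dvd j" for j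
    unfolding s_def Tmat_in_scalar_group_iff[OF ne] by (rule iff)
  have m5: "int m \<in> {2,3,4,5}" using mn by auto
  note K = normal_in_SL2_scalar_group[of s]
  obtain u1 u2 where u12: "lin_sol s u1" "lin_sol s u2" "wronskian u1 u2 \<i> \<noteq> 0"
    "\<And>\<tau>. \<tau> \<in> upper_half_plane \<Longrightarrow> h \<tau> = u1 \<tau> / u2 \<tau>"
    using schwarz_solution_quotient[OF h[folded s_def] u v W] by blast
  have inv: "invariance_group h = scalar_group s"
    by (rule invariance_group_eq_scalar_group[OF u12])
  have Tm: "Tmat (int m) \<in> scalar_group s" by (simp add: T)
  show "to_PSL2Z ` invariance_group h = to_PSL2Z ` principal_congruence_subgroup m"
    unfolding inv
  proof (rule to_PSL2Z_image_eq[OF K m5 Tm])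
    show "Tmat j \<notin> scalar_group s" if "0 < j" "j < int m" for j
      unfolding T using that zdvd_not_zless by blast
    show "mat2 0 (- 1) 1 t \<notin> scalar_group s" if "\<bar>t\<bar> \<le> 1" for t
      by (rule elliptic_notin_scalar_group[OF u12(1-3) that])
  qed
  show "modular_function h" unfolding modular_function_def
  proof (intro conjI ballI)
    show "h nicely_meromorphic_on upper_half_plane" using h by (simp add: schwarz_solution_def)
    show "finite (rcosets\<^bsub>SL2Z\<^esub> (invariance_group h))"
      unfolding inv by (rule finite_rcosets_of_congruence[OF K m5 Tm])
    show "meromorphic_at_cusp h A" if "A \<in> SL2" for A
      by (rule quotient_meromorphic_at_cusp[OF m0 ne u12(1,2)[unfolded s_def] u12(4) that])
  qed
qed

lemma exp_2pi_i_eq_1_iff: "exp (2 * of_real pi * \<i> * z) = 1 \<longleftrightarrow> (\<exists>k. z = of_int k)"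
proof
  assume "exp (2 * of_real pi * \<i> * z) = 1"
  then obtain k :: int where "Im z = 0" "2 * pi * Re z = of_int (2 * k) * pi"
    by (auto simp: exp_eq_1)
  hence "z = of_int k" by (simp add: complex_eq_iff)
  thus "\<exists>k. z = of_int k" ..
next
  assume "\<exists>k. z = of_int k"
  thus "exp (2 * of_real pi * \<i> * z) = 1" by (auto simp: exp_eq_1)
qed

lemma all_modular_imp_rational:
  assumes mod: "\<And>h. schwarz_solution s h \<Longrightarrow> modular_function h"
  shows "\<exists>m n :: nat. m \<ge> 2 \<and> m \<le> 5 \<and> n > 0 \<and> coprime m n \<and> s = 2 * of_real pi ^ 2 * (of_real (real n / real m))\<^sup>2"
proof -
  \<comment> \<open>Only r^2 is determined by s; the principal root has Re r >= 0, so the integer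
    numerators found below are not negative.\<close>
  define r where "r = csqrt (s / (2 * of_real pi ^ 2))"
  have s: "s = 2 * of_real pi ^ 2 * r\<^sup>2" by (simp add: r_def)
  have r0: "Re r \<ge> 0" unfolding r_def using csqrt_principal[of "s / (2 * of_real pi ^ 2)"] by linarith
  have ne: "exp (2 * of_real pi * \<i> * r) \<noteq> 1"
  proof
    assume "exp (2 * of_real pi * \<i> * r) = 1"
    then obtain k where k: "r = of_int k" by (auto simp: exp_2pi_i_eq_1_iff)
    hence "k \<ge> 0" using r0 by simp
    then obtain n :: nat where n: "r = of_nat n" using k by (metis of_int_of_nat_eq zero_le_imp_eq_int)
    show False
    proof (cases "n = 0")
      case True
      thus False using not_all_modular_0 mod s n by simp
    next
      case False
      thus False using not_all_modular_integer[of n] mod s n by simp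
    qed
  qed
  interpret solution_basis s "frob_sol r" "frob_sol (- r)" unfolding s by (rule frob_basis(3)[OF ne])
  note fin = modular_solution_Tmat(1)[OF u v W mod]
  obtain N :: nat where N: "N > 0" "Tmat (int N) \<in> scalar_group s"
    using modular_solution_Tmat(2)[OF u v W mod] by blast
  have "exp (2 * of_real pi * \<i> * (r * of_nat N)) = 1"
    using N(2) Tmat_in_scalar_group_iff[OF ne, of "int N"] by (simp add: s mult.assoc)
  then obtain k where k: "r * of_nat N = of_int k" by (auto simp: exp_2pi_i_eq_1_iff)
  have rk: "r = of_real (of_int k / real N)" using k N(1) by (simp add: field_simps)
  have "Re r = of_int k / real N" by (simp add: rk)
  hence "k \<ge> 0" using r0 N(1) by (simp add: zero_le_divide_iff)
  moreover have "k \<noteq> 0" using ne rk by auto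
  ultimately obtain n' :: nat where n': "k = int n'" "n' > 0" by (metis of_nat_0_less_iff zero_le_imp_eq_int order_le_less)
  define g where "g = gcd n' N"
  define n where "n = n' div g"
  define m where "m = N div g"
  have g0: "g > 0" using N by (simp add: g_def)
  have ng: "n' = n * g" "N = m * g" by (simp_all add: n_def m_def g_def)
  have mn: "m > 0" "n > 0" using ng n' N by auto
  have cop: "coprime m n" using N(1) unfolding m_def n_def g_def by (simp add: div_gcd_coprime gcd.commute coprime_commute)
  have rmn: "r = of_real (real n / real m)" unfolding rk n'(1) ng using g0 by simp
  have "m \<noteq> 1" using exp_2pi_i_rational_eq_1_iff[OF mn(1) cop, of 1] ne by (auto simp: rmn)
  hence "m \<ge> 2" using mn by simp
  moreover have "m \<le> 5" by (rule order_at_most_5[OF mn cop fin[unfolded s rmn]])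
  ultimately show ?thesis using mn cop s rmn by blast
qed

theorem theorem8p3:
  fixes s :: complex
  shows "((\<forall>h. schwarz_solution s h \<longrightarrow> modular_function h) \<longleftrightarrow>
            (\<exists>m n :: nat. m > 0 \<and> n > 0 \<and> 2 \<le> m \<and> m \<le> 5 \<and> coprime m n \<and>
               s = of_real (2 * pi\<^sup>2 * (real n / real m)\<^sup>2))) \<and>
         (\<forall>m n :: nat. m > 0 \<and> n > 0 \<and> 2 \<le> m \<and> m \<le> 5 \<and> coprime m n \<and>
               s = of_real (2 * pi\<^sup>2 * (real n / real m)\<^sup>2) \<longrightarrow>
            (\<forall>h. schwarz_solution s h \<longrightarrow>
               to_PSL2Z ` invariance_group h = to_PSL2Z ` principal_congruence_subgroup m))"
proof -
  have e: "of_real (2 * pi\<^sup>2 * (real n / real m)\<^sup>2) = (2 * of_real pi ^ 2 * (of_real (real n / real m))\<^sup>2 :: complex)" for m n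
    by simp
  show ?thesis unfolding e
  proof (intro conjI iffI allI impI)
    assume "\<forall>h. schwarz_solution s h \<longrightarrow> modular_function h"
    hence "\<exists>m n :: nat. m \<ge> 2 \<and> m \<le> 5 \<and> n > 0 \<and> coprime m n \<and> s = 2 * of_real pi ^ 2 * (of_real (real n / real m))\<^sup>2"
      by (intro all_modular_imp_rational) blast
    then obtain m n :: nat where "m \<ge> 2" "m \<le> 5" "n > 0" "coprime m n" "s = 2 * of_real pi ^ 2 * (of_real (real n / real m))\<^sup>2"
      by blast
    thus "\<exists>m n :: nat. m > 0 \<and> n > 0 \<and> 2 \<le> m \<and> m \<le> 5 \<and> coprime m n \<and>
        s = 2 * of_real pi ^ 2 * (of_real (real n / real m))\<^sup>2"
      by (intro exI[of _ m] exI[of _ n]) simp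
  qed (use rational_case in blast)+
qed

end
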